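(* Let $L>0$ be fixed and consider $\omega>\omega_L:=\frac18\left(\frac{\sqrt{L^2+16\pi^2}}{L}+\frac{8\pi^2}{L^2}-1\right)$. Let $\phi=\phi_\omega$ be the dnoidal wave of fundamental period $L$. The operator $$\mathcal{L}=\begin{pmatrix}-\partial_x^2+\omega-3\phi^2-5\phi^4&0\\0&-\partial_x^2+\omega-\phi^2-\phi^4\end{pmatrix}$$ defined in $\mathbb{L}^2_{per}$ with domain $\mathbb{H}^2_{per}$ has a unique negative eigenvalue, which is simple, and zero is a double eigenvalue with corresponding eigenfunctions $(\phi',0)$ and $(0,\phi)$. Moreover, the remainder of the spectrum of $\mathcal{L}$ is constituted by a discrete set of eigenvalues bounded away from zero.
   Context: $H^s_{per}=H^s_{per}([0,L])$ is the $L$-periodic Sobolev space ($L^2_{per}=H^0_{per}$); $\mathbb{L}^2_{per}=L^2_{per}\times L^2_{per}$ and $\mathbb{H}^2_{per}=H^2_{per}\times H^2_{per}$. $K(k)=\int_0^{\pi/2}(1-k^2\sin^2t)^{-1/2}dt$; $\mathrm{sn}(\cdot,k)$, $\mathrm{dn}(\cdot,k)$ are the Jacobi elliptic functions of modulus $k$. For $\omega>0$ and $\alpha_3\in\left(\frac{\sqrt{1+4\omega}-1}{2},\frac{\sqrt{48\omega+9}-3}{4}\right)$ put $q(\alpha_3)=16\omega-4\alpha_3^2-4\alpha_3+3>0$, $\alpha_1=-\frac{\sqrt3\sqrt{q(\alpha_3)}+2\alpha_3+3}{4}$, $\alpha_2=\frac{\sqrt3\sqrt{q(\alpha_3)}-2\alpha_3-3}{4}$,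 $g=\frac{2}{\sqrt{\alpha_3(\alpha_2-\alpha_1)}}$, $k^2=\frac{-\alpha_1(\alpha_3-\alpha_2)}{\alpha_3(\alpha_2-\alpha_1)}$, $\beta^2=-\frac{\alpha_3}{\alpha_1}k^2$. The dnoidal wave is $$\phi(x)=\frac{\sqrt{\alpha_3}\,\mathrm{dn}\left(\frac{2}{\sqrt3 g}x,k\right)}{\sqrt{1+\beta^2\mathrm{sn}^2\left(\frac{2}{\sqrt3 g}x,k\right)}};$$ it solves $-\phi''+\omega\phi-\phi^3-\phi^5=0$ and has fundamental period $\frac{2\sqrt3K(k)}{\sqrt{\alpha_3(\alpha_2-\alpha_1)}}$. For $\omega>\omega_L$, $\phi_\omega$ denotes the dnoidal wave for the unique $\alpha_3\in\left(\frac{\sqrt{1+4\omega}-1}{2},\frac{\sqrt{48\omega+9}-3}{4}\right)$ for which the fundamental period $\frac{2\sqrt3K(k)}{\sqrt{\alpha_3(\alpha_2-\alpha_1)}}$ equals $L$. *)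

theory Defs
  imports "HOL-Analysis.Analysis"
begin

section \<open>Jacobi elliptic functions (real argument, modulus $0 \le k < 1$)\<close>

definition ellF :: "real \<Rightarrow> real \<Rightarrow> real" where
  "ellF p k = (LBINT t=0..p. 1 / sqrt (1 - k\<^sup>2 * (sin t)\<^sup>2))"

definition ellK :: "real \<Rightarrow> real" where
  "ellK k = ellF (pi / 2) k"

text \<open>The Jacobi amplitude is the inverse of \<open>p \<mapsto> ellF p k\<close>, which for \<open>0 \<le> k < 1\<close> is an
  increasing bijection of the real line.\<close>

definition jacobi_am :: "real \<Rightarrow> real \<Rightarrow> real" where
  "jacobi_am u k = (THE p. ellF p k = u)"

definition jacobi_sn :: "real \<Rightarrow> real \<Rightarrow> real" where
  "jacobi_sn u k = sin (jacobi_am u k)"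

definition jacobi_dn :: "real \<Rightarrow> real \<Rightarrow> real" where
  "jacobi_dn u k = sqrt (1 - k\<^sup>2 * (jacobi_sn u k)\<^sup>2)"


section \<open>The dnoidal wave\<close>

definition omegaL :: "real \<Rightarrow> real" where
  "omegaL L = 1 / 8 * (sqrt (L\<^sup>2 + 16 * pi\<^sup>2) / L + 8 * pi\<^sup>2 / L\<^sup>2 - 1)"

definition alpha3_range :: "real \<Rightarrow> real set" where
  "alpha3_range \<omega> = {(sqrt (1 + 4 * \<omega>) - 1) / 2 <..< (sqrt (48 * \<omega> + 9) - 3) / 4}"

definition dn_q :: "real \<Rightarrow> real \<Rightarrow> real" where
  "dn_q \<omega> a3 = 16 * \<omega> - 4 * a3\<^sup>2 - 4 * a3 + 3"

definition alpha1 :: "real \<Rightarrow> real \<Rightarrow> real" where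
  "alpha1 \<omega> a3 = - (sqrt 3 * sqrt (dn_q \<omega> a3) + 2 * a3 + 3) / 4"

definition alpha2 :: "real \<Rightarrow> real \<Rightarrow> real" where
  "alpha2 \<omega> a3 = (sqrt 3 * sqrt (dn_q \<omega> a3) - 2 * a3 - 3) / 4"

definition dn_g :: "real \<Rightarrow> real \<Rightarrow> real" where
  "dn_g \<omega> a3 = 2 / sqrt (a3 * (alpha2 \<omega> a3 - alpha1 \<omega> a3))"

definition dn_k :: "real \<Rightarrow> real \<Rightarrow> real" where
  "dn_k \<omega> a3 =
     sqrt (- alpha1 \<omega> a3 * (a3 - alpha2 \<omega> a3) / (a3 * (alpha2 \<omega> a3 - alpha1 \<omega> a3)))"

text \<open>This is the quantity written $\beta^2$; only the square of $\beta$ is ever used.\<close>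

definition dn_beta2 :: "real \<Rightarrow> real \<Rightarrow> real" where
  "dn_beta2 \<omega> a3 = - (a3 / alpha1 \<omega> a3) * (dn_k \<omega> a3)\<^sup>2"

definition dnoidal :: "real \<Rightarrow> real \<Rightarrow> real \<Rightarrow> real" where
  "dnoidal \<omega> a3 x =
     (let u = 2 / (sqrt 3 * dn_g \<omega> a3) * x; k = dn_k \<omega> a3
      in sqrt a3 * jacobi_dn u k / sqrt (1 + dn_beta2 \<omega> a3 * (jacobi_sn u k)\<^sup>2))"

definition dnoidal_period :: "real \<Rightarrow> real \<Rightarrow> real" where
  "dnoidal_period \<omega> a3 =
     2 * sqrt 3 * ellK (dn_k \<omega> a3) / sqrt (a3 * (alpha2 \<omega> a3 - alpha1 \<omega> a3))"


section \<open>Periodic Lebesgue and Sobolev spaces\<close>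

text \<open>Spectra are taken over the complex numbers, so the function spaces are complex.
  Elements of $L^2_{per}$ are represented by \<open>L\<close>-periodic Borel functions on the real line;
  two representatives are the same element iff they agree almost everywhere, and all notions
  below are understood modulo that relation.\<close>

definition L2per :: "real \<Rightarrow> (real \<Rightarrow> complex) set" where
  "L2per L = {f. f \<in> borel_measurable borel \<and> (\<forall>x. f (x + L) = f x) \<and>
                 set_integrable lborel {0..L} (\<lambda>x. (cmod (f x))\<^sup>2)}"

definition smooth_periodic :: "real \<Rightarrow> (real \<Rightarrow> real) \<Rightarrow> bool" where
  "smooth_periodic L \<psi> \<longleftrightarrow>
     (\<forall>x. \<psi> (x + L) = \<psi> x) \<and> (\<forall>n. (deriv ^^ n) \<psi> differentiable_on UNIV)"

text \<open>\<open>v\<close> is the weak (periodic distributional) derivative of \<open>u\<close>.\<close>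

definition is_weak_deriv :: "real \<Rightarrow> (real \<Rightarrow> complex) \<Rightarrow> (real \<Rightarrow> complex) \<Rightarrow> bool" where
  "is_weak_deriv L u v \<longleftrightarrow>
     (\<forall>\<psi>. smooth_periodic L \<psi> \<longrightarrow>
        (LINT x:{0..L}|lborel. u x * complex_of_real (deriv \<psi> x)) =
        - (LINT x:{0..L}|lborel. v x * complex_of_real (\<psi> x)))"

definition H2per :: "real \<Rightarrow> (real \<Rightarrow> complex) set" where
  "H2per L = {u \<in> L2per L. \<exists>v\<in>L2per L. \<exists>w\<in>L2per L. is_weak_deriv L u v \<and> is_weak_deriv L v w}"

text \<open>A representative of the weak derivative, which is unique up to null sets.\<close>

definition wderiv :: "real \<Rightarrow> (real \<Rightarrow> complex) \<Rightarrow> real \<Rightarrow> complex" where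
  "wderiv L u = (SOME v. v \<in> L2per L \<and> is_weak_deriv L u v)"

type_synonym cpair = "(real \<Rightarrow> complex) \<times> (real \<Rightarrow> complex)"

definition LL2per :: "real \<Rightarrow> cpair set" where
  "LL2per L = L2per L \<times> L2per L"

definition HH2per :: "real \<Rightarrow> cpair set" where
  "HH2per L = H2per L \<times> H2per L"

definition LL2norm :: "real \<Rightarrow> cpair \<Rightarrow> real" where
  "LL2norm L U = sqrt ((LINT x:{0..L}|lborel. (cmod (fst U x))\<^sup>2) +
                       (LINT x:{0..L}|lborel. (cmod (snd U x))\<^sup>2))"

definition pair_aeq :: "cpair \<Rightarrow> cpair \<Rightarrow> bool" (infix \<open>=\<^sub>a\<^sub>e\<close> 50) where
  "U =\<^sub>a\<^sub>e V \<longleftrightarrow> (AE x in lborel. fst U x = fst V x \<and> snd U x = snd V x)"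

definition pair_zero :: cpair where
  "pair_zero = (\<lambda>x. 0, \<lambda>x. 0)"

definition pair_lincomb :: "(nat \<Rightarrow> complex) \<Rightarrow> cpair list \<Rightarrow> cpair" where
  "pair_lincomb c Us = (\<lambda>x. \<Sum>i<length Us. c i * fst (Us ! i) x,
                        \<lambda>x. \<Sum>i<length Us. c i * snd (Us ! i) x)"

text \<open>\<open>Us\<close> represents a basis of the space of classes of elements of \<open>E\<close>.\<close>

definition is_basis_ae :: "cpair list \<Rightarrow> cpair set \<Rightarrow> bool" where
  "is_basis_ae Us E \<longleftrightarrow>
     set Us \<subseteq> E \<and>
     (\<forall>c. pair_lincomb c Us =\<^sub>a\<^sub>e pair_zero \<longrightarrow> (\<forall>i<length Us. c i = 0)) \<and>
     (\<forall>U\<in>E. \<exists>c. U =\<^sub>a\<^sub>e pair_lincomb c Us)"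


section \<open>Spectral notions for an operator in \<open>LL2per L\<close> with domain \<open>HH2per L\<close>\<close>

definition op_minus :: "(cpair \<Rightarrow> cpair) \<Rightarrow> complex \<Rightarrow> cpair \<Rightarrow> cpair" where
  "op_minus T \<mu> U = (\<lambda>x. fst (T U) x - \<mu> * fst U x, \<lambda>x. snd (T U) x - \<mu> * snd U x)"

definition eigenspace :: "real \<Rightarrow> (cpair \<Rightarrow> cpair) \<Rightarrow> complex \<Rightarrow> cpair set" where
  "eigenspace L T \<mu> = {U \<in> HH2per L. op_minus T \<mu> U =\<^sub>a\<^sub>e pair_zero}"

definition is_eigenvalue :: "real \<Rightarrow> (cpair \<Rightarrow> cpair) \<Rightarrow> complex \<Rightarrow> bool" where
  "is_eigenvalue L T \<mu> \<longleftrightarrow> (\<exists>U\<in>eigenspace L T \<mu>. \<not> U =\<^sub>a\<^sub>e pair_zero)"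

text \<open>Dimension of the eigenspace; for a self-adjoint operator this is also the algebraic
  multiplicity.\<close>

definition has_multiplicity :: "real \<Rightarrow> (cpair \<Rightarrow> cpair) \<Rightarrow> complex \<Rightarrow> nat \<Rightarrow> bool" where
  "has_multiplicity L T \<mu> n \<longleftrightarrow>
     (\<exists>Us. length Us = n \<and> is_basis_ae Us (eigenspace L T \<mu>))"

text \<open>\<open>T - \<mu>\<close> is a bijection of the domain onto the whole space, with bounded inverse.\<close>

definition resolvent_set :: "real \<Rightarrow> (cpair \<Rightarrow> cpair) \<Rightarrow> complex set" where
  "resolvent_set L T = {\<mu>.
     (\<forall>U\<in>HH2per L. op_minus T \<mu> U \<in> LL2per L) \<and>
     (\<forall>F\<in>LL2per L. \<exists>U\<in>HH2per L. op_minus T \<mu> U =\<^sub>a\<^sub>e F \<and>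
        (\<forall>U'\<in>HH2per L. op_minus T \<mu> U' =\<^sub>a\<^sub>e F \<longrightarrow> U' =\<^sub>a\<^sub>e U)) \<and>
     (\<exists>C. \<forall>U\<in>HH2per L. LL2norm L U \<le> C * LL2norm L (op_minus T \<mu> U))}"

definition op_spectrum :: "real \<Rightarrow> (cpair \<Rightarrow> cpair) \<Rightarrow> complex set" where
  "op_spectrum L T = - resolvent_set L T"


section \<open>The linearized operator\<close>

definition schroedinger :: "real \<Rightarrow> (real \<Rightarrow> real) \<Rightarrow> (real \<Rightarrow> complex) \<Rightarrow> real \<Rightarrow> complex" where
  "schroedinger L V u = (\<lambda>x. - wderiv L (wderiv L u) x + complex_of_real (V x) * u x)"

definition lin_op :: "real \<Rightarrow> real \<Rightarrow> (real \<Rightarrow> real) \<Rightarrow> cpair \<Rightarrow> cpair" where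
  "lin_op L \<omega> \<phi> U =
     (schroedinger L (\<lambda>x. \<omega> - 3 * \<phi> x ^ 2 - 5 * \<phi> x ^ 4) (fst U),
      schroedinger L (\<lambda>x. \<omega> - \<phi> x ^ 2 - \<phi> x ^ 4) (snd U))"

end

theory Submission
  imports Defs
begin

text \<open>With \<open>a > b > 0 > -c\<close> the roots of the energy polynomial \<open>P\<close>, the wave satisfies
  \<open>\<phi>'\<^sup>2 = P(\<phi>\<^sup>2)\<close>, is even about \<open>0\<close> and \<open>L/2\<close> and decreases from \<open>\<surd>a\<close> to \<open>\<surd>b\<close> in between.
  The operator is diagonal, so only scalar periodic Schroedinger operators matter.
  As \<open>\<phi> > 0\<close> is in the kernel of the second one, that operator is nonnegative with kernel spanned
  by \<open>\<phi>\<close>.  The kernel of the first one contains \<open>\<phi>'\<close>, which is odd and vanishes only at multiples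
  of \<open>L/2\<close>.  The even solution \<open>y\<close> of the same equation is computed by reduction of order; the sign of
  \<open>y'(L/2)\<close>, which expresses the monotone dependence of the period on the energy, shows that
  \<open>y\<close> is not periodic, so the kernel is spanned by \<open>\<phi>'\<close>.  Splitting eigenfunctions for negative
  eigenvalues into odd and even parts, Sturm comparison with \<open>\<phi>'\<close> excludes the odd ones, and
  comparison with \<open>y\<close>, which changes sign once on the half period, leaves exactly one even one.

  Variation of constants inverts \<open>-\<partial>\<^sup>2 + V - \<mu>\<close> unless \<open>\<mu>\<close> is a periodic eigenvalue.  Eigenvalues
  cannot accumulate: the initial data of normalised eigenfunctions would have a convergent
  subsequence, but eigenfunctions for different eigenvalues are orthogonal.\<close>

section \<open>The inhomogeneous Hill equation\<close>

text \<open>The operator acts on almost-everywhere classes, and \<open>wderiv\<close> takes its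
  values by choice, so nothing can be evaluated pointwise at first. The bridge is a period cell: an
  element of \<open>H2per\<close> has a \<open>C^1\<close> representative on [0, L] with matching
  end values, and an eigenfunction then satisfies a classical linear system there. Resolvent sources
  are only square integrable; subtracting a double primitive of the source leaves a continuous one,
  at the price of non-periodic end values. This is why the periodic problem is solved with
  prescribed jumps. The spectral part never touches elliptic functions. It uses the energy relation
  and the symmetry of the orbit, for any 0 < b < a and 0 < c; the relations between a, b, c and
  \<omega> enter only when the two potentials are recognised. All sign information about the period
  is condensed into one explicit function y.\<close>

lemma Icc_deriv_nonneg_mono:
  fixes f f' :: "real \<Rightarrow> real"
  assumes d: "\<And>x. x \<in> {a..b} \<Longrightarrow> (f has_real_derivative f' x) (at x within {a..b})"
    and nn: "\<And>x. a < x \<Longrightarrow> x < b \<Longrightarrow> f' x \<ge> 0" and st: "a \<le> s" "s \<le> t" "t \<le> b"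
  shows "f s \<le> f t"
proof (rule DERIV_nonneg_imp_increasing_open[OF st(2)])
  show "\<exists>y. (f has_real_derivative y) (at x) \<and> 0 \<le> y" if "s < x" "x < t" for x
  proof -
    have "at x within {a..b} = at x" using that st by (intro at_within_Icc_at) auto
    then show ?thesis using d[of x] nn[of x] that st by auto
  qed
  show "continuous_on {s..t} f"
    using st by (intro continuous_on_subset[OF DERIV_continuous_on[OF d]]) auto
qed

lemma Icc_deriv_pos_strict_mono:
  fixes f f' :: "real \<Rightarrow> real"
  assumes d: "\<And>x. x \<in> {a..b} \<Longrightarrow> (f has_real_derivative f' x) (at x within {a..b})"
    and nn: "\<And>x. s < x \<Longrightarrow> x < t \<Longrightarrow> f' x > 0" and st: "a \<le> s" "s < t" "t \<le> b"
  shows "f s < f t"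
proof (rule DERIV_pos_imp_increasing_open[OF st(2)])
  show "\<exists>y. (f has_real_derivative y) (at x) \<and> 0 < y" if "s < x" "x < t" for x
  proof -
    have "at x within {a..b} = at x" using that st by (intro at_within_Icc_at) auto
    then show ?thesis using d[of x] nn[of x] that st by auto
  qed
  show "continuous_on {s..t} f"
    using st by (intro continuous_on_subset[OF DERIV_continuous_on[OF d]]) auto
qed

lemma continuous_on_Icc_bound:
  fixes f :: "real \<Rightarrow> 'a :: real_normed_vector"
  assumes "continuous_on {a..b} f"
  obtains C where "0 \<le> C" "\<And>x. x \<in> {a..b} \<Longrightarrow> norm (f x) \<le> C"
proof -
  have "bounded (f ` {a..b})" using assms by (intro compact_imp_bounded compact_continuous_image) auto
  then obtain C where "\<And>x. x \<in> {a..b} \<Longrightarrow> norm (f x) \<le> C" unfolding bounded_iff by blast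
  then show ?thesis using that[of "max C 0"] by fastforce
qed

text \<open>u'' = q u + r as a first-order system on the closed cell, with one-sided derivatives at
  its ends. The spectral parameter is absorbed in q, and periodicity is imposed separately by
  comparing u and v at 0 and l.\<close>

definition hill_sol ::
  "(real \<Rightarrow> complex) \<Rightarrow> (real \<Rightarrow> complex) \<Rightarrow> real \<Rightarrow> (real \<Rightarrow> complex) \<Rightarrow> (real \<Rightarrow> complex) \<Rightarrow> bool" where
  "hill_sol q r l u v \<longleftrightarrow> (\<forall>x\<in>{0..l}. (u has_vector_derivative v x) (at x within {0..l}) \<and>
      (v has_vector_derivative (q x * u x + r x)) (at x within {0..l}))"

lemma hill_solD:
  assumes "hill_sol q r l u v" "x \<in> {0..l}"
  shows "(u has_vector_derivative v x) (at x within {0..l})"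
    and "(v has_vector_derivative (q x * u x + r x)) (at x within {0..l})"
  using assms by (auto simp: hill_sol_def)

lemma hill_sol_continuous:
  assumes "hill_sol q r l u v"
  shows "continuous_on {0..l} u" "continuous_on {0..l} v"
  using assms unfolding hill_sol_def by (auto intro: continuous_on_vector_derivative)

lemma hill_sol_lincomb:
  assumes "hill_sol q r l u v" "hill_sol q r' l u' v'"
  shows "hill_sol q (\<lambda>x. c * r x + d * r' x) l (\<lambda>x. c * u x + d * u' x) (\<lambda>x. c * v x + d * v' x)"
  unfolding hill_sol_def
proof (intro ballI conjI)
  fix x assume x: "x \<in> {0..l}"
  note D = hill_solD[OF assms(1) x] hill_solD[OF assms(2) x]
  show "((\<lambda>x. c * u x + d * u' x) has_vector_derivative c * v x + d * v' x) (at x within {0..l})"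
    by (intro has_vector_derivative_add has_vector_derivative_mult_right D)
  have "((\<lambda>x. c * v x + d * v' x) has_vector_derivative c * (q x * u x + r x) + d * (q x * u' x + r' x)) (at x within {0..l})"
    by (intro has_vector_derivative_add has_vector_derivative_mult_right D)
  then show "((\<lambda>x. c * v x + d * v' x) has_vector_derivative q x * (c * u x + d * u' x) + (c * r x + d * r' x)) (at x within {0..l})"
    by (simp add: algebra_simps)
qed

text \<open>Gronwall for e = |u|^2 + |v|^2: splitting each product by 2xy <= x^2 + y^2 gives e' <=
  (2 + Q) e + R^2, so R^2 x - e exp(-(2 + Q) x) is nondecreasing.\<close>

lemma hill_sol_energy_bound:
  assumes sol: "hill_sol q r l u v"
    and q: "\<And>x. x \<in> {0..l} \<Longrightarrow> cmod (q x) \<le> Q" and r: "\<And>x. x \<in> {0..l} \<Longrightarrow> cmod (r x) \<le> R"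
    and x: "x \<in> {0..l}"
  shows "(cmod (u x))\<^sup>2 + (cmod (v x))\<^sup>2 \<le> exp ((2 + Q) * l) * ((cmod (u 0))\<^sup>2 + (cmod (v 0))\<^sup>2 + l * R\<^sup>2)"
proof -
  have l: "0 \<le> l" using x by auto
  have Q0: "0 \<le> Q" using q[OF x] norm_ge_zero order_trans by blast
  have R0: "0 \<le> R" using r[OF x] norm_ge_zero order_trans by blast
  define K where "K = 2 + Q"
  define e where "e x = u x \<bullet> u x + v x \<bullet> v x" for x
  define e' where "e' x = 2 * (u x \<bullet> v x) + 2 * (v x \<bullet> (q x * u x + r x))" for x
  define f where "f x = R\<^sup>2 * x - e x * exp (- (K * x))" for x
  have de: "(e has_real_derivative e' x) (at x within {0..l})" if "x \<in> {0..l}" for x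
  proof -
    note D = hill_solD[OF sol that]
    have "(e has_derivative (\<lambda>h. (u x \<bullet> (h *\<^sub>R v x) + (h *\<^sub>R v x) \<bullet> u x) +
        (v x \<bullet> (h *\<^sub>R (q x * u x + r x)) + (h *\<^sub>R (q x * u x + r x)) \<bullet> v x))) (at x within {0..l})"
      unfolding e_def
      by (intro has_derivative_add has_derivative_inner D[unfolded has_vector_derivative_def])
    then show ?thesis
      unfolding has_field_derivative_def
      by (rule has_derivative_eq_rhs) (auto simp: e'_def inner_commute algebra_simps)
  qed
  have df: "(f has_real_derivative (R\<^sup>2 - (e' x * exp (-(K*x)) - K * e x * exp (-(K*x))))) (at x within {0..l})"
    if "x \<in> {0..l}" for x
    unfolding f_def
    by (rule derivative_eq_intros de[OF that] refl)+ (auto simp: algebra_simps)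
  have le: "e' x \<le> K * e x + R\<^sup>2" if "x \<in> {0..l}" for x
  proof -
    have 1: "u x \<bullet> v x \<le> cmod (u x) * cmod (v x)" by (rule norm_cauchy_schwarz)
    have 2: "v x \<bullet> (q x * u x + r x) \<le> cmod (v x) * (Q * cmod (u x) + R)"
    proof (rule order_trans[OF norm_cauchy_schwarz])
      have "cmod (q x * u x + r x) \<le> cmod (q x) * cmod (u x) + cmod (r x)"
        by (metis norm_mult norm_triangle_ineq)
      also have "\<dots> \<le> Q * cmod (u x) + R"
        using q[OF that] r[OF that] by (intro add_mono mult_right_mono) auto
      finally show "cmod (v x) * cmod (q x * u x + r x) \<le> cmod (v x) * (Q * cmod (u x) + R)"
        by (intro mult_left_mono) auto
    qed
    define U V where "U = cmod (u x)" and "V = cmod (v x)"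
    have ex: "e x = U\<^sup>2 + V\<^sup>2" by (simp add: e_def U_def V_def power2_norm_eq_inner)
    have uv: "2 * (U * V) \<le> U\<^sup>2 + V\<^sup>2" using sum_squares_bound[of U V] by simp
    have vr: "2 * (V * R) \<le> V\<^sup>2 + R\<^sup>2" using sum_squares_bound[of V R] by simp
    have "e' x \<le> 2 * (U * V) + Q * (2 * (U * V)) + 2 * (V * R)"
      using 1 2 unfolding e'_def U_def V_def by (simp add: algebra_simps)
    also have "\<dots> \<le> (U\<^sup>2 + V\<^sup>2) + Q * (U\<^sup>2 + V\<^sup>2) + (V\<^sup>2 + R\<^sup>2)"
      using uv vr mult_left_mono[OF uv Q0] by linarith
    also have "\<dots> \<le> K * e x + R\<^sup>2" unfolding ex K_def by (simp add: algebra_simps)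
    finally show ?thesis .
  qed
  have "f 0 \<le> f x"
  proof (rule Icc_deriv_nonneg_mono[OF df])
    show "0 \<le> R\<^sup>2 - (e' x * exp (-(K*x)) - K * e x * exp (-(K*x)))" if "0 < x" "x < l" for x
    proof -
      have "(e' x - K * e x) * exp (-(K*x)) \<le> R\<^sup>2 * 1"
      proof (cases "e' x - K * e x \<le> 0")
        case True
        then have "(e' x - K * e x) * exp (-(K*x)) \<le> 0" by (simp add: mult_nonpos_nonneg)
        then show ?thesis by (smt (verit) zero_le_power2)
      next
        case False
        have "exp (-(K*x)) \<le> 1" using that Q0 by (simp add: K_def)
        then show ?thesis using False le[of x] that by (intro mult_mono) auto
      qed
      then show ?thesis by (simp add: algebra_simps)
    qed
  qed (use x in auto)
  then have "e x * exp (-(K*x)) \<le> e 0 + R\<^sup>2 * x" by (simp add: f_def)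
  also have "\<dots> \<le> e 0 + l * R\<^sup>2" using x by (simp add: mult.commute mult_right_mono)
  finally have *: "e x * exp (-(K*x)) \<le> e 0 + l * R\<^sup>2" .
  have "e x = e x * exp (-(K*x)) * exp (K*x)" by (simp add: exp_minus field_simps)
  also have "\<dots> \<le> (e 0 + l * R\<^sup>2) * exp (K*x)" using * by (intro mult_right_mono) auto
  also have "\<dots> \<le> (e 0 + l * R\<^sup>2) * exp (K*l)"
    using x Q0 l by (intro mult_left_mono) (auto simp: K_def e_def mult_left_mono)
  finally show ?thesis by (simp add: e_def power2_norm_eq_inner K_def mult.commute)
qed

lemma hill_sol_eq_0:
  assumes sol: "hill_sol q (\<lambda>x. 0) l u v" and q: "continuous_on {0..l} q"
    and 0: "u 0 = 0" "v 0 = 0" and x: "x \<in> {0..l}"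
  shows "u x = 0 \<and> v x = 0"
proof -
  obtain Q where "\<And>x. x \<in> {0..l} \<Longrightarrow> cmod (q x) \<le> Q"
    using continuous_on_Icc_bound[OF q] by blast
  from hill_sol_energy_bound[OF sol this, of 0 x] x 0
  have "(cmod (u x))\<^sup>2 + (cmod (v x))\<^sup>2 \<le> 0" by simp
  then show ?thesis by (simp add: sum_power2_le_zero_iff)
qed

lemma hill_sol_unique:
  assumes "hill_sol q r l u v" "hill_sol q r l u' v'" and q: "continuous_on {0..l} q"
    and 0: "u 0 = u' 0" "v 0 = v' 0" and x: "x \<in> {0..l}"
  shows "u x = u' x \<and> v x = v' x"
proof -
  have "hill_sol q (\<lambda>x. 0) l (\<lambda>x. 1 * u x + (-1) * u' x) (\<lambda>x. 1 * v x + (-1) * v' x)"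
    using hill_sol_lincomb[OF assms(1,2), of 1 "-1"] by simp
  from hill_sol_eq_0[OF this q _ _ x] 0 show ?thesis by simp
qed

text \<open>Picard iteration for the integral equation u = g + J(q u), where g carries the initial
  data and the source.\<close>

lemma hill_sol_exists:
  assumes l: "0 \<le> l" and q: "continuous_on {0..l} q" and r: "continuous_on {0..l} r"
  obtains u v where "hill_sol q r l u v" "u 0 = \<xi>" "v 0 = \<eta>"
proof -
  \<comment> \<open>The double primitive, that is, the integral of (x - t) h(t). With x pulled out
    of the integral it is differentiated by the product rule and the fundamental theorem.\<close>
  define J where "J h x = of_real x * integral {0..x} h - integral {0..x} (\<lambda>t. of_real t * h t)"
    for h :: "real \<Rightarrow> complex" and x
  have J_deriv: "(J h has_vector_derivative integral {0..x} h) (at x within {0..l})"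
    if h: "continuous_on {0..l} h" and x: "x \<in> {0..l}" for h x
  proof -
    have "((\<lambda>x. of_real x * integral {0..x} h - integral {0..x} (\<lambda>t. of_real t * h t))
       has_vector_derivative (of_real x * h x + of_real 1 * integral {0..x} h) - of_real x * h x) (at x within {0..l})"
      by (intro has_vector_derivative_diff has_vector_derivative_mult has_vector_derivative_of_real
         integral_has_vector_derivative[OF _ x] continuous_intros h) (auto intro!: derivative_eq_intros)
    then show ?thesis by (simp add: J_def[abs_def])
  qed
  have J_cont: "continuous_on {0..l} (J h)" if "continuous_on {0..l} h" for h
    using J_deriv[OF that] by (rule continuous_on_vector_derivative)
  have J_eq: "((\<lambda>t. of_real (x - t) * h t) has_integral J h x) {0..x}"
    if h: "continuous_on {0..l} h" and x: "x \<in> {0..l}" for h x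
  proof -
    have hx: "continuous_on {0..x} h" using h x by (auto intro: continuous_on_subset)
    have "((\<lambda>t. of_real x * h t - of_real t * h t) has_integral J h x) {0..x}"
      unfolding J_def
      by (intro has_integral_diff has_integral_mult_right integrable_integral
            integrable_continuous_real continuous_intros hx)
    then show ?thesis by (simp add: algebra_simps)
  qed
  obtain Q0 where Qn: "0 \<le> Q0" and Q0: "\<And>x. x \<in> {0..l} \<Longrightarrow> cmod (q x) \<le> Q0"
    using continuous_on_Icc_bound[OF q] by blast
  define g where "g x = \<xi> + of_real x * \<eta> + J r x" for x
  have g: "continuous_on {0..l} g" unfolding g_def by (intro continuous_intros J_cont r)
  obtain M where Mn: "0 \<le> M" and M: "\<And>x. x \<in> {0..l} \<Longrightarrow> cmod (g x) \<le> M"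
    using continuous_on_Icc_bound[OF g] by blast
  define w where "w = rec_nat g (\<lambda>_ f. J (\<lambda>t. q t * f t))"
  have w0: "w 0 = g" and wS: "w (Suc n) = J (\<lambda>t. q t * w n t)" for n by (auto simp: w_def)
  have wc: "continuous_on {0..l} (w n)" for n
    by (induction n) (auto simp: w0 wS intro!: g J_cont continuous_intros q)
  have qw: "continuous_on {0..l} (\<lambda>t. q t * w n t)" for n by (intro continuous_on_mult q wc)
  \<comment> \<open>In \<open>wb\<close> the factor x - t is bounded only by l, so each iterate
    gains one power of x rather than two; the factorial still makes the series converge
    uniformly.\<close>
  define K where "K = l * Q0"
  have Kn: "0 \<le> K" using Qn l by (simp add: K_def)
  have wb: "\<forall>x\<in>{0..l}. cmod (w n x) \<le> M * ((K * x) ^ n / fact n)" for n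
  proof (induction n)
    case 0
    then show ?case using M by (simp add: w0)
  next
    case (Suc n)
    show ?case
    proof
      fix x assume x: "x \<in> {0..l}"
      define b where "b t = l * Q0 * (M * ((K * t) ^ n / fact n))" for t
      have bi: "(b has_integral M * ((K * x) ^ Suc n / fact (Suc n)) - M * ((K * 0) ^ Suc n / fact (Suc n))) {0..x}"
      proof (rule fundamental_theorem_of_calculus)
        show "0 \<le> x" using x by auto
        fix t assume "t \<in> {0..x}"
        have "((\<lambda>x. M * ((K * x) ^ Suc n / fact (Suc n))) has_real_derivative
            M * ((real (Suc n) * (K * t) ^ n * K) / fact (Suc n))) (at t within {0..x})"
          by (rule derivative_eq_intros refl | simp)+
        also have "M * ((real (Suc n) * (K * t) ^ n * K) / fact (Suc n)) = b t"
          by (simp add: b_def K_def divide_simps)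
        finally show "((\<lambda>x. M * ((K * x) ^ Suc n / fact (Suc n))) has_vector_derivative b t) (at t within {0..x})"
          by (simp add: has_real_derivative_iff_has_vector_derivative)
      qed
      have "cmod (integral {0..x} (\<lambda>t. of_real (x - t) * (q t * w n t))) \<le> integral {0..x} b"
      proof (rule integral_norm_bound_integral)
        show "(\<lambda>t. of_real (x - t) * (q t * w n t)) integrable_on {0..x}"
          by (rule has_integral_integrable[OF J_eq[OF qw x]])
        show "b integrable_on {0..x}" using bi by blast
        fix t assume t: "t \<in> {0..x}"
        have "cmod (of_real (x - t) * (q t * w n t)) = \<bar>x - t\<bar> * (cmod (q t) * cmod (w n t))"
          by (simp add: norm_mult del: of_real_diff)
        also have "\<dots> \<le> l * (Q0 * (M * ((K * t) ^ n / fact n)))"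
          using t x Suc.IH Q0 l Qn by (intro mult_mono) auto
        finally show "cmod (of_real (x - t) * (q t * w n t)) \<le> b t" by (simp add: b_def)
      qed
      then show "cmod (w (Suc n) x) \<le> M * ((K * x) ^ Suc n / fact (Suc n))"
        unfolding integral_unique[OF J_eq[OF qw x]] integral_unique[OF bi] wS by simp
    qed
  qed
  define S where "S n x = (\<Sum>i<n. w i x)" for n x
  define u where "u x = (\<Sum>i. w i x)" for x
  have ul: "uniform_limit {0..l} S u sequentially"
    unfolding S_def[abs_def] u_def[abs_def]
  proof (rule Weierstrass_m_test)
    show "cmod (w n x) \<le> M * ((K * l) ^ n / fact n)" if "x \<in> {0..l}" for n x
    proof -
      have "cmod (w n x) \<le> M * ((K * x) ^ n / fact n)" using wb that by blast
      also have "\<dots> \<le> M * ((K * l) ^ n / fact n)"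
        using that Kn Mn by (intro mult_left_mono divide_right_mono power_mono) (auto intro: mult_left_mono)
      finally show ?thesis .
    qed
    show "summable (\<lambda>n. M * ((K * l) ^ n / fact n))"
      using summable_exp[of "K * l"] by (intro summable_mult) (simp add: field_simps)
  qed
  have Sc: "continuous_on {0..l} (S n)" for n unfolding S_def by (intro continuous_intros wc)
  have uc: "continuous_on {0..l} u"
    by (rule uniform_limit_theorem[OF _ ul]) (auto simp: Sc)
  have qS: "continuous_on {0..l} (\<lambda>t. q t * S n t)" for n by (intro continuous_on_mult q Sc)
  have qu: "continuous_on {0..l} (\<lambda>t. q t * u t)" by (intro continuous_on_mult q uc)
  have SS: "S (Suc n) x = g x + J (\<lambda>t. q t * S n t) x" if x: "x \<in> {0..l}" for n x
  proof -
    have "((\<lambda>t. \<Sum>i<n. of_real (x - t) * (q t * w i t)) has_integral (\<Sum>i<n. J (\<lambda>t. q t * w i t) x)) {0..x}"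
      by (intro has_integral_sum J_eq x qw) auto
    moreover have "(\<lambda>t. \<Sum>i<n. of_real (x - t) * (q t * w i t)) = (\<lambda>t. of_real (x - t) * (q t * S n t))"
      by (simp add: S_def sum_distrib_left mult.assoc)
    ultimately have "((\<lambda>t. of_real (x - t) * (q t * S n t)) has_integral (\<Sum>i<n. J (\<lambda>t. q t * w i t) x)) {0..x}"
      by (simp only:)
    from has_integral_unique[OF this J_eq[OF qS x]] show ?thesis
      unfolding S_def by (simp add: sum.lessThan_Suc_shift w0 wS del: sum.lessThan_Suc)
  qed
  have ueq: "u x = g x + J (\<lambda>t. q t * u t) x" if x: "x \<in> {0..l}" for x
  proof -
    have "uniform_limit {0..x} S u sequentially"
      using ul by (rule uniform_limit_on_subset) (use x in auto)
    moreover have "bounded (u ` {0..x})"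
      using x by (intro compact_imp_bounded compact_continuous_image continuous_on_subset[OF uc]) auto
    moreover have c: "continuous_on {0..x} (\<lambda>t. of_real (x - t) * q t)"
      using x by (intro continuous_intros continuous_on_subset[OF q]) auto
    then have "bounded ((\<lambda>t. of_real (x - t) * q t) ` {0..x})"
      by (intro compact_imp_bounded compact_continuous_image) auto
    ultimately have "uniform_limit {0..x} (\<lambda>n t. (of_real (x - t) * q t) * S n t) (\<lambda>t. (of_real (x - t) * q t) * u t) sequentially"
      by (intro uniform_lim_mult uniform_limit_const)
    moreover have "continuous_on {0..x} (\<lambda>t. (of_real (x - t) * q t) * S n t)" for n
      using x by (intro continuous_on_mult c continuous_on_subset[OF Sc]) auto
    ultimately obtain I J' where
      I: "\<And>n. ((\<lambda>t. (of_real (x - t) * q t) * S n t) has_integral I n) {0..x}"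
        "((\<lambda>t. (of_real (x - t) * q t) * u t) has_integral J') {0..x}" "I \<longlonglongrightarrow> J'"
      by (rule uniform_limit_integral[where F = sequentially]) auto
    have "I = (\<lambda>n. J (\<lambda>t. q t * S n t) x)"
      using has_integral_unique[OF I(1)[unfolded mult.assoc] J_eq[OF qS x]] by (intro ext)
    moreover have "J' = J (\<lambda>t. q t * u t) x"
      using has_integral_unique[OF I(2)[unfolded mult.assoc] J_eq[OF qu x]] .
    ultimately have "(\<lambda>n. g x + J (\<lambda>t. q t * S n t) x) \<longlonglongrightarrow> g x + J (\<lambda>t. q t * u t) x"
      using I(3) by (intro tendsto_add tendsto_const) simp
    then have "(\<lambda>n. S (Suc n) x) \<longlonglongrightarrow> g x + J (\<lambda>t. q t * u t) x" by (simp add: SS[OF x])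
    moreover have "(\<lambda>n. S (Suc n) x) \<longlonglongrightarrow> u x"
      using tendsto_uniform_limitI[OF ul x] by (rule LIMSEQ_Suc)
    ultimately show ?thesis using LIMSEQ_unique by blast
  qed
  \<comment> \<open>U equals the limit u on the cell by the integral equation, but its formula can
    be differentiated term by term.\<close>
  define U where "U x = \<xi> + of_real x * \<eta> + J r x + J (\<lambda>t. q t * u t) x" for x
  define V where "V x = \<eta> + integral {0..x} r + integral {0..x} (\<lambda>t. q t * u t)" for x
  have Uu: "U x = u x" if "x \<in> {0..l}" for x using ueq[OF that] by (simp add: U_def g_def)
  have "hill_sol q r l U V"
    unfolding hill_sol_def
  proof (intro ballI conjI)
    fix x assume x: "x \<in> {0..l}"
    have "(U has_vector_derivative 0 + of_real 1 * \<eta> + integral {0..x} r + integral {0..x} (\<lambda>t. q t * u t)) (at x within {0..l})"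
      unfolding U_def
      by (intro has_vector_derivative_add has_vector_derivative_const has_vector_derivative_mult_left
          has_vector_derivative_of_real J_deriv r x qu) (auto intro!: derivative_eq_intros)
    then show "(U has_vector_derivative V x) (at x within {0..l})" by (simp add: V_def)
    have "(V has_vector_derivative 0 + r x + q x * u x) (at x within {0..l})"
      unfolding V_def
      by (intro has_vector_derivative_add has_vector_derivative_const integral_has_vector_derivative x qu r)
    then show "(V has_vector_derivative q x * U x + r x) (at x within {0..l})"
      by (simp add: Uu[OF x] add.commute)
  qed
  moreover have "U 0 = \<xi>" "V 0 = \<eta>" by (auto simp: U_def V_def J_def)
  ultimately show ?thesis using that by blast
qed

text \<open>The square root of the energy constant; the factor 1 + l lets one constant serve both
  the initial values (weight 1) and the source (weight l).\<close>

definition hill_const :: "real \<Rightarrow> real \<Rightarrow> real" where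
  "hill_const Q l = sqrt (exp ((2 + Q) * l) * (1 + l))"

lemma hill_const_nonneg: "0 \<le> l \<Longrightarrow> 0 \<le> hill_const Q l"
  by (simp add: hill_const_def)

lemma hill_sol_bound:
  assumes sol: "hill_sol q r l u v"
    and q: "\<And>x. x \<in> {0..l} \<Longrightarrow> cmod (q x) \<le> Q" and r: "\<And>x. x \<in> {0..l} \<Longrightarrow> cmod (r x) \<le> R"
    and x: "x \<in> {0..l}"
  shows "cmod (u x) \<le> hill_const Q l * (cmod (u 0) + cmod (v 0) + R)"
    and "cmod (v x) \<le> hill_const Q l * (cmod (u 0) + cmod (v 0) + R)"
proof -
  have l: "0 \<le> l" using x by auto
  have R0: "0 \<le> R" using r[OF x] norm_ge_zero order_trans by blast
  define a b where "a = cmod (u 0)" and "b = cmod (v 0)"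
  have ab: "0 \<le> a" "0 \<le> b" by (auto simp: a_def b_def)
  have sq: "a\<^sup>2 + b\<^sup>2 + R\<^sup>2 \<le> (a + b + R)\<^sup>2"
    using ab R0 by (simp add: power2_sum add_nonneg_nonneg)
  have "a\<^sup>2 + b\<^sup>2 + l * R\<^sup>2 \<le> (1 + l) * (a\<^sup>2 + b\<^sup>2 + R\<^sup>2)"
    using l by (simp add: algebra_simps)
  also have "\<dots> \<le> (1 + l) * (a + b + R)\<^sup>2" using l sq by (intro mult_left_mono) auto
  finally have "exp ((2 + Q) * l) * (a\<^sup>2 + b\<^sup>2 + l * R\<^sup>2) \<le> exp ((2 + Q) * l) * ((1 + l) * (a + b + R)\<^sup>2)"
    by simp
  also have "\<dots> = (hill_const Q l * (a + b + R))\<^sup>2"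
    using l by (simp add: hill_const_def power_mult_distrib)
  finally have *: "(cmod (u x))\<^sup>2 + (cmod (v x))\<^sup>2 \<le> (hill_const Q l * (a + b + R))\<^sup>2"
    using hill_sol_energy_bound[OF sol q r x] unfolding a_def b_def by linarith
  have nn: "0 \<le> hill_const Q l * (a + b + R)" using ab R0 hill_const_nonneg[OF l] by simp
  have "(cmod (u x))\<^sup>2 \<le> (hill_const Q l * (a + b + R))\<^sup>2"
    using * zero_le_power2[of "cmod (v x)"] by linarith
  from power2_le_imp_le[OF this nn]
  show "cmod (u x) \<le> hill_const Q l * (cmod (u 0) + cmod (v 0) + R)" by (simp add: a_def b_def)
  have "(cmod (v x))\<^sup>2 \<le> (hill_const Q l * (a + b + R))\<^sup>2"
    using * zero_le_power2[of "cmod (u x)"] by linarith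
  from power2_le_imp_le[OF this nn]
  show "cmod (v x) \<le> hill_const Q l * (cmod (u 0) + cmod (v 0) + R)" by (simp add: a_def b_def)
qed

text \<open>The difference solves the equation at \<nu> with source (\<nu> - \<mu>) u, whose size is
  controlled by the bound on u. This continuity in the spectral parameter serves both for limits of
  eigenfunctions and for shooting.\<close>

lemma hill_sol_dependence:
  assumes u: "hill_sol (\<lambda>x. of_real (V x) - \<mu>) (\<lambda>x. 0) l u v"
    and w: "hill_sol (\<lambda>x. of_real (V x) - \<nu>) (\<lambda>x. 0) l w z"
    and Q: "\<And>x. x \<in> {0..l} \<Longrightarrow> cmod (of_real (V x) - \<mu>) \<le> Q"
      "\<And>x. x \<in> {0..l} \<Longrightarrow> cmod (of_real (V x) - \<nu>) \<le> Q"
    and x: "x \<in> {0..l}"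
  defines "B \<equiv> hill_const Q l * (cmod (u 0 - w 0) + cmod (v 0 - z 0) +
        cmod (\<mu> - \<nu>) * (hill_const Q l * (cmod (u 0) + cmod (v 0))))"
  shows "cmod (u x - w x) \<le> B" and "cmod (v x - z x) \<le> B"
proof -
  have "hill_sol (\<lambda>x. of_real (V x) - \<nu>) (\<lambda>x. (\<nu> - \<mu>) * u x) l u v"
    using u unfolding hill_sol_def by (simp add: algebra_simps)
  from hill_sol_lincomb[OF this w, of 1 "-1"]
  have d: "hill_sol (\<lambda>x. of_real (V x) - \<nu>) (\<lambda>x. (\<nu> - \<mu>) * u x) l (\<lambda>x. u x - w x) (\<lambda>x. v x - z x)"
    by simp
  have r: "cmod ((\<nu> - \<mu>) * u x) \<le> cmod (\<mu> - \<nu>) * (hill_const Q l * (cmod (u 0) + cmod (v 0)))"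
    if "x \<in> {0..l}" for x
    using hill_sol_bound(1)[OF u Q(1) _ that, of 0]
    by (simp add: norm_mult norm_minus_commute mult_left_mono)
  show "cmod (u x - w x) \<le> B" "cmod (v x - z x) \<le> B"
    unfolding B_def by (rule hill_sol_bound[OF d Q(2) r x]; assumption)+
qed

section \<open>Periodic eigenvalues: reality, orthogonality, discreteness\<close>

lemma hill_sol_cnj:
  assumes "hill_sol (\<lambda>x. of_real (V x) - \<mu>) (\<lambda>x. 0) l u v"
  shows "hill_sol (\<lambda>x. of_real (V x) - cnj \<mu>) (\<lambda>x. 0) l (\<lambda>x. cnj (u x)) (\<lambda>x. cnj (v x))"
  unfolding hill_sol_def
proof (intro ballI conjI)
  fix x assume x: "x \<in> {0..l}"
  note D = hill_solD[OF assms x]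
  show "((\<lambda>x. cnj (u x)) has_vector_derivative cnj (v x)) (at x within {0..l})"
    using D(1) by (rule has_vector_derivative_cnj)
  have "((\<lambda>x. cnj (v x)) has_vector_derivative cnj ((of_real (V x) - \<mu>) * u x + 0)) (at x within {0..l})"
    using D(2) by (rule has_vector_derivative_cnj)
  then show "((\<lambda>x. cnj (v x)) has_vector_derivative (of_real (V x) - cnj \<mu>) * cnj (u x) + 0) (at x within {0..l})"
    by simp
qed

text \<open>Lagrange's identity: v w - u z has derivative (\<nu> - \<mu>) u w, and its boundary
  terms cancel for periodic solutions. The pairing is bilinear; conjugation comes in through
  \<open>hill_sol_cnj\<close>.\<close>

lemma hill_sol_lagrange:
  assumes u: "hill_sol (\<lambda>x. of_real (V x) - \<mu>) (\<lambda>x. 0) l u v"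
    and w: "hill_sol (\<lambda>x. of_real (V x) - \<nu>) (\<lambda>x. 0) l w z" and l: "0 \<le> l"
    and per: "u l = u 0" "v l = v 0" "w l = w 0" "z l = z 0" and ne: "\<mu> \<noteq> \<nu>"
  shows "((\<lambda>x. u x * w x) has_integral 0) {0..l}"
proof -
  have "((\<lambda>x. (\<nu> - \<mu>) * (u x * w x)) has_integral (v l * w l - u l * z l) - (v 0 * w 0 - u 0 * z 0)) {0..l}"
  proof (rule fundamental_theorem_of_calculus[OF l])
    fix x assume x: "x \<in> {0..l}"
    note D = hill_solD[OF u x] hill_solD[OF w x]
    have "((\<lambda>x. v x * w x - u x * z x) has_vector_derivative
      (v x * z x + ((of_real (V x) - \<mu>) * u x + 0) * w x) - (u x * ((of_real (V x) - \<nu>) * w x + 0) + v x * z x)) (at x within {0..l})"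
      by (intro has_vector_derivative_diff has_vector_derivative_mult D)
    then show "((\<lambda>x. v x * w x - u x * z x) has_vector_derivative (\<nu> - \<mu>) * (u x * w x)) (at x within {0..l})"
      by (simp add: algebra_simps)
  qed
  then have "((\<lambda>x. (\<nu> - \<mu>) * (u x * w x)) has_integral 0) {0..l}" using per by simp
  from has_integral_mult_right[OF this, of "1 / (\<nu> - \<mu>)"] ne show ?thesis by simp
qed

lemma has_integral_cmod_sq_eq_0:
  fixes u :: "real \<Rightarrow> complex"
  assumes "((\<lambda>x. u x * cnj (u x)) has_integral 0) {0..l}" and u: "continuous_on {0..l} u"
    and l: "0 < l" and x: "x \<in> {0..l}"
  shows "u x = 0"
proof -
  have "((\<lambda>x. Re (u x * cnj (u x))) has_integral Re 0) {0..l}"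
    using has_integral_Re[OF assms(1)] .
  moreover have "Re (u x * cnj (u x)) = (cmod (u x))\<^sup>2" for x
    by (metis Re_complex_of_real complex_norm_square)
  ultimately have "integral {0..l} (\<lambda>x. (cmod (u x))\<^sup>2) = 0"
    by (simp add: integral_unique)
  moreover have "continuous_on {0..l} (\<lambda>x. (cmod (u x))\<^sup>2)" by (intro continuous_intros u)
  ultimately have "\<forall>x\<in>{0..l}. (cmod (u x))\<^sup>2 = 0"
    using Equivalence_Lebesgue_Henstock_Integration.integral_eq_0_iff[of 0 l "\<lambda>x. (cmod (u x))\<^sup>2"] l
    by simp
  then show ?thesis using x by auto
qed

lemma hill_sol_zero_deriv:
  assumes "hill_sol q r l u v" "0 < l" "\<And>x. x \<in> {0..l} \<Longrightarrow> u x = 0" "x \<in> {0..l}"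
  shows "v x = 0"
proof -
  have "(u has_vector_derivative 0) (at x within {0..l})"
    by (rule has_vector_derivative_transform[OF assms(4) _ has_vector_derivative_const[of 0]])
      (use assms in auto)
  then show ?thesis
    using hill_solD(1)[OF assms(1,4)] vector_derivative_unique_within_closed_interval[of 0 l x]
      assms(2,4) by (metis atLeastAtMost_iff box_real(2))
qed

text \<open>Nontriviality is stated through the data at 0, so that not being an eigenvalue is
  exactly the invertibility of monodromy minus identity.\<close>

definition per_eig :: "(real \<Rightarrow> real) \<Rightarrow> real \<Rightarrow> complex \<Rightarrow> bool" where
  "per_eig V l \<mu> \<longleftrightarrow> (\<exists>u v. hill_sol (\<lambda>x. of_real (V x) - \<mu>) (\<lambda>x. 0) l u v \<and>
      u l = u 0 \<and> v l = v 0 \<and> (u 0, v 0) \<noteq> (0, 0))"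

text \<open>For non-real \<mu> the conjugate eigenfunction belongs to a different eigenvalue, so
  Lagrange's identity makes the integral of |u|^2 vanish.\<close>

lemma per_eig_real:
  assumes "per_eig V l \<mu>" and l: "0 < l"
  shows "cnj \<mu> = \<mu>"
proof (rule ccontr)
  assume ne: "cnj \<mu> \<noteq> \<mu>"
  obtain u v where u: "hill_sol (\<lambda>x. of_real (V x) - \<mu>) (\<lambda>x. 0) l u v"
    and p: "u l = u 0" "v l = v 0" "(u 0, v 0) \<noteq> (0, 0)"
    using assms by (auto simp: per_eig_def)
  have "((\<lambda>x. u x * cnj (u x)) has_integral 0) {0..l}"
    using hill_sol_lagrange[OF u hill_sol_cnj[OF u]] p ne l by auto
  then have z: "u x = 0" if "x \<in> {0..l}" for x
    using has_integral_cmod_sq_eq_0 hill_sol_continuous(1)[OF u] l that by blast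
  have "v 0 = 0" using hill_sol_zero_deriv[OF u l z, of 0] l by auto
  with z[of 0] p l show False by auto
qed

lemma per_eig_sparse:
  assumes V: "continuous_on {0..l} V" and l: "0 < l"
  shows "{\<mu>. per_eig V l \<mu>} sparse_in UNIV"
  unfolding sparse_in_open[OF open_UNIV]
proof (intro ballI notI)
  fix \<nu> assume "\<nu> islimpt {\<mu>. per_eig V l \<mu>}"
  then obtain f1 where f1: "\<forall>n. f1 n \<in> {\<mu>. per_eig V l \<mu>} - {\<nu>}" and lim1: "f1 \<longlonglongrightarrow> \<nu>"
    unfolding islimpt_sequential by blast
  \<comment> \<open>Dropping finitely many terms keeps the sequence within distance 1 of \<nu>, so
    that one bound Q serves all the coefficients.\<close>
  obtain N where N: "\<And>n. n \<ge> N \<Longrightarrow> dist (f1 n) \<nu> < 1"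
    using metric_LIMSEQ_D[OF lim1, of 1] by auto
  define f where "f n = f1 (n + N)" for n
  have f0: "\<forall>n. f n \<in> {\<mu>. per_eig V l \<mu>} \<inter> ball \<nu> 1 - {\<nu>}"
    using f1 N by (auto simp: f_def dist_commute)
  have lim0: "f \<longlonglongrightarrow> \<nu>" unfolding f_def using LIMSEQ_ignore_initial_segment[OF lim1] .
  have "\<forall>n. \<exists>u v. hill_sol (\<lambda>x. of_real (V x) - f n) (\<lambda>x. 0) l u v \<and>
      u l = u 0 \<and> v l = v 0 \<and> norm (u 0, v 0) = 1"
  proof
    fix n
    obtain u v where u: "hill_sol (\<lambda>x. of_real (V x) - f n) (\<lambda>x. 0) l u v"
      and p: "u l = u 0" "v l = v 0" "(u 0, v 0) \<noteq> (0, 0)"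
      using f0 unfolding per_eig_def by blast
    define c where "c = norm (u 0, v 0)"
    have c: "c > 0" using p(3) by (simp only: c_def zero_less_norm_iff zero_prod_def not_False_eq_True)
    have "norm (u 0 / of_real c, v 0 / of_real c) = norm (inverse c *\<^sub>R (u 0, v 0))"
      by (simp add: scaleR_conv_of_real field_simps)
    also have "\<dots> = 1" using c unfolding norm_scaleR c_def[symmetric] by simp
    finally show "\<exists>u v. hill_sol (\<lambda>x. of_real (V x) - f n) (\<lambda>x. 0) l u v \<and>
      u l = u 0 \<and> v l = v 0 \<and> norm (u 0, v 0) = 1"
      using hill_sol_lincomb[OF u u, of "1 / of_real c" 0] p by (intro exI conjI) (assumption | simp)+
  qed
  then obtain U W where U: "\<And>n. hill_sol (\<lambda>x. of_real (V x) - f n) (\<lambda>x. 0) l (U n) (W n)"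
    and UP: "\<And>n. U n l = U n 0" "\<And>n. W n l = W n 0" and UN: "\<And>n. norm (U n 0, W n 0) = 1"
    by metis
  have "\<forall>n. (U n 0, W n 0) \<in> sphere 0 1" using UN by simp
  then obtain p \<sigma> where p: "p \<in> sphere 0 1" and \<sigma>: "strict_mono (\<sigma> :: nat \<Rightarrow> nat)"
    and lim: "((\<lambda>n. (U n 0, W n 0)) \<circ> \<sigma>) \<longlonglongrightarrow> p"
    by (rule seq_compactE[OF compact_imp_seq_compact[OF compact_sphere]])
  define g u v where "g n = f (\<sigma> n)" and "u n = U (\<sigma> n)" and "v n = W (\<sigma> n)" for n
  have g: "per_eig V l (g n)" "g n \<noteq> \<nu>" "dist (g n) \<nu> < 1" for n
    using f0 by (auto simp: g_def dist_commute)
  have glim: "g \<longlonglongrightarrow> \<nu>" unfolding g_def using LIMSEQ_subseq_LIMSEQ[OF lim0 \<sigma>] by (simp add: o_def)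
  have u: "hill_sol (\<lambda>x. of_real (V x) - g n) (\<lambda>x. 0) l (u n) (v n)"
    and up: "u n l = u n 0" "v n l = v n 0" for n
    using U UP by (auto simp: g_def u_def v_def)
  have un: "cmod (u n 0) \<le> 1" "cmod (v n 0) \<le> 1" for n
    using UN[of "\<sigma> n"] norm_fst_le[of "u n 0" "v n 0"] norm_snd_le[of "v n 0" "u n 0"]
    by (auto simp: u_def v_def)
  have ulim: "(\<lambda>n. u n 0) \<longlonglongrightarrow> fst p" "(\<lambda>n. v n 0) \<longlonglongrightarrow> snd p"
    using tendsto_fst[OF lim] tendsto_snd[OF lim] by (auto simp: o_def u_def v_def)
  have qc: "continuous_on {0..l} (\<lambda>x. of_real (V x) - \<nu>)" by (intro continuous_intros V)
  \<comment> \<open>w is the solution at \<nu> with the limiting data p; the eigenfunctions converge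
    to it uniformly by \<open>hill_sol_dependence\<close>.\<close>
  obtain w z where w: "hill_sol (\<lambda>x. of_real (V x) - \<nu>) (\<lambda>x. 0) l w z"
    and w0: "w 0 = fst p" "z 0 = snd p"
    by (rule hill_sol_exists[OF less_imp_le[OF l] qc continuous_on_const])
  obtain Q0 where Q0: "\<And>x. x \<in> {0..l} \<Longrightarrow> cmod (of_real (V x) - \<nu>) \<le> Q0"
    using continuous_on_Icc_bound[OF qc] by blast
  define Q where "Q = Q0 + 1"
  have Q: "cmod (of_real (V x) - \<nu>) \<le> Q" "cmod (of_real (V x) - g n) \<le> Q" if "x \<in> {0..l}" for x n
  proof -
    have "cmod (of_real (V x) - g n) \<le> cmod (of_real (V x) - \<nu>) + cmod (\<nu> - g n)"
      by (metis norm_triangle_ineq diff_add_cancel add_diff_eq)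
    then show "cmod (of_real (V x) - \<nu>) \<le> Q" "cmod (of_real (V x) - g n) \<le> Q"
      using Q0[OF that] g(3)[of n] by (auto simp: Q_def dist_norm norm_minus_commute)
  qed
  define E where "E = hill_const Q l"
  have E: "0 \<le> E" using hill_const_nonneg l by (simp add: E_def)
  define B where "B n = E * (cmod (u n 0 - fst p) + cmod (v n 0 - snd p) + cmod (g n - \<nu>) * (E * 2))" for n
  have dep: "cmod (u n x - w x) \<le> B n" if "x \<in> {0..l}" for n x
  proof -
    have "cmod (u n x - w x) \<le> E * (cmod (u n 0 - fst p) + cmod (v n 0 - snd p) +
        cmod (g n - \<nu>) * (E * (cmod (u n 0) + cmod (v n 0))))"
      using hill_sol_dependence(1)[OF u w Q(2) Q(1) that] w0 by (simp add: E_def)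
    also have "\<dots> \<le> B n"
      unfolding B_def using un[of n] E by (intro mult_left_mono add_left_mono) auto
    finally show ?thesis .
  qed
  have Blim: "B \<longlonglongrightarrow> 0"
  proof -
    have "B \<longlonglongrightarrow> E * (cmod (fst p - fst p) + cmod (snd p - snd p) + cmod (\<nu> - \<nu>) * (E * 2))"
      unfolding B_def by (intro tendsto_intros ulim glim)
    then show ?thesis by simp
  qed
  have ul: "uniform_limit {0..l} u w sequentially"
  proof (rule uniform_limitI)
    fix e :: real assume "0 < e"
    then have "\<forall>\<^sub>F n in sequentially. B n < e" using order_tendstoD(2)[OF Blim] by blast
    then show "\<forall>\<^sub>F n in sequentially. \<forall>x\<in>{0..l}. dist (u n x) (w x) < e"
      by (rule eventually_mono) (metis dep dist_norm le_less_trans)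
  qed
  have ulc: "uniform_limit {0..l} (\<lambda>n x. cnj (u n x)) (\<lambda>x. cnj (w x)) sequentially"
    using ul unfolding uniform_limit_iff by (simp flip: complex_cnj_diff add: dist_norm)
  note uc = hill_sol_continuous(1)[OF u] and wc = hill_sol_continuous(1)[OF w]
  have bdd: "bounded (h ` {0..l})" if "continuous_on {0..l} h" for h :: "real \<Rightarrow> complex"
    using that by (intro compact_imp_bounded compact_continuous_image) auto
  \<comment> \<open>Two limits in succession: for fixed n, letting m tend to infinity makes every u
    n orthogonal to w; a second limit, in the remaining index, makes w orthogonal to itself.\<close>
  have uw: "((\<lambda>x. u n x * cnj (w x)) has_integral 0) {0..l}" for n
  proof -
    have "uniform_limit {0..l} (\<lambda>m x. u n x * cnj (u m x)) (\<lambda>x. u n x * cnj (w x)) sequentially"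
      by (intro uniform_lim_mult uniform_limit_const ulc bdd
          continuous_intros uc wc)
    then obtain I J where I: "\<And>m. ((\<lambda>x. u n x * cnj (u m x)) has_integral I m) {0..l}"
      "((\<lambda>x. u n x * cnj (w x)) has_integral J) {0..l}" "I \<longlonglongrightarrow> J"
      by (rule uniform_limit_integral[where F = sequentially]) (auto intro!: continuous_intros uc)
    have "\<forall>\<^sub>F m in sequentially. g m \<noteq> g n"
      using tendsto_imp_eventually_ne[OF glim] g(2)[of n] by auto
    then have "\<forall>\<^sub>F m in sequentially. I m = 0"
    proof (rule eventually_mono)
      fix m assume m: "g m \<noteq> g n"
      have "((\<lambda>x. u n x * cnj (u m x)) has_integral 0) {0..l}"
        using hill_sol_lagrange[OF u hill_sol_cnj[OF u], of n m] up m per_eig_real[OF g(1) l] l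
        by (metis less_imp_le)
      then show "I m = 0" using I(1) has_integral_unique by blast
    qed
    then have "I \<longlonglongrightarrow> 0" by (rule tendsto_eventually)
    then show ?thesis using I LIMSEQ_unique by blast
  qed
  have "uniform_limit {0..l} (\<lambda>m x. u m x * cnj (w x)) (\<lambda>x. w x * cnj (w x)) sequentially"
    by (intro uniform_lim_mult uniform_limit_const ul bdd
        continuous_intros wc)
  then obtain I J where I: "\<And>m. ((\<lambda>x. u m x * cnj (w x)) has_integral I m) {0..l}"
    "((\<lambda>x. w x * cnj (w x)) has_integral J) {0..l}" "I \<longlonglongrightarrow> J"
    by (rule uniform_limit_integral[where F = sequentially]) (auto intro!: continuous_intros uc wc)
  have "I m = 0" for m using I(1) uw has_integral_unique by blast
  then have "I = (\<lambda>m. 0)" by (rule ext)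
  then have "J = 0" using I(3) by (simp add: LIMSEQ_const_iff)
  then have z: "w x = 0" if "x \<in> {0..l}" for x
    using has_integral_cmod_sq_eq_0 I(2) wc l that by blast
  \<comment> \<open>The normalisation concerned the initial data, so w = 0 forces p = 0, which is
    not on the unit sphere.\<close>
  have "z 0 = 0" using hill_sol_zero_deriv[OF w l z, of 0] l by auto
  with z[of 0] w0 l have "p = 0" by (simp add: prod_eq_iff)
  with p show False by simp
qed

text \<open>Take the solution u0 with zero data and correct its end values by a combination of the
  fundamental solutions y1, y2. The coefficients come from Cramer's rule for monodromy minus
  identity. The jumps d, e are there because the sources met later become continuous only after
  subtracting a non-periodic function.\<close>

lemma per_solvable:
  assumes V: "continuous_on {0..l} V" and l: "0 < l" and ne: "\<not> per_eig V l \<mu>"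
  obtains C where "0 \<le> C"
    "\<And>r R d e. continuous_on {0..l} r \<Longrightarrow> (\<And>x. x \<in> {0..l} \<Longrightarrow> cmod (r x) \<le> R) \<Longrightarrow>
      \<exists>u v. hill_sol (\<lambda>x. of_real (V x) - \<mu>) r l u v \<and> u l - u 0 = d \<and> v l - v 0 = e \<and>
        (\<forall>x\<in>{0..l}. cmod (u x) \<le> C * (R + cmod d + cmod e))"
proof -
  define q where "q x = complex_of_real (V x) - \<mu>" for x
  have qc: "continuous_on {0..l} q" unfolding q_def by (intro continuous_intros V)
  obtain Q where Q: "\<And>x. x \<in> {0..l} \<Longrightarrow> cmod (q x) \<le> Q"
    using continuous_on_Icc_bound[OF qc] by blast
  define E where "E = hill_const Q l"
  have E: "0 \<le> E" using hill_const_nonneg l by (simp add: E_def)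
  have l0: "0 \<le> l" and lin: "l \<in> {0..l}" using l by auto
  obtain y1 z1 where y1: "hill_sol q (\<lambda>x. 0) l y1 z1" "y1 0 = 1" "z1 0 = 0"
    using hill_sol_exists[OF l0 qc continuous_on_const] by blast
  obtain y2 z2 where y2: "hill_sol q (\<lambda>x. 0) l y2 z2" "y2 0 = 0" "z2 0 = 1"
    using hill_sol_exists[OF l0 qc continuous_on_const] by blast
  have yb: "cmod (y1 x) \<le> E" "cmod (y2 x) \<le> E" if "x \<in> {0..l}" for x
    using hill_sol_bound(1)[OF y1(1) Q _ that, of 0] hill_sol_bound(1)[OF y2(1) Q _ that, of 0] y1 y2
    by (auto simp: E_def)
  define a b c d0 where "a = y1 l - 1" and "b = y2 l" and "c = z1 l" and "d0 = z2 l - 1"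
  define D where "D = a * d0 - b * c"
  have triv: "\<xi> = 0 \<and> \<eta> = 0" if "a * \<xi> + b * \<eta> = 0" "c * \<xi> + d0 * \<eta> = 0" for \<xi> \<eta>
  proof (rule ccontr)
    assume n: "\<not> (\<xi> = 0 \<and> \<eta> = 0)"
    have "hill_sol q (\<lambda>x. 0) l (\<lambda>x. \<xi> * y1 x + \<eta> * y2 x) (\<lambda>x. \<xi> * z1 x + \<eta> * z2 x)"
      using hill_sol_lincomb[OF y1(1) y2(1), of \<xi> \<eta>] by simp
    then have "per_eig V l \<mu>" unfolding per_eig_def q_def
      by (intro exI conjI, assumption)
        (use that n y1 y2 in \<open>auto simp: a_def b_def c_def d0_def algebra_simps\<close>)
    then show False using ne by simp
  qed
  have D: "D \<noteq> 0"
  proof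
    assume "D = 0"
    then have "a * d0 = b * c" by (simp add: D_def)
    \<comment> \<open>If the determinant D vanishes, (b, -a) and (d0, -c) lie in the kernel; if both
      are zero, the matrix is zero and (1, 0) lies in it.\<close>
    then show False using triv[of b "-a"] triv[of d0 "-c"] triv[of 1 0]
      by (auto simp: algebra_simps)
  qed
  define m where "m = (cmod a + cmod b + cmod c + cmod d0) / cmod D"
  have m: "0 \<le> m" by (simp add: m_def)
  \<comment> \<open>E R bounds u0, E bounds the fundamental solutions, and each Cramer coefficient
    is at most m times |d| + |e| + 2 E R.\<close>
  define C where "C = E + 2 * m * (1 + 2 * E) * E"
  show ?thesis
  proof
    show "0 \<le> C" using E m by (simp add: C_def)
    fix r R d e
    assume rc: "continuous_on {0..l} r" and R: "\<And>x. x \<in> {0..l} \<Longrightarrow> cmod (r x) \<le> R"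
    have R0: "0 \<le> R" using R[OF lin] norm_ge_zero order_trans by blast
    obtain u0 v0 where u0: "hill_sol q r l u0 v0" "u0 0 = 0" "v0 0 = 0"
      using hill_sol_exists[OF l0 qc rc] by blast
    have ub: "cmod (u0 x) \<le> E * R" "cmod (v0 x) \<le> E * R" if "x \<in> {0..l}" for x
      using hill_sol_bound[OF u0(1) Q R that] u0 by (auto simp: E_def)
    define p s where "p = d - u0 l" and "s = e - v0 l"
    define \<xi> \<eta> where "\<xi> = (d0 * p - b * s) / D" and "\<eta> = (a * s - c * p) / D"
    have ps: "cmod p + cmod s \<le> cmod d + cmod e + 2 * E * R"
      using norm_triangle_ineq4[of d "u0 l"] norm_triangle_ineq4[of e "v0 l"] ub[OF lin]
      by (auto simp: p_def s_def)
    have x1: "cmod \<xi> \<le> m * (cmod p + cmod s)"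
    proof -
      have "cmod (d0 * p - b * s) \<le> cmod d0 * cmod p + cmod b * cmod s"
        by (metis norm_mult norm_triangle_ineq4)
      also have "\<dots> \<le> (cmod a + cmod b + cmod c + cmod d0) * (cmod p + cmod s)"
        by (simp add: algebra_simps)
      finally show ?thesis using D by (simp add: \<xi>_def m_def norm_divide divide_right_mono)
    qed
    have x2: "cmod \<eta> \<le> m * (cmod p + cmod s)"
    proof -
      have "cmod (a * s - c * p) \<le> cmod a * cmod s + cmod c * cmod p"
        by (metis norm_mult norm_triangle_ineq4)
      also have "\<dots> \<le> (cmod a + cmod b + cmod c + cmod d0) * (cmod p + cmod s)"
        by (simp add: algebra_simps)
      finally show ?thesis using D by (simp add: \<eta>_def m_def norm_divide divide_right_mono)
    qed
    define u v where "u x = u0 x + (\<xi> * y1 x + \<eta> * y2 x)" and "v x = v0 x + (\<xi> * z1 x + \<eta> * z2 x)" for x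
    have sol: "hill_sol q r l u v"
      using hill_sol_lincomb[OF u0(1) hill_sol_lincomb[OF y1(1) y2(1), of \<xi> \<eta>], of 1 1]
      by (simp add: u_def[abs_def] v_def[abs_def])
    have e1: "a * \<xi> + b * \<eta> = p"
    proof -
      have "a * \<xi> + b * \<eta> = (a * (d0 * p - b * s) + b * (a * s - c * p)) / D"
        by (simp add: \<xi>_def \<eta>_def add_divide_distrib)
      also have "\<dots> = D * p / D" by (simp add: D_def algebra_simps)
      finally show ?thesis using D by simp
    qed
    have e2: "c * \<xi> + d0 * \<eta> = s"
    proof -
      have "c * \<xi> + d0 * \<eta> = (c * (d0 * p - b * s) + d0 * (a * s - c * p)) / D"
        by (simp add: \<xi>_def \<eta>_def add_divide_distrib)
      also have "\<dots> = D * s / D" by (simp add: D_def algebra_simps)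
      finally show ?thesis using D by simp
    qed
    have "u l - u 0 = d" using e1 y1 y2 u0 by (simp add: u_def a_def b_def p_def algebra_simps)
    moreover have "v l - v 0 = e" using e2 y1 y2 u0 by (simp add: v_def c_def d0_def s_def algebra_simps)
    moreover have "cmod (u x) \<le> C * (R + cmod d + cmod e)" if x: "x \<in> {0..l}" for x
    proof -
      have "cmod (u x) \<le> cmod (u0 x) + (cmod \<xi> * cmod (y1 x) + cmod \<eta> * cmod (y2 x))"
        unfolding u_def norm_mult[symmetric]
        by (intro order_trans[OF norm_triangle_ineq] add_left_mono norm_triangle_ineq)
      also have "\<dots> \<le> E * R + (m * (cmod p + cmod s) * E + m * (cmod p + cmod s) * E)"
        using ub[OF x] yb[OF x] x1 x2 m by (intro add_mono mult_mono) auto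
      also have "\<dots> = E * R + 2 * m * E * (cmod p + cmod s)" by (simp add: algebra_simps)
      also have "\<dots> \<le> E * R + 2 * m * E * (cmod d + cmod e + 2 * E * R)"
        using ps m E by (intro add_left_mono mult_left_mono) auto
      also have "\<dots> \<le> E * (R + cmod d + cmod e) + 2 * m * E * ((1 + 2 * E) * (R + cmod d + cmod e))"
        using m E R0 by (intro add_mono mult_left_mono) (auto simp: algebra_simps)
      also have "\<dots> = C * (R + cmod d + cmod e)" by (simp add: C_def algebra_simps)
      finally show ?thesis .
    qed
    ultimately show "\<exists>u v. hill_sol (\<lambda>x. of_real (V x) - \<mu>) r l u v \<and> u l - u 0 = d \<and> v l - v 0 = e \<and>
        (\<forall>x\<in>{0..l}. cmod (u x) \<le> C * (R + cmod d + cmod e))"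
      using sol unfolding q_def by blast
  qed
qed

section \<open>Weak derivatives of periodic functions\<close>

lemma set_integrable_mult_continuous:
  fixes f g :: "real \<Rightarrow> complex"
  assumes f: "set_integrable lborel {a..b} f" and g: "continuous_on {a..b} g"
  shows "set_integrable lborel {a..b} (\<lambda>x. f x * g x)"
proof -
  obtain C where C: "0 \<le> C" "\<And>x. x \<in> {a..b} \<Longrightarrow> cmod (g x) \<le> C"
    using continuous_on_Icc_bound[OF g] by blast
  have g': "(\<lambda>x. indicator {a..b} x *\<^sub>R g x) \<in> borel_measurable lborel"
    using borel_measurable_continuous_on_indicator[OF _ g] by simp
  have f': "integrable lborel (\<lambda>x. indicator {a..b} x *\<^sub>R f x)" using f by (simp add: set_integrable_def)
  have "integrable lborel (\<lambda>x. (indicator {a..b} x *\<^sub>R f x) * (indicator {a..b} x *\<^sub>R g x))"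
  proof (rule Bochner_Integration.integrable_bound)
    show "integrable lborel (\<lambda>x. C *\<^sub>R (indicator {a..b} x *\<^sub>R f x))" using f' by (intro integrable_scaleR_right)
    show "(\<lambda>x. (indicator {a..b} x *\<^sub>R f x) * (indicator {a..b} x *\<^sub>R g x)) \<in> borel_measurable lborel"
      using f' g' by (intro borel_measurable_times) auto
    show "AE x in lborel. cmod ((indicator {a..b} x *\<^sub>R f x) * (indicator {a..b} x *\<^sub>R g x))
       \<le> cmod (C *\<^sub>R (indicator {a..b} x *\<^sub>R f x))"
      using C by (intro AE_I2) (auto simp: indicator_def norm_mult intro!: mult_right_mono[THEN ord_eq_le_trans[OF mult.commute]])
  qed
  moreover have "(\<lambda>x. (indicator {a..b} x *\<^sub>R f x) * (indicator {a..b} x *\<^sub>R g x)) =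
      (\<lambda>x. indicator {a..b} x *\<^sub>R (f x * g x))"
    by (auto simp: indicator_def)
  ultimately show ?thesis unfolding set_integrable_def by (simp only:)
qed

lemma set_integrable_continuous:
  fixes g :: "real \<Rightarrow> complex"
  assumes "continuous_on {a..b} g"
  shows "set_integrable lborel {a..b} g"
  using borel_integrable_atLeastAtMost'[OF assms] .

lemma set_lebesgue_eq_integral:
  fixes f :: "real \<Rightarrow> complex"
  assumes "set_integrable lborel {a..b} f"
  shows "(LINT x:{a..b}|lborel. f x) = integral {a..b} f" "f integrable_on {a..b}"
  using set_borel_integral_eq_integral[OF assms] by auto

text \<open>Fubini on the triangle \<open>t \<le> x\<close>: the primitive of \<open>v\<close> need not be differentiable everywhere.\<close>

lemma integral_primitive_by_parts:
  fixes v :: "real \<Rightarrow> complex" and \<psi> \<psi>' :: "real \<Rightarrow> real"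
  assumes v: "set_integrable lborel {0..L} v" and L: "0 \<le> L"
    and \<psi>: "\<And>x. x \<in> {0..L} \<Longrightarrow> (\<psi> has_real_derivative \<psi>' x) (at x within {0..L})"
    and c: "continuous_on {0..L} \<psi>'"
  shows "(LINT x:{0..L}|lborel. integral {0..x} v * of_real (\<psi>' x)) =
    of_real (\<psi> L) * integral {0..L} v - (LINT x:{0..L}|lborel. v x * of_real (\<psi> x))"
proof -
  define g where "g t = indicator {0..L} t *\<^sub>R v t" for t
  define h where "h x = indicator {0..L} x *\<^sub>R complex_of_real (\<psi>' x)" for x
  have g: "integrable lborel g" using v by (simp add: set_integrable_def g_def[abs_def])
  have gm[measurable]: "g \<in> borel_measurable borel" using g by auto
  have h: "integrable lborel h" unfolding h_def[abs_def]
    using set_integrable_continuous[of 0 L "\<lambda>x. of_real (\<psi>' x)"] c by (simp add: set_integrable_def continuous_intros)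
  have hm[measurable]: "h \<in> borel_measurable borel" using h by auto
  \<comment> \<open>Integrating k first in t gives the primitive of v times \<psi>'; integrating
    first in x gives v(t) times \<psi>(L) - \<psi>(t).\<close>
  define k where "k x t = (if t \<le> x then h x * g t else 0)" for x t :: real
  have inner: "(\<integral>t. k x t \<partial>lborel) = indicator {0..L} x *\<^sub>R (integral {0..x} v * of_real (\<psi>' x))" for x
  proof (cases "x \<in> {0..L}")
    case True
    have "(\<integral>t. k x t \<partial>lborel) = (\<integral>t. h x * (indicator {0..x} t *\<^sub>R v t) \<partial>lborel)"
      using True by (intro Bochner_Integration.integral_cong) (auto simp: k_def g_def indicator_def)
    also have "\<dots> = (LINT t:{0..x}|lborel. h x * v t)" by (simp only: set_lebesgue_integral_def mult_scaleR_right)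
    also have "\<dots> = h x * (LINT t:{0..x}|lborel. v t)" by simp
    also have "(LINT t:{0..x}|lborel. v t) = integral {0..x} v"
      by (rule set_lebesgue_eq_integral(1)[OF set_integrable_subset[OF v]]) (use True in auto)
    finally show ?thesis using True by (simp add: h_def)
  next
    case False
    then have "h x = 0" by (auto simp: h_def)
    then have "k x = (\<lambda>t. 0)" by (auto simp: k_def)
    then show ?thesis using False by simp
  qed
  have kint: "integrable lborel (\<lambda>t. k x t)" for x
  proof (rule Bochner_Integration.integrable_bound[of _ "\<lambda>t. h x * g t"])
    show "integrable lborel (\<lambda>t. h x * g t)" using g by simp
    show "(\<lambda>t. k x t) \<in> borel_measurable lborel" unfolding k_def by measurable
  qed (auto simp: k_def)
  have "integrable (lborel \<Otimes>\<^sub>M lborel) (case_prod k)"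
  proof (rule lborel_pair.Fubini_integrable)
    show "case_prod k \<in> borel_measurable (lborel \<Otimes>\<^sub>M lborel)" unfolding k_def by measurable
    show "AE x in lborel. integrable lborel (\<lambda>y. case_prod k (x, y))" using kint by simp
    show "integrable lborel (\<lambda>x. \<integral>y. norm (case_prod k (x, y)) \<partial>lborel)"
    proof (rule Bochner_Integration.integrable_bound[of _ "\<lambda>x. (\<integral>t. norm (g t) \<partial>lborel) *\<^sub>R h x"])
      show "integrable lborel (\<lambda>x. (\<integral>t. norm (g t) \<partial>lborel) *\<^sub>R h x)" using h by simp
      show "(\<lambda>x. \<integral>y. norm (case_prod k (x, y)) \<partial>lborel) \<in> borel_measurable lborel" unfolding k_def by measurable
      have "norm (\<integral>y. norm (case_prod k (x, y)) \<partial>lborel) \<le> norm ((\<integral>t. norm (g t) \<partial>lborel) *\<^sub>R h x)" for x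
      proof -
        have "(\<integral>y. norm (k x y) \<partial>lborel) \<le> (\<integral>y. norm (h x) * norm (g y) \<partial>lborel)"
          using kint[of x] g by (intro integral_mono) (auto simp: k_def norm_mult)
        also have "\<dots> = norm (h x) * (\<integral>y. norm (g y) \<partial>lborel)" by simp
        finally show ?thesis by (simp add: mult.commute)
      qed
      then show "AE x in lborel. norm (\<integral>y. norm (case_prod k (x, y)) \<partial>lborel) \<le> norm ((\<integral>t. norm (g t) \<partial>lborel) *\<^sub>R h x)"
        by blast
    qed
  qed
  from lborel_pair.Fubini_integral[OF this]
  have F: "(\<integral>t. (\<integral>x. k x t \<partial>lborel) \<partial>lborel) = (\<integral>x. (\<integral>t. k x t \<partial>lborel) \<partial>lborel)" .
  have inner2: "(\<integral>x. k x t \<partial>lborel) = indicator {0..L} t *\<^sub>R (of_real (\<psi> L) * v t - v t * of_real (\<psi> t))" for t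
  proof (cases "t \<in> {0..L}")
    case True
    have "(\<integral>x. k x t \<partial>lborel) = (\<integral>x. v t * (indicator {t..L} x *\<^sub>R complex_of_real (\<psi>' x)) \<partial>lborel)"
      using True by (intro Bochner_Integration.integral_cong) (auto simp: k_def g_def h_def indicator_def)
    also have "\<dots> = (LINT x:{t..L}|lborel. v t * complex_of_real (\<psi>' x))" by (simp only: set_lebesgue_integral_def mult_scaleR_right)
    also have "\<dots> = v t * (LINT x:{t..L}|lborel. complex_of_real (\<psi>' x))" by simp
    also have "(LINT x:{t..L}|lborel. complex_of_real (\<psi>' x)) = integral {t..L} (\<lambda>x. complex_of_real (\<psi>' x))"
      by (rule set_lebesgue_eq_integral(1)[OF set_integrable_continuous])
        (use True in \<open>auto intro!: continuous_intros continuous_on_subset[OF c]\<close>)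
    also have "\<dots> = of_real (\<psi> L) - of_real (\<psi> t)"
    proof (rule integral_unique, rule fundamental_theorem_of_calculus)
      fix x assume "x \<in> {t..L}"
      then have "(\<psi> has_real_derivative \<psi>' x) (at x within {t..L})"
        using True by (intro DERIV_subset[OF \<psi>]) auto
      then show "((\<lambda>x. complex_of_real (\<psi> x)) has_vector_derivative complex_of_real (\<psi>' x)) (at x within {t..L})"
        by (intro has_vector_derivative_of_real) (simp add: has_real_derivative_iff_has_vector_derivative)
    qed (use True in auto)
    finally show ?thesis using True by (simp add: algebra_simps)
  next
    case False
    then have "g t = 0" by (auto simp: g_def)
    then have "(\<lambda>x. k x t) = (\<lambda>x. 0)" by (auto simp: k_def)
    then show ?thesis using False by simp
  qed
  have \<psi>c: "continuous_on {0..L} \<psi>" using DERIV_continuous_on[OF \<psi>] .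
  have "(LINT x:{0..L}|lborel. integral {0..x} v * of_real (\<psi>' x)) = (\<integral>t. (\<integral>x. k x t \<partial>lborel) \<partial>lborel)"
    unfolding F inner by (simp add: set_lebesgue_integral_def)
  also have "\<dots> = (LINT t:{0..L}|lborel. of_real (\<psi> L) * v t - v t * of_real (\<psi> t))"
    unfolding inner2 by (simp add: set_lebesgue_integral_def)
  also have "\<dots> = (LINT t:{0..L}|lborel. of_real (\<psi> L) * v t) - (LINT t:{0..L}|lborel. v t * of_real (\<psi> t))"
    by (intro set_integral_diff set_integrable_mult_right set_integrable_mult_continuous v continuous_intros \<psi>c)
  also have "(LINT t:{0..L}|lborel. of_real (\<psi> L) * v t) = of_real (\<psi> L) * integral {0..L} v"
    using set_lebesgue_eq_integral(1)[OF v] by simp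
  finally show ?thesis .
qed

text \<open>Test functions rich enough to detect continuous functions: being an algebra, they
  contain the powers of a peaked kernel, and stability under differentiation makes them smooth by
  induction.\<close>

inductive_set trig_poly :: "real \<Rightarrow> (real \<Rightarrow> real) set" for L where
  const: "(\<lambda>x. c) \<in> trig_poly L"
| cos: "(\<lambda>x. cos (2 * pi * x / L)) \<in> trig_poly L"
| sin: "(\<lambda>x. sin (2 * pi * x / L)) \<in> trig_poly L"
| add: "f \<in> trig_poly L \<Longrightarrow> g \<in> trig_poly L \<Longrightarrow> (\<lambda>x. f x + g x) \<in> trig_poly L"
| mult: "f \<in> trig_poly L \<Longrightarrow> g \<in> trig_poly L \<Longrightarrow> (\<lambda>x. f x * g x) \<in> trig_poly L"

lemma trig_poly_power: "f \<in> trig_poly L \<Longrightarrow> (\<lambda>x. f x ^ n) \<in> trig_poly L"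
  by (induction n) (auto intro: trig_poly.intros)

lemma trig_poly_deriv:
  assumes "f \<in> trig_poly L" and L: "L > 0"
  shows "\<exists>g\<in>trig_poly L. \<forall>x. (f has_real_derivative g x) (at x)"
  using assms(1)
proof induction
  case (const c)
  show ?case by (rule bexI[of _ "\<lambda>x. 0"]) (auto intro: trig_poly.intros)
next
  case cos
  show ?case
  proof (rule bexI, rule allI)
    show "((\<lambda>x. cos (2 * pi * x / L)) has_real_derivative (- (2 * pi / L)) * sin (2 * pi * x / L)) (at x)" for x
      using L by (auto intro!: derivative_eq_intros)
  qed (intro trig_poly.intros)
next
  case sin
  show ?case
  proof (rule bexI, rule allI)
    show "((\<lambda>x. sin (2 * pi * x / L)) has_real_derivative (2 * pi / L) * cos (2 * pi * x / L)) (at x)" for x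
      using L by (auto intro!: derivative_eq_intros)
  qed (intro trig_poly.intros)
next
  case (add f g)
  then obtain f' g' where "f' \<in> trig_poly L" "g' \<in> trig_poly L"
    "\<And>x. (f has_real_derivative f' x) (at x)" "\<And>x. (g has_real_derivative g' x) (at x)" by blast
  then show ?case by (intro bexI[of _ "\<lambda>x. f' x + g' x"]) (auto intro: trig_poly.intros DERIV_add)
next
  case (mult f g)
  then obtain f' g' where "f' \<in> trig_poly L" "g' \<in> trig_poly L"
    "\<And>x. (f has_real_derivative f' x) (at x)" "\<And>x. (g has_real_derivative g' x) (at x)" by blast
  with mult show ?case
    by (intro bexI[of _ "\<lambda>x. f' x * g x + g' x * f x"]) (auto intro!: trig_poly.intros DERIV_mult)
qed

lemma trig_poly_periodic: "f \<in> trig_poly L \<Longrightarrow> L > 0 \<Longrightarrow> f (x + L) = f x"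
proof (induction rule: trig_poly.induct)
  case cos
  then have "2 * pi * (x + L) / L = 2 * pi * x / L + 2 * pi" by (simp add: field_simps)
  then show ?case by simp
next
  case sin
  then have "2 * pi * (x + L) / L = 2 * pi * x / L + 2 * pi" by (simp add: field_simps)
  then show ?case by simp
qed auto

lemma trig_poly_deriv_iter: "f \<in> trig_poly L \<Longrightarrow> L > 0 \<Longrightarrow> (deriv ^^ n) f \<in> trig_poly L"
proof (induction n arbitrary: f)
  case (Suc n)
  obtain g where g: "g \<in> trig_poly L" "\<And>x. (f has_real_derivative g x) (at x)"
    using trig_poly_deriv[OF Suc.prems] by blast
  then have "deriv f = g" by (intro ext DERIV_imp_deriv)
  then show ?case using Suc.IH[OF g(1) Suc.prems(2)] by (simp only: funpow_Suc_right o_def)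
qed simp

lemma smooth_periodic_trig_poly:
  assumes "f \<in> trig_poly L" "L > 0"
  shows "smooth_periodic L f"
  unfolding smooth_periodic_def
proof (intro conjI allI)
  show "f (x + L) = f x" for x using trig_poly_periodic[OF assms] .
  fix n
  obtain g where "\<forall>x. ((deriv ^^ n) f has_real_derivative g x) (at x)"
    using trig_poly_deriv[OF trig_poly_deriv_iter[OF assms], of n] assms(2) by blast
  then show "(deriv ^^ n) f differentiable_on UNIV"
    unfolding differentiable_on_def using real_differentiable_def by blast
qed

lemma smooth_periodic_DERIV:
  assumes "smooth_periodic L \<psi>"
  shows "(\<psi> has_real_derivative deriv \<psi> x) (at x)"
    and "continuous_on S \<psi>" and "continuous_on S (deriv \<psi>)"
proof -
  have "(deriv ^^ 0) \<psi> differentiable_on UNIV" "(deriv ^^ 1) \<psi> differentiable_on UNIV"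
    using assms unfolding smooth_periodic_def by blast+
  then have d: "\<psi> differentiable_on UNIV" "deriv \<psi> differentiable_on UNIV" by simp_all
  then show "(\<psi> has_real_derivative deriv \<psi> x) (at x)"
    by (simp add: differentiable_on_def DERIV_deriv_iff_real_differentiable)
  show "continuous_on S \<psi>" "continuous_on S (deriv \<psi>)"
    using d differentiable_imp_continuous_on continuous_on_subset by blast+
qed

lemma smooth_periodic_diff_const:
  assumes "smooth_periodic L \<psi>"
  shows "smooth_periodic L (\<lambda>x. \<psi> x - m)"
  unfolding smooth_periodic_def
proof (intro conjI allI)
  show "\<psi> (x + L) - m = \<psi> x - m" for x using assms by (simp add: smooth_periodic_def)
  fix n
  have d: "deriv (\<lambda>x. \<psi> x - m) = deriv \<psi>"
  proof
    fix x
    have "((\<lambda>x. \<psi> x - m) has_real_derivative deriv \<psi> x - 0) (at x)"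
      by (intro DERIV_diff smooth_periodic_DERIV[OF assms] DERIV_const)
    then show "deriv (\<lambda>x. \<psi> x - m) x = deriv \<psi> x" by (intro DERIV_imp_deriv) simp
  qed
  show "(deriv ^^ n) (\<lambda>x. \<psi> x - m) differentiable_on UNIV"
  proof (cases n)
    case 0
    have "(deriv ^^ 0) \<psi> differentiable_on UNIV" using assms unfolding smooth_periodic_def by blast
    then show ?thesis using 0 by (auto intro!: differentiable_on_diff)
  next
    case (Suc k)
    then have "(deriv ^^ n) (\<lambda>x. \<psi> x - m) = (deriv ^^ n) \<psi>"
      using d by (simp only: funpow_Suc_right o_def)
    then show ?thesis using assms unfolding smooth_periodic_def by metis
  qed
qed

text \<open>Zero mean is what makes the antiderivative periodic.\<close>

lemma smooth_periodic_antiderivative: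
  assumes \<rho>: "smooth_periodic L \<rho>" and L: "L > 0" and 0: "integral {0..L} \<rho> = 0"
  obtains \<psi> where "smooth_periodic L \<psi>" "deriv \<psi> = \<rho>"
proof -
  have "\<exists>F. \<forall>x::real. -\<infinity> < ereal x \<longrightarrow> ereal x < \<infinity> \<longrightarrow> (F has_vector_derivative \<rho> x) (at x)"
    by (rule einterval_antiderivative)
      (use smooth_periodic_DERIV(1)[OF \<rho>] in \<open>auto intro: DERIV_isCont\<close>)
  then obtain \<psi> where "\<And>x. (\<psi> has_vector_derivative \<rho> x) (at x)" by auto
  then have d: "(\<psi> has_real_derivative \<rho> x) (at x)" for x
    by (simp add: has_real_derivative_iff_has_vector_derivative)
  then have dd: "deriv \<psi> = \<rho>" by (intro ext DERIV_imp_deriv)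
  have "smooth_periodic L \<psi>" unfolding smooth_periodic_def
  proof (intro conjI allI)
    have "((\<lambda>x. \<psi> (x + L) - \<psi> x) has_real_derivative 0) (at x)" for x
    proof -
      have "((\<lambda>x. \<psi> (x + L)) has_real_derivative \<rho> (x + L)) (at x)"
        using d[of "x + L"] by (simp add: DERIV_shift)
      from DERIV_diff[OF this d] show ?thesis using \<rho> by (simp add: smooth_periodic_def)
    qed
    then have c: "\<psi> (x + L) - \<psi> x = \<psi> (0 + L) - \<psi> 0" for x
      using DERIV_isconst_all[of "\<lambda>x. \<psi> (x + L) - \<psi> x" x 0] by blast
    have "(\<rho> has_integral \<psi> L - \<psi> 0) {0..L}"
      using L by (intro fundamental_theorem_of_calculus)
        (auto simp flip: has_real_derivative_iff_has_vector_derivative intro: has_field_derivative_at_within d)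
    then have "\<psi> L - \<psi> 0 = 0" using 0 integral_unique by metis
    then show "\<psi> (x + L) = \<psi> x" for x using c[of x] by simp
    fix n
    show "(deriv ^^ n) \<psi> differentiable_on UNIV"
    proof (cases n)
      case 0
      then show ?thesis using d by (auto simp: differentiable_on_def real_differentiable_def)
    next
      case (Suc k)
      then have "(deriv ^^ n) \<psi> = (deriv ^^ k) \<rho>" using dd by (simp only: funpow_Suc_right o_def)
      then show ?thesis using \<rho> unfolding smooth_periodic_def by metis
    qed
  qed
  then show ?thesis using dd that by blast
qed

text \<open>Powers of \<open>1 + cos (2\<pi>(x - y)/L) - cos (2\<pi>\<delta>/L)\<close> concentrate near \<open>y\<close>.\<close>

lemma trig_poly_orthogonal_not_pos:
  fixes F :: "real \<Rightarrow> real"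
  assumes F: "continuous_on {0..L} F"
    and orth: "\<And>p. p \<in> trig_poly L \<Longrightarrow> integral {0..L} (\<lambda>x. F x * p x) = 0"
    and y: "0 < y" "y < L"
  shows "F y \<le> 0"
proof (rule ccontr)
  assume "\<not> F y \<le> 0"
  define m where "m = F y / 2"
  have m: "m > 0" using \<open>\<not> F y \<le> 0\<close> by (simp add: m_def)
  have L: "L > 0" using y by simp
  obtain d where d: "d > 0" "\<And>x. x \<in> {0..L} \<Longrightarrow> dist x y < d \<Longrightarrow> dist (F x) (F y) < m"
    using F y m unfolding continuous_on_iff by (metis atLeastAtMost_iff less_imp_le)
  \<comment> \<open>The second minimum gives |x - y| <= L - \<delta> on the cell, so a point at
    distance at least \<delta> from y is also that far from y on the circle.\<close>
  define \<delta> where "\<delta> = min (d / 2) (min y (L - y))"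
  have \<delta>: "\<delta> > 0" "\<delta> < d" "\<delta> \<le> y" "\<delta> \<le> L - y" using d y by (auto simp: \<delta>_def)
  have Fm: "F x \<ge> m" if "x \<in> {0..L}" "\<bar>x - y\<bar> \<le> \<delta>" for x
    using d(2)[OF that(1)] that \<delta> by (auto simp: dist_real_def m_def field_simps abs_if split: if_splits)
  define t where "t x = 1 + cos (2 * pi * (x - y) / L) - cos (2 * pi * \<delta> / L)" for x
  have tp: "t \<in> trig_poly L"
  proof -
    have "t = (\<lambda>x. (1 - cos (2 * pi * \<delta> / L)) + (cos (2 * pi * y / L) * cos (2 * pi * x / L) + sin (2 * pi * y / L) * sin (2 * pi * x / L)))"
    proof
      fix x
      have "2 * pi * (x - y) / L = 2 * pi * x / L - 2 * pi * y / L"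
        by (simp add: diff_divide_distrib right_diff_distrib)
      then show "t x = (1 - cos (2 * pi * \<delta> / L)) + (cos (2 * pi * y / L) * cos (2 * pi * x / L) + sin (2 * pi * y / L) * sin (2 * pi * x / L))"
        by (simp add: t_def cos_diff)
    qed
    then show ?thesis by (simp only:) (intro trig_poly.intros)
  qed
  \<comment> \<open>The value of t at distance \<delta>/2 from y: t is at least \<rho> > 1 within
    that distance and at most 1 in modulus from distance \<delta> on.\<close>
  define \<rho> where "\<rho> = 1 + cos (pi * \<delta> / L) - cos (2 * pi * \<delta> / L)"
  have \<delta>2: "2 * \<delta> \<le> L" using \<delta> by simp
  have \<delta>pi: "2 * pi * \<delta> / L \<le> pi" "0 < pi * \<delta> / L" "pi * \<delta> / L \<le> pi" using \<delta>2 \<delta> L by (auto simp: field_simps)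
  have \<rho>1: "\<rho> > 1"
    using cos_monotone_0_pi[of "pi * \<delta> / L" "2 * pi * \<delta> / L"] \<delta>pi \<delta> L by (simp add: \<rho>_def field_simps)
  have cosabs: "cos (2 * pi * (x - y) / L) = cos (2 * pi * \<bar>x - y\<bar> / L)" for x
  proof -
    have "2 * pi * \<bar>x - y\<bar> / L = \<bar>2 * pi * (x - y) / L\<bar>" using L by (simp add: abs_mult)
    then show ?thesis by (simp only: cos_abs_real)
  qed
  have arg: "2 * pi * s / L \<le> 2 * pi * r / L" if "s \<le> r" for s r
    using that L by (simp add: divide_right_mono)
  have t\<rho>: "t x \<ge> \<rho>" if "\<bar>x - y\<bar> \<le> \<delta> / 2" for x
  proof -
    have "cos (2 * pi * (\<delta> / 2) / L) \<le> cos (2 * pi * \<bar>x - y\<bar> / L)"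
      using arg[OF that] \<delta>pi \<delta> L by (intro cos_monotone_0_pi_le) auto
    then show ?thesis unfolding t_def \<rho>_def cosabs by simp
  qed
  have t1: "t x \<ge> 1" if "\<bar>x - y\<bar> \<le> \<delta>" for x
  proof -
    have "cos (2 * pi * \<delta> / L) \<le> cos (2 * pi * \<bar>x - y\<bar> / L)"
      using arg[OF that] \<delta>pi \<delta> L by (intro cos_monotone_0_pi_le) auto
    then show ?thesis unfolding t_def cosabs by simp
  qed
  have tout: "\<bar>t x\<bar> \<le> 1" if "x \<in> {0..L}" "\<bar>x - y\<bar> \<ge> \<delta>" for x
  proof -
    have u: "\<bar>x - y\<bar> \<le> L - \<delta>" using that \<delta> by auto
    have "cos (2 * pi * \<bar>x - y\<bar> / L) \<le> cos (2 * pi * \<delta> / L)"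
    proof (cases "2 * \<bar>x - y\<bar> \<le> L")
      case True
      then have "2 * pi * \<bar>x - y\<bar> / L \<le> pi" using L by (simp add: field_simps)
      then show ?thesis using arg[OF that(2)] \<delta> L by (intro cos_monotone_0_pi_le) auto
    next
      case False
      have e: "cos (2 * pi * \<bar>x - y\<bar> / L) = cos (2 * pi * (L - \<bar>x - y\<bar>) / L)"
      proof -
        have "2 * pi * (L - \<bar>x - y\<bar>) / L = 2 * pi - 2 * pi * \<bar>x - y\<bar> / L" using L by (simp add: field_simps)
        then show ?thesis by (simp add: cos_diff)
      qed
      have "2 * pi * (L - \<bar>x - y\<bar>) / L \<le> pi" using False L by (simp add: field_simps)
      moreover have "2 * pi * \<delta> / L \<le> 2 * pi * (L - \<bar>x - y\<bar>) / L" using u by (intro arg) auto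
      ultimately show ?thesis unfolding e using \<delta> L by (intro cos_monotone_0_pi_le) auto
    qed
    moreover have "cos (2 * pi * \<delta> / L) \<le> 1" "- 1 \<le> cos (2 * pi * (x - y) / L)" by auto
    ultimately show ?thesis unfolding t_def cosabs[symmetric] abs_le_iff by linarith
  qed
  obtain M where M: "0 \<le> M" "\<And>x. x \<in> {0..L} \<Longrightarrow> norm (F x) \<le> M"
    using continuous_on_Icc_bound[OF F] by blast
  have tc: "continuous_on A t" for A unfolding t_def by (intro continuous_intros) (use L in auto)
  \<comment> \<open>Adding M makes the integrand nonnegative on the whole cell, so everything
    outside the inner interval may be dropped. Orthogonality reduces the total to M L, while the
    left side grows like \<rho>^n.\<close>
  have key: "\<delta> * (m * \<rho> ^ n) \<le> M * L" for n
  proof -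
    have c: "continuous_on {0..L} (\<lambda>x. F x * t x ^ n)" by (intro continuous_intros F tc)
    have sub: "{y - \<delta>/2..y + \<delta>/2} \<subseteq> {0..L}" using \<delta> by auto
    have lowb: "F x * t x ^ n + M \<ge> 0" if x: "x \<in> {0..L}" for x
    proof (cases "\<bar>x - y\<bar> \<le> \<delta>")
      case True
      then have "F x * t x ^ n \<ge> 0" using Fm[OF x] t1[of x] m by (intro mult_nonneg_nonneg) auto
      then show ?thesis using M by simp
    next
      case False
      have "\<bar>F x * t x ^ n\<bar> \<le> M * 1"
        unfolding abs_mult power_abs using M(2)[OF x] tout[OF x] False M(1)
        by (intro mult_mono power_le_one) auto
      then show ?thesis by simp
    qed
    have "\<delta> * (m * \<rho> ^ n) = integral {y - \<delta>/2..y + \<delta>/2} (\<lambda>x. m * \<rho> ^ n)" using \<delta> by simp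
    also have "\<dots> \<le> integral {y - \<delta>/2..y + \<delta>/2} (\<lambda>x. F x * t x ^ n + M)"
    proof (rule integral_le)
      show "(\<lambda>x. F x * t x ^ n + M) integrable_on {y - \<delta>/2..y + \<delta>/2}"
        by (intro integrable_continuous_real continuous_intros continuous_on_subset[OF c sub] continuous_on_subset[OF F sub] tc)
      fix x assume x: "x \<in> {y - \<delta>/2..y + \<delta>/2}"
      then have "x - y \<le> \<delta>/2" "- (x - y) \<le> \<delta>/2" by auto
      then have xd: "\<bar>x - y\<bar> \<le> \<delta>/2" by (rule abs_leI)
      have "m * \<rho> ^ n \<le> F x * t x ^ n"
        using xd x sub Fm[of x] t\<rho>[of x] m \<rho>1 \<delta> by (intro mult_mono power_mono) auto
      then show "m * \<rho> ^ n \<le> F x * t x ^ n + M" using M by simp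
    qed auto
    also have "\<dots> \<le> integral {0..L} (\<lambda>x. F x * t x ^ n + M)"
    proof (rule integral_subset_le[OF sub])
      show "(\<lambda>x. F x * t x ^ n + M) integrable_on {y - \<delta>/2..y + \<delta>/2}" "(\<lambda>x. F x * t x ^ n + M) integrable_on {0..L}"
        by (intro integrable_continuous_real continuous_intros continuous_on_subset[OF F sub] F tc)+
    qed (use lowb in auto)
    also have "\<dots> = integral {0..L} (\<lambda>x. F x * t x ^ n) + integral {0..L} (\<lambda>x. M)"
      by (intro integral_add integrable_continuous_real c continuous_on_const)
    also have "\<dots> = M * L" using orth[OF trig_poly_power[OF tp]] L by simp
    finally show ?thesis .
  qed
  obtain n where "M * L / (\<delta> * m) < \<rho> ^ n" using real_arch_pow[OF \<rho>1] by blast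
  then have "M * L < \<delta> * (m * \<rho> ^ n)" using \<delta> m by (simp add: field_simps)
  with key[of n] show False by simp
qed

text \<open>The one-sided statement for F and for -F settles the interior of the cell; the end
  points follow by continuity.\<close>

lemma trig_poly_orthogonal_zero_real:
  fixes F :: "real \<Rightarrow> real"
  assumes F: "continuous_on {0..L} F" and L: "0 < L"
    and orth: "\<And>p. p \<in> trig_poly L \<Longrightarrow> integral {0..L} (\<lambda>x. F x * p x) = 0"
    and x: "x \<in> {0..L}"
  shows "F x = 0"
proof (rule continuous_constant_on_closure[of "{0<..<L}" F])
  show "continuous_on (closure {0<..<L}) F" using F L by simp
  show "x \<in> closure {0<..<L}" using x L by simp
  fix y assume "y \<in> {0<..<L}"
  then have y: "0 < y" "y < L" by auto
  have "- F y \<le> 0"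
    by (rule trig_poly_orthogonal_not_pos[of L "\<lambda>x. - F x"]) (use F orth y in \<open>auto intro: continuous_intros\<close>)
  moreover have "F y \<le> 0" by (rule trig_poly_orthogonal_not_pos[OF F orth y])
  ultimately show "F y = 0" by simp
qed

lemma trig_poly_orthogonal_zero:
  fixes F :: "real \<Rightarrow> complex"
  assumes F: "continuous_on {0..L} F" and L: "0 < L"
    and orth: "\<And>p. p \<in> trig_poly L \<Longrightarrow> (LINT x:{0..L}|lborel. F x * of_real (p x)) = 0"
    and x: "x \<in> {0..L}"
  shows "F x = 0"
proof (rule complex_eqI)
  have hi: "((\<lambda>x. F x * of_real (p x)) has_integral 0) {0..L}" if p: "p \<in> trig_poly L" for p
  proof -
    have "set_integrable lborel {0..L} (\<lambda>x. F x * of_real (p x))"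
      using smooth_periodic_DERIV(2)[OF smooth_periodic_trig_poly[OF p L]]
      by (intro set_integrable_continuous continuous_intros F)
    from set_lebesgue_eq_integral[OF this] orth[OF p] show ?thesis by (simp add: has_integral_iff)
  qed
  show "Re (F x) = Re 0"
  proof (simp, rule trig_poly_orthogonal_zero_real[of L "\<lambda>x. Re (F x)"])
    fix p assume "p \<in> trig_poly L"
    from has_integral_Re[OF hi[OF this]] show "integral {0..L} (\<lambda>x. Re (F x) * p x) = 0"
      by (simp add: integral_unique)
  qed (use F L x in \<open>auto intro: continuous_intros\<close>)
  show "Im (F x) = Im 0"
  proof (simp, rule trig_poly_orthogonal_zero_real[of L "\<lambda>x. Im (F x)"])
    fix p assume "p \<in> trig_poly L"
    from has_integral_Im[OF hi[OF this]] show "integral {0..L} (\<lambda>x. Im (F x) * p x) = 0"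
      by (simp add: integral_unique)
  qed (use F L x in \<open>auto intro: continuous_intros\<close>)
qed

text \<open>The du Bois-Reymond argument: \<rho> minus its mean is the derivative of a periodic test
  function, so h is orthogonal to it, and subtracting the mean c of h disposes of the constant part
  of \<rho>.\<close>

lemma weak_constant_orthogonal:
  assumes h: "set_integrable lborel {0..L} h" and L: "0 < L"
    and weak: "\<And>\<psi>. smooth_periodic L \<psi> \<Longrightarrow> (LINT x:{0..L}|lborel. h x * complex_of_real (deriv \<psi> x)) = 0"
    and \<rho>: "smooth_periodic L \<rho>"
  defines "c \<equiv> integral {0..L} h / of_real L"
  shows "(LINT x:{0..L}|lborel. (h x - c) * of_real (\<rho> x)) = 0"
proof -
  define m where "m = integral {0..L} \<rho> / L"
  note \<rho>c = smooth_periodic_DERIV(2)[OF \<rho>]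
  have "integral {0..L} (\<lambda>x. \<rho> x - m) = integral {0..L} \<rho> - integral {0..L} (\<lambda>x. m)"
    by (intro integral_diff integrable_continuous_real \<rho>c continuous_on_const)
  then have "integral {0..L} (\<lambda>x. \<rho> x - m) = 0" using L by (simp add: m_def)
  then obtain \<psi> where \<psi>: "smooth_periodic L \<psi>" "deriv \<psi> = (\<lambda>x. \<rho> x - m)"
    using smooth_periodic_antiderivative[OF smooth_periodic_diff_const[OF \<rho>] L] by blast
  have i\<rho>: "(LINT x:{0..L}|lborel. complex_of_real (\<rho> x)) = of_real (L * m)"
  proof -
    have "(LINT x:{0..L}|lborel. complex_of_real (\<rho> x)) = integral {0..L} (\<lambda>x. complex_of_real (\<rho> x))"
      by (intro set_lebesgue_eq_integral set_integrable_continuous continuous_intros \<rho>c)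
    also have "\<dots> = of_real (integral {0..L} \<rho>)"
      using has_integral_of_real[OF integrable_integral[OF integrable_continuous_real[OF \<rho>c[of "{0..L}"]]]]
      by (rule integral_unique)
    finally show ?thesis using L by (simp add: m_def)
  qed
  have ih: "(LINT x:{0..L}|lborel. h x) = of_real L * c"
    using set_lebesgue_eq_integral(1)[OF h] L by (simp add: c_def)
  have S1: "set_integrable lborel {0..L} (\<lambda>x. h x * of_real (\<rho> x - m))"
    using set_integrable_mult_continuous[OF h, of "\<lambda>x. of_real (\<rho> x - m)"] \<rho>c by (simp add: continuous_intros)
  have S2: "set_integrable lborel {0..L} (\<lambda>x. of_real m * h x)" using h by simp
  have S3: "set_integrable lborel {0..L} (\<lambda>x. c * of_real (\<rho> x))"
    by (intro set_integrable_continuous continuous_intros \<rho>c)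
  have "(LINT x:{0..L}|lborel. (h x - c) * of_real (\<rho> x)) =
     (LINT x:{0..L}|lborel. (h x * of_real (\<rho> x - m) + of_real m * h x) - c * of_real (\<rho> x))"
    by (intro set_lebesgue_integral_cong) (auto simp: algebra_simps)
  also have "\<dots> = ((LINT x:{0..L}|lborel. h x * of_real (\<rho> x - m)) + (LINT x:{0..L}|lborel. of_real m * h x))
      - (LINT x:{0..L}|lborel. c * of_real (\<rho> x))"
    using S1 S2 S3 by (simp only: set_integral_diff set_integral_add)
  also have "(LINT x:{0..L}|lborel. h x * of_real (\<rho> x - m)) = 0" using weak[OF \<psi>(1)] \<psi>(2) by simp
  finally show ?thesis using ih i\<rho> by simp
qed

text \<open>Half-lines are stable under intersection and generate the Borel sets. With f cut off to
  the cell, integrals vanishing on half-lines therefore vanish on all Borel sets, which forces f = 0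
  almost everywhere.\<close>

lemma AE_zero_of_primitive_zero:
  fixes f :: "real \<Rightarrow> complex"
  assumes f: "set_integrable lborel {0..L} f" and L: "0 \<le> L"
    and 0: "\<And>x. x \<in> {0..L} \<Longrightarrow> integral {0..x} f = 0"
  shows "AE x in lborel. x \<in> {0..L} \<longrightarrow> f x = 0"
proof -
  define g where "g x = indicator {0..L} x *\<^sub>R f x" for x
  have g: "integrable lborel g" using f by (simp add: g_def[abs_def] set_integrable_def)
  have gs: "set_integrable lborel A g" if "A \<in> sets borel" for A
    using g that unfolding set_integrable_def by (intro integrable_mult_indicator) auto
  have z: "(LINT t:{0..x}|lborel. f t) = 0" if "x \<in> {0..L}" for x
    using set_lebesgue_eq_integral(1)[OF set_integrable_subset[OF f, of "{0..x}"]] 0[OF that] that by auto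
  have gle: "(LINT x:{..a}|lborel. g x) = 0" for a
  proof -
    have "(LINT x:{..a}|lborel. g x) = (LINT x:{0..min a L}|lborel. f x)"
      unfolding set_lebesgue_integral_def g_def
      by (intro Bochner_Integration.integral_cong) (auto simp: indicator_def)
    also have "\<dots> = 0"
      using z[of "min a L"] L by (cases "a < 0") (auto simp: set_lebesgue_integral_def)
    finally show ?thesis .
  qed
  have gU: "(LINT x:UNIV|lborel. g x) = 0"
    using z[of L] L by (simp add: set_lebesgue_integral_def g_def)
  have int: "Int_stable (range (\<lambda>a::real. {..a}))" by (auto simp: Int_stable_def)
  have sub: "range (\<lambda>a::real. {..a}) \<subseteq> Pow UNIV" by simp
  have all: "(LINT x:A|lborel. g x) = 0" if "A \<in> sigma_sets UNIV (range (\<lambda>a::real. {..a}))" for A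
    using int sub that
  proof (induction rule: sigma_sets_induct_disjoint)
    case (basic A)
    then show ?case using gle by auto
  next
    case empty
    then show ?case by (simp add: set_lebesgue_integral_def)
  next
    case (compl A)
    then have A: "A \<in> sets borel" by (simp add: borel_eq_atMost)
    have "(LINT x:A \<union> (UNIV - A)|lborel. g x) = (LINT x:A|lborel. g x) + (LINT x:UNIV - A|lborel. g x)"
      using A by (intro set_integral_Un gs) auto
    then show ?case using compl gU by simp
  next
    case (union A)
    then have A: "range A \<subseteq> sets borel" by (auto simp: borel_eq_atMost)
    have "(LINT x:(\<Union>i. A i)|lborel. g x) = (\<Sum>i. (LINT x:(A i)|lborel. g x))"
      using A union(1) by (intro lebesgue_integral_countable_add gs) (auto simp: disjoint_family_on_def)
    then show ?case using union by simp
  qed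
  have "AE x in lborel. g x = 0"
    by (rule sigma_finite_measure.density_zero[OF sigma_finite_lborel g]) (use all in \<open>simp add: borel_eq_atMost\<close>)
  then show ?thesis by (rule AE_mp) (auto simp: g_def)
qed

lemma integral_primitive_continuous:
  fixes v :: "real \<Rightarrow> complex"
  assumes "set_integrable lborel {0..L} v"
  shows "continuous_on {0..L} (\<lambda>x. integral {0..x} v)"
  using set_lebesgue_eq_integral(2)[OF assms] by (rule indefinite_integral_continuous_1)

text \<open>Passing to the primitive F trades an integrable function for a continuous one. By parts
  F has weak derivative zero, so F minus its mean is orthogonal to all trigonometric polynomials and
  F is constant.\<close>

lemma smooth_orthogonal_AE_zero:
  fixes f :: "real \<Rightarrow> complex"
  assumes f: "set_integrable lborel {0..L} f" and L: "0 < L"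
    and orth: "\<And>\<psi>. smooth_periodic L \<psi> \<Longrightarrow> (LINT x:{0..L}|lborel. f x * of_real (\<psi> x)) = 0"
  shows "AE x in lborel. x \<in> {0..L} \<longrightarrow> f x = 0"
proof (rule AE_zero_of_primitive_zero[OF f])
  have iL: "integral {0..L} f = 0"
    using orth[OF smooth_periodic_trig_poly[OF trig_poly.const[of 1] L]] set_lebesgue_eq_integral(1)[OF f] by simp
  define F where "F x = integral {0..x} f" for x
  have Fc: "continuous_on {0..L} F" unfolding F_def by (rule integral_primitive_continuous[OF f])
  define c where "c = integral {0..L} F / of_real L"
  have w: "(LINT x:{0..L}|lborel. F x * complex_of_real (deriv \<psi> x)) = 0" if \<psi>: "smooth_periodic L \<psi>" for \<psi>
    unfolding F_def
    using integral_primitive_by_parts[OF f, of \<psi> "deriv \<psi>"] smooth_periodic_DERIV[OF \<psi>] L iL orth[OF \<psi>]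
    by (simp add: has_field_derivative_at_within)
  have "(LINT x:{0..L}|lborel. (F x - c) * of_real (p x)) = 0" if "p \<in> trig_poly L" for p
    unfolding c_def
    by (rule weak_constant_orthogonal[OF set_integrable_continuous[OF Fc] L w smooth_periodic_trig_poly[OF that L]])
  moreover have "continuous_on {0..L} (\<lambda>x. F x - c)" by (intro continuous_intros Fc)
  ultimately have Fconst: "F x - c = 0" if "x \<in> {0..L}" for x
    using trig_poly_orthogonal_zero[of L "\<lambda>x. F x - c"] L that by blast
  show "integral {0..x} f = 0" if "x \<in> {0..L}" for x
    using Fconst[OF that] Fconst[of 0] L by (simp add: F_def)
qed (use L in auto)

text \<open>The test function 1 shows that v has mean zero, which removes the boundary term in the
  integration by parts. Hence u minus the primitive of v has weak derivative zero and is
  constant.\<close>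

lemma weak_deriv_imp_primitive:
  assumes u: "set_integrable lborel {0..L} u" and v: "set_integrable lborel {0..L} v" and L: "0 < L"
    and weak: "is_weak_deriv L u v"
  obtains c where "AE x in lborel. x \<in> {0..L} \<longrightarrow> u x = c + integral {0..x} v" "integral {0..L} v = 0"
proof -
  have iv: "integral {0..L} v = 0"
  proof -
    have "smooth_periodic L (\<lambda>x. 1)" by (rule smooth_periodic_trig_poly[OF trig_poly.const[of 1] L])
    then have "(LINT x:{0..L}|lborel. u x * complex_of_real (deriv (\<lambda>x. 1) x)) = - (LINT x:{0..L}|lborel. v x * complex_of_real 1)"
      using weak unfolding is_weak_deriv_def by blast
    then show ?thesis using set_lebesgue_eq_integral(1)[OF v] by simp
  qed
  define W where "W x = integral {0..x} v" for x
  have Wc: "continuous_on {0..L} W" unfolding W_def by (rule integral_primitive_continuous[OF v])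
  have h: "set_integrable lborel {0..L} (\<lambda>x. u x - W x)"
    by (intro set_integral_diff u set_integrable_continuous Wc)
  have w: "(LINT x:{0..L}|lborel. (u x - W x) * complex_of_real (deriv \<psi> x)) = 0" if \<psi>: "smooth_periodic L \<psi>" for \<psi>
  proof -
    note D = smooth_periodic_DERIV[OF \<psi>]
    have "(LINT x:{0..L}|lborel. (u x - W x) * complex_of_real (deriv \<psi> x)) =
       (LINT x:{0..L}|lborel. u x * complex_of_real (deriv \<psi> x)) - (LINT x:{0..L}|lborel. W x * complex_of_real (deriv \<psi> x))"
      unfolding left_diff_distrib
      by (intro set_integral_diff set_integrable_mult_continuous u set_integrable_continuous Wc continuous_intros D)
    also have "(LINT x:{0..L}|lborel. W x * complex_of_real (deriv \<psi> x)) = - (LINT x:{0..L}|lborel. v x * of_real (\<psi> x))"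
      unfolding W_def using integral_primitive_by_parts[OF v, of \<psi> "deriv \<psi>"] D L iv
      by (simp add: has_field_derivative_at_within)
    finally show ?thesis using weak \<psi> by (simp add: is_weak_deriv_def)
  qed
  define c where "c = integral {0..L} (\<lambda>x. u x - W x) / of_real L"
  have "set_integrable lborel {0..L} (\<lambda>x. (u x - W x) - c)"
    by (intro set_integral_diff h set_integrable_continuous continuous_on_const)
  moreover have "(LINT x:{0..L}|lborel. ((u x - W x) - c) * of_real (\<rho> x)) = 0" if "smooth_periodic L \<rho>" for \<rho>
    unfolding c_def by (rule weak_constant_orthogonal[OF h L w that])
  ultimately have "AE x in lborel. x \<in> {0..L} \<longrightarrow> (u x - W x) - c = 0"
    by (rule smooth_orthogonal_AE_zero[OF _ L])
  then have "AE x in lborel. x \<in> {0..L} \<longrightarrow> u x = c + integral {0..x} v"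
    by (rule AE_mp) (auto simp: W_def algebra_simps)
  then show ?thesis using iv that by blast
qed

section \<open>Square integrable periodic functions\<close>

lemma L2per_D:
  assumes "f \<in> L2per L"
  shows "f \<in> borel_measurable borel" "\<And>x. f (x + L) = f x"
    "set_integrable lborel {0..L} (\<lambda>x. (cmod (f x))\<^sup>2)"
  using assms by (auto simp: L2per_def)

lemma set_integrable_bound:
  fixes f :: "real \<Rightarrow> 'a :: {banach, second_countable_topology}" and g :: "real \<Rightarrow> real"
  assumes g: "set_integrable lborel {a..b} g" and f: "f \<in> borel_measurable borel"
    and le: "\<And>x. x \<in> {a..b} \<Longrightarrow> norm (f x) \<le> g x"
  shows "set_integrable lborel {a..b} f"
  unfolding set_integrable_def
proof (rule Bochner_Integration.integrable_bound[OF g[unfolded set_integrable_def]])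
  show "(\<lambda>x. indicator {a..b} x *\<^sub>R f x) \<in> borel_measurable lborel" using f by measurable
  show "AE x in lborel. norm (indicator {a..b} x *\<^sub>R f x) \<le> norm (indicator {a..b} x *\<^sub>R g x)"
    using le by (intro AE_I2) (auto simp: indicator_def intro: order_trans[OF _ abs_ge_self])
qed

lemma set_integrable_const_Icc: "set_integrable lborel {a..b::real} (\<lambda>x. c :: real)"
  by (rule borel_integrable_atLeastAtMost') simp

lemma L2per_set_integrable:
  assumes "f \<in> L2per L"
  shows "set_integrable lborel {0..L} f"
proof (rule set_integrable_bound)
  show "set_integrable lborel {0..L} (\<lambda>x. 1 + (cmod (f x))\<^sup>2)"
    by (intro set_integral_add set_integrable_const_Icc L2per_D(3)[OF assms])
  show "cmod (f x) \<le> 1 + (cmod (f x))\<^sup>2" for x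
  proof -
    have "2 * cmod (f x) \<le> 1 + (cmod (f x))\<^sup>2" using sum_squares_bound[of 1 "cmod (f x)"] by simp
    then show ?thesis using norm_ge_zero[of "f x"] by linarith
  qed
qed (use L2per_D[OF assms] in auto)

lemma L2per_bounded:
  assumes f: "f \<in> borel_measurable borel" "\<And>x. f (x + L) = f x" and C: "\<And>x. x \<in> {0..L} \<Longrightarrow> cmod (f x) \<le> C"
  shows "f \<in> L2per L"
proof -
  have "set_integrable lborel {0..L} (\<lambda>x. (cmod (f x))\<^sup>2)"
    by (rule set_integrable_bound[OF set_integrable_const_Icc[of 0 L "C\<^sup>2"]])
      (use f(1) C in \<open>auto intro!: power_mono\<close>)
  then show ?thesis using f by (simp add: L2per_def)
qed

lemma L2per_diff:
  assumes f: "f \<in> L2per L" and g: "g \<in> L2per L"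
  shows "(\<lambda>x. f x - g x) \<in> L2per L"
proof -
  note D = L2per_D[OF f] L2per_D[OF g]
  have m: "(\<lambda>x. f x - g x) \<in> borel_measurable borel" using D by measurable
  have "set_integrable lborel {0..L} (\<lambda>x. (cmod (f x - g x))\<^sup>2)"
  proof (rule set_integrable_bound)
    show "set_integrable lborel {0..L} (\<lambda>x. 2 * (cmod (f x))\<^sup>2 + 2 * (cmod (g x))\<^sup>2)"
      using D by (intro set_integral_add set_integrable_mult_right) auto
    show "(\<lambda>x. (cmod (f x - g x))\<^sup>2) \<in> borel_measurable borel" using m by measurable
    fix x
    have "(cmod (f x - g x))\<^sup>2 \<le> (cmod (f x) + cmod (g x))\<^sup>2"
      by (intro power_mono norm_triangle_ineq4) auto
    also have "\<dots> \<le> 2 * (cmod (f x))\<^sup>2 + 2 * (cmod (g x))\<^sup>2"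
      using sum_squares_bound[of "cmod (f x)" "cmod (g x)"] by (simp add: power2_sum)
    finally show "norm ((cmod (f x - g x))\<^sup>2) \<le> 2 * (cmod (f x))\<^sup>2 + 2 * (cmod (g x))\<^sup>2" by simp
  qed
  then show ?thesis using D m by (simp add: L2per_def)
qed

lemma L2per_mult_bounded:
  assumes f: "f \<in> L2per L" and m: "m \<in> borel_measurable borel" "\<And>x. m (x + L) = m x"
    and C: "\<And>x. x \<in> {0..L} \<Longrightarrow> cmod (m x) \<le> C"
  shows "(\<lambda>x. m x * f x) \<in> L2per L"
proof -
  note D = L2per_D[OF f]
  have "set_integrable lborel {0..L} (\<lambda>x. (cmod (m x * f x))\<^sup>2)"
  proof (rule set_integrable_bound)
    show "set_integrable lborel {0..L} (\<lambda>x. C\<^sup>2 * (cmod (f x))\<^sup>2)" using D by simp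
    show "(\<lambda>x. (cmod (m x * f x))\<^sup>2) \<in> borel_measurable borel" using D m by measurable
    show "norm ((cmod (m x * f x))\<^sup>2) \<le> C\<^sup>2 * (cmod (f x))\<^sup>2" if "x \<in> {0..L}" for x
      using C[OF that] by (auto simp: norm_mult power_mult_distrib intro!: mult_right_mono power_mono)
  qed
  then show ?thesis using D m by (simp add: L2per_def)
qed

section \<open>Periodic extension from a cell\<close>

lemma periodic_shift_int:
  assumes "\<And>x::real. f (x + L) = f x"
  shows "f (x + of_int n * L) = f x"
proof (induction n rule: int_induct[where k = 0])
  case (step1 i)
  have "f (x + of_int (i + 1) * L) = f ((x + of_int i * L) + L)" by (simp add: algebra_simps)
  then show ?case using assms step1 by metis
next
  case (step2 i)
  have "f (x + of_int i * L) = f ((x + of_int (i - 1) * L) + L)" by (simp add: algebra_simps)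
  then show ?case using assms step2 by metis
qed simp

definition per_rem :: "real \<Rightarrow> real \<Rightarrow> real" where
  "per_rem L x = x - of_int \<lfloor>x / L\<rfloor> * L"

lemma per_rem_bounds: "0 < L \<Longrightarrow> 0 \<le> per_rem L x \<and> per_rem L x < L"
  using floor_divide_lower[of L x] floor_divide_upper[of L x] by (simp add: per_rem_def algebra_simps)

lemma per_rem_id: "0 \<le> x \<Longrightarrow> x < L \<Longrightarrow> per_rem L x = x"
proof -
  assume "0 \<le> x" "x < L"
  then have "\<lfloor>x / L\<rfloor> = 0" by (simp add: floor_eq_iff)
  then show ?thesis by (simp add: per_rem_def)
qed

lemma per_rem_add: "0 < L \<Longrightarrow> per_rem L (x + L) = per_rem L x"
proof -
  assume "0 < L"
  then have "(x + L) / L = x / L + 1" by (simp add: field_simps)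
  then show ?thesis by (simp add: per_rem_def algebra_simps)
qed

lemma periodic_per_rem:
  assumes "\<And>x::real. f (x + L) = f x"
  shows "f (per_rem L x) = f x"
  using periodic_shift_int[of f L x "- \<lfloor>x / L\<rfloor>"] assms by (simp add: per_rem_def)

text \<open>The exceptional set is covered by the countably many translates of a null set in the
  cell.\<close>

lemma AE_periodic:
  assumes L: "0 < L" and f: "\<And>x::real. f (x + L) = f x" and g: "\<And>x. g (x + L) = g x"
    and ae: "AE x in lborel. x \<in> {0..L} \<longrightarrow> f x = g x"
  shows "AE x in lborel. f x = g x"
proof -
  obtain N where N: "N \<in> null_sets lborel" "\<And>x. x \<notin> N \<Longrightarrow> x \<in> {0..L} \<longrightarrow> f x = g x"
    using ae by (auto elim!: AE_E3)
  have tr: "(\<lambda>x. of_int n * L + x) ` N \<in> null_sets lborel" for n :: int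
  proof -
    have "(\<lambda>x. of_int n * L + x) ` N = {x. x - of_int n * L \<in> N}" by (force simp: image_iff)
    then show ?thesis using null_sets_translation[OF N(1)] by simp
  qed
  have un: "(\<Union>n::int. (\<lambda>x. of_int n * L + x) ` N) \<in> null_sets lborel" by (intro null_sets_UN tr)
  show ?thesis
  proof (rule AE_I'[OF un], rule subsetI)
    fix x assume "x \<in> {x \<in> space lborel. f x \<noteq> g x}"
    then have "f (per_rem L x) \<noteq> g (per_rem L x)"
      using periodic_per_rem[of f L x] periodic_per_rem[of g L x] f g by simp
    then have "per_rem L x \<in> N" using N(2)[of "per_rem L x"] per_rem_bounds[OF L, of x] by auto
    moreover have "x = of_int \<lfloor>x / L\<rfloor> * L + per_rem L x" by (simp add: per_rem_def)
    ultimately show "x \<in> (\<Union>n::int. (\<lambda>x. of_int n * L + x) ` N)" by blast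
  qed
qed

text \<open>Only values on [0, L) are read; the value of U at L has to be matched separately, as in
  \<open>per_ext_eq\<close>.\<close>

definition per_ext :: "real \<Rightarrow> (real \<Rightarrow> complex) \<Rightarrow> real \<Rightarrow> complex" where
  "per_ext L U x = U (per_rem L x)"

lemma per_ext_periodic: "0 < L \<Longrightarrow> per_ext L U (x + L) = per_ext L U x"
  by (simp add: per_ext_def per_rem_add)

lemma per_ext_eq:
  assumes "0 < L" "U L = U 0" "x \<in> {0..L}"
  shows "per_ext L U x = U x"
  using assms per_rem_id[of x L] per_rem_add[of L 0] per_rem_id[of 0 L]
  by (cases "x = L") (auto simp: per_ext_def)

lemma per_ext_L2per:
  assumes L: "0 < L" and U: "continuous_on {0..L} U"
  shows "per_ext L U \<in> L2per L"
proof -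
  obtain C where C: "\<And>x. x \<in> {0..L} \<Longrightarrow> cmod (U x) \<le> C" using continuous_on_Icc_bound[OF U] by blast
  have r: "per_rem L x \<in> {0..L}" for x using per_rem_bounds[OF L, of x] by auto
  have m1: "(\<lambda>x. indicator {0..L} x *\<^sub>R U x) \<in> borel_measurable borel"
    using borel_measurable_continuous_on_indicator[OF _ U] by simp
  have m2: "per_rem L \<in> borel_measurable borel" unfolding per_rem_def[abs_def] by measurable
  have "(\<lambda>x. indicator {0..L} (per_rem L x) *\<^sub>R U (per_rem L x)) \<in> borel_measurable borel"
    using measurable_compose[OF m2 m1] .
  then have m: "per_ext L U \<in> borel_measurable borel"
    using r by (simp add: per_ext_def[abs_def])
  show ?thesis
  proof (rule L2per_bounded[OF m, of _ C])
    show "per_ext L U (x + L) = per_ext L U x" for x by (rule per_ext_periodic[OF L])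
    show "cmod (per_ext L U x) \<le> C" for x unfolding per_ext_def by (rule C[OF r])
  qed
qed

section \<open>Classical representatives of twice weakly differentiable functions\<close>

lemma integral_cong_AE_Icc:
  fixes f g :: "real \<Rightarrow> complex"
  assumes f: "set_integrable lborel {0..L} f" and g: "set_integrable lborel {0..L} g"
    and ae: "AE x in lborel. x \<in> {0..L} \<longrightarrow> f x = g x" and x: "x \<in> {0..L}"
  shows "integral {0..x} f = integral {0..x} g"
proof -
  have sub: "{0..x} \<subseteq> {0..L}" using x by auto
  have f': "set_integrable lborel {0..x} f" and g': "set_integrable lborel {0..x} g"
    using set_integrable_subset[OF f _ sub] set_integrable_subset[OF g _ sub] by auto
  have "(LINT t:{0..x}|lborel. f t) = (LINT t:{0..x}|lborel. g t)"
    unfolding set_lebesgue_integral_def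
  proof (rule integral_cong_AE)
    show "(\<lambda>t. indicator {0..x} t *\<^sub>R f t) \<in> borel_measurable lborel" "(\<lambda>t. indicator {0..x} t *\<^sub>R g t) \<in> borel_measurable lborel"
      using f' g' by (auto simp: set_integrable_def)
    show "AE t in lborel. indicator {0..x} t *\<^sub>R f t = indicator {0..x} t *\<^sub>R g t"
      using ae by (rule AE_mp) (use sub in \<open>auto simp: indicator_def\<close>)
  qed
  then show ?thesis using set_lebesgue_eq_integral(1)[OF f'] set_lebesgue_eq_integral(1)[OF g'] by simp
qed

lemma set_LINT_cong_AE:
  fixes f g :: "real \<Rightarrow> complex"
  assumes f: "set_integrable lborel {0..L} f" and g: "set_integrable lborel {0..L} g"
    and ae: "AE x in lborel. x \<in> {0..L} \<longrightarrow> f x = g x"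
  shows "(LINT x:{0..L}|lborel. f x) = (LINT x:{0..L}|lborel. g x)"
proof (cases "0 \<le> L")
  case True
  then show ?thesis
    using integral_cong_AE_Icc[OF f g ae, of L] set_lebesgue_eq_integral(1)[OF f] set_lebesgue_eq_integral(1)[OF g] by simp
qed (simp add: set_lebesgue_integral_def)

lemma is_weak_deriv_cong_AE:
  assumes u: "set_integrable lborel {0..L} u" "set_integrable lborel {0..L} u'"
    and ae: "AE x in lborel. x \<in> {0..L} \<longrightarrow> u x = u' x" and w: "is_weak_deriv L u v"
  shows "is_weak_deriv L u' v"
  unfolding is_weak_deriv_def
proof (intro allI impI)
  fix \<psi> assume \<psi>: "smooth_periodic L \<psi>"
  have c: "continuous_on {0..L} (\<lambda>x. complex_of_real (deriv \<psi> x))"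
    by (intro continuous_intros smooth_periodic_DERIV[OF \<psi>])
  have "(LINT x:{0..L}|lborel. u' x * complex_of_real (deriv \<psi> x)) = (LINT x:{0..L}|lborel. u x * complex_of_real (deriv \<psi> x))"
    by (rule set_LINT_cong_AE[OF set_integrable_mult_continuous[OF u(2) c] set_integrable_mult_continuous[OF u(1) c]])
      (rule AE_mp[OF ae], auto)
  then show "(LINT x:{0..L}|lborel. u' x * complex_of_real (deriv \<psi> x)) = - (LINT x:{0..L}|lborel. v x * complex_of_real (\<psi> x))"
    using w \<psi> by (simp add: is_weak_deriv_def)
qed

text \<open>Converse of \<open>weak_deriv_imp_primitive\<close>; the zero mean of v again cancels
  the boundary term.\<close>

lemma primitive_imp_weak_deriv:
  assumes u: "set_integrable lborel {0..L} u" and v: "set_integrable lborel {0..L} v" and L: "0 < L"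
    and ae: "AE x in lborel. x \<in> {0..L} \<longrightarrow> u x = c + integral {0..x} v" and 0: "integral {0..L} v = 0"
  shows "is_weak_deriv L u v"
proof -
  have Wc: "continuous_on {0..L} (\<lambda>x. integral {0..x} v)" by (rule integral_primitive_continuous[OF v])
  have "is_weak_deriv L (\<lambda>x. c + integral {0..x} v) v"
    unfolding is_weak_deriv_def
  proof (intro allI impI)
    fix \<psi> assume \<psi>: "smooth_periodic L \<psi>"
    note D = smooth_periodic_DERIV[OF \<psi>]
    have c: "continuous_on {0..L} (\<lambda>x. complex_of_real (deriv \<psi> x))" by (intro continuous_intros D)
    have "(LINT x:{0..L}|lborel. complex_of_real (deriv \<psi> x)) = integral {0..L} (\<lambda>x. complex_of_real (deriv \<psi> x))"
      by (rule set_lebesgue_eq_integral(1)[OF set_integrable_continuous[OF c]])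
    also have "\<dots> = of_real (\<psi> L) - of_real (\<psi> 0)"
    proof (rule integral_unique, rule fundamental_theorem_of_calculus)
      fix x
      show "((\<lambda>x. complex_of_real (\<psi> x)) has_vector_derivative complex_of_real (deriv \<psi> x)) (at x within {0..L})"
        by (rule has_vector_derivative_of_real[OF has_field_derivative_at_within[OF D(1)]])
    qed (use L in auto)
    also have "\<psi> L = \<psi> 0" using \<psi> unfolding smooth_periodic_def by (metis add_0)
    finally have z: "(LINT x:{0..L}|lborel. complex_of_real (deriv \<psi> x)) = 0" by simp
    have "(LINT x:{0..L}|lborel. (c + integral {0..x} v) * complex_of_real (deriv \<psi> x)) =
      (LINT x:{0..L}|lborel. c * complex_of_real (deriv \<psi> x)) + (LINT x:{0..L}|lborel. integral {0..x} v * complex_of_real (deriv \<psi> x))"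
      unfolding distrib_right
      by (intro set_integral_add set_integrable_continuous continuous_intros c Wc D)
    also have "\<dots> = - (LINT x:{0..L}|lborel. v x * complex_of_real (\<psi> x))"
      using integral_primitive_by_parts[OF v, of \<psi> "deriv \<psi>"] D L 0 z
      by (simp add: has_field_derivative_at_within)
    finally show "(LINT x:{0..L}|lborel. (c + integral {0..x} v) * complex_of_real (deriv \<psi> x)) =
       - (LINT x:{0..L}|lborel. v x * complex_of_real (\<psi> x))" .
  qed
  moreover have "set_integrable lborel {0..L} (\<lambda>x. c + integral {0..x} v)"
    by (intro set_integrable_continuous continuous_intros Wc)
  moreover have "AE x in lborel. x \<in> {0..L} \<longrightarrow> c + integral {0..x} v = u x" by (rule AE_mp[OF ae]) auto
  ultimately show ?thesis using is_weak_deriv_cong_AE u by blast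
qed

text \<open>The difference of two weak derivatives is orthogonal to all test functions, so the
  choice in \<open>wderiv\<close> is determined up to null sets.\<close>

lemma wderiv_AE_unique:
  assumes L: "0 < L" and v: "v \<in> L2per L" "is_weak_deriv L u v"
  shows "wderiv L u \<in> L2per L" "is_weak_deriv L u (wderiv L u)" "AE x in lborel. wderiv L u x = v x"
proof -
  have w: "wderiv L u \<in> L2per L \<and> is_weak_deriv L u (wderiv L u)"
    unfolding wderiv_def by (rule someI[of _ v]) (use v in auto)
  then show w1: "wderiv L u \<in> L2per L" and w2: "is_weak_deriv L u (wderiv L u)" by auto
  note I = L2per_set_integrable[OF w1] L2per_set_integrable[OF v(1)]
  have *: "AE x in lborel. x \<in> {0..L} \<longrightarrow> wderiv L u x - v x = 0"
  proof (rule smooth_orthogonal_AE_zero[OF _ L])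
    show "set_integrable lborel {0..L} (\<lambda>x. wderiv L u x - v x)" by (intro set_integral_diff I)
    fix \<psi> assume \<psi>: "smooth_periodic L \<psi>"
    have c: "continuous_on {0..L} (\<lambda>x. complex_of_real (\<psi> x))" by (intro continuous_intros smooth_periodic_DERIV[OF \<psi>])
    have "(LINT x:{0..L}|lborel. (wderiv L u x - v x) * complex_of_real (\<psi> x)) =
      (LINT x:{0..L}|lborel. wderiv L u x * complex_of_real (\<psi> x)) - (LINT x:{0..L}|lborel. v x * complex_of_real (\<psi> x))"
      unfolding left_diff_distrib by (intro set_integral_diff set_integrable_mult_continuous I c)
    then show "(LINT x:{0..L}|lborel. (wderiv L u x - v x) * complex_of_real (\<psi> x)) = 0"
      using v(2) w2 \<psi> by (simp add: is_weak_deriv_def)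
  qed
  show "AE x in lborel. wderiv L u x = v x"
    by (rule AE_periodic[where L = L]) (use L L2per_D(2)[OF w1] L2per_D(2)[OF v(1)] * in simp_all)
qed

text \<open>\<open>U\<close> is the \<open>C\<^sup>1\<close> representative on a period cell, \<open>U1\<close> its derivative, and
  \<open>w\<close> the second weak derivative.\<close>

definition H2rep :: "real \<Rightarrow> (real \<Rightarrow> complex) \<Rightarrow> (real \<Rightarrow> complex) \<Rightarrow> (real \<Rightarrow> complex) \<Rightarrow> bool" where
  "H2rep L U U1 w \<longleftrightarrow> w \<in> L2per L \<and> U L = U 0 \<and> U1 L = U1 0 \<and>
     (\<forall>x\<in>{0..L}. (U has_vector_derivative U1 x) (at x within {0..L}) \<and> U1 x = U1 0 + integral {0..x} w)"

text \<open>Integrate twice: the chosen first weak derivative agrees almost everywhere with the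
  continuous function U1, and u with a primitive of U1, which is therefore
  \<open>C^1\<close>.\<close>

lemma H2per_imp_H2rep:
  assumes u: "u \<in> H2per L" and L: "0 < L"
  obtains U U1 where "H2rep L U U1 (wderiv L (wderiv L u))" "AE x in lborel. x \<in> {0..L} \<longrightarrow> u x = U x"
proof -
  obtain v0 w0 where 0: "u \<in> L2per L" "v0 \<in> L2per L" "w0 \<in> L2per L" "is_weak_deriv L u v0" "is_weak_deriv L v0 w0"
    using u by (auto simp: H2per_def)
  define v where "v = wderiv L u"
  have v: "v \<in> L2per L" "is_weak_deriv L u v" "AE x in lborel. v x = v0 x"
    using wderiv_AE_unique[OF L 0(2,4)] by (auto simp: v_def)
  have "is_weak_deriv L v w0"
    by (rule is_weak_deriv_cong_AE[OF L2per_set_integrable[OF 0(2)] L2per_set_integrable[OF v(1)] _ 0(5)])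
      (rule AE_mp[OF v(3)], auto)
  define w where "w = wderiv L v"
  have w: "w \<in> L2per L" "is_weak_deriv L v w"
    using wderiv_AE_unique[OF L 0(3) \<open>is_weak_deriv L v w0\<close>] by (auto simp: w_def)
  obtain c1 where c1: "AE x in lborel. x \<in> {0..L} \<longrightarrow> v x = c1 + integral {0..x} w" "integral {0..L} w = 0"
    by (rule weak_deriv_imp_primitive[OF L2per_set_integrable[OF v(1)] L2per_set_integrable[OF w(1)] L w(2)])
  obtain c where c: "AE x in lborel. x \<in> {0..L} \<longrightarrow> u x = c + integral {0..x} v" "integral {0..L} v = 0"
    by (rule weak_deriv_imp_primitive[OF L2per_set_integrable[OF 0(1)] L2per_set_integrable[OF v(1)] L v(2)])
  define U1 where "U1 x = c1 + integral {0..x} w" for x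
  define U where "U x = c + integral {0..x} U1" for x
  have U1c: "continuous_on {0..L} U1" unfolding U1_def
    by (intro continuous_intros integral_primitive_continuous L2per_set_integrable w)
  have Uv: "integral {0..x} v = integral {0..x} U1" if "x \<in> {0..L}" for x
    by (rule integral_cong_AE_Icc[OF L2per_set_integrable[OF v(1)] set_integrable_continuous[OF U1c] _ that])
      (use c1(1) in \<open>simp add: U1_def\<close>)
  have "(U has_vector_derivative U1 x) (at x within {0..L})" if "x \<in> {0..L}" for x
  proof -
    have "(U has_vector_derivative 0 + U1 x) (at x within {0..L})"
      unfolding U_def
      by (intro has_vector_derivative_add has_vector_derivative_const integral_has_vector_derivative U1c that)
    then show ?thesis by simp
  qed
  then have "H2rep L U U1 w"
    unfolding H2rep_def using w c(2) Uv[of L] c1(2) L by (auto simp: U_def U1_def)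
  moreover have "AE x in lborel. x \<in> {0..L} \<longrightarrow> u x = U x"
    using c(1) by (rule AE_mp) (auto simp: U_def Uv)
  ultimately show ?thesis using that by (simp add: w_def v_def)
qed

text \<open>Recognises a function built on the cell as a member of the domain, together with its
  second weak derivative, which may be any w in \<open>L2per\<close>.\<close>

lemma H2rep_imp_H2per:
  assumes rep: "H2rep L U U1 w" and L: "0 < L"
  shows "per_ext L U \<in> H2per L" "AE x in lborel. wderiv L (wderiv L (per_ext L U)) x = w x"
proof -
  have U: "\<And>x. x \<in> {0..L} \<Longrightarrow> (U has_vector_derivative U1 x) (at x within {0..L})" "U L = U 0" "U1 L = U1 0"
    and w: "w \<in> L2per L" and U1: "\<And>x. x \<in> {0..L} \<Longrightarrow> U1 x = U1 0 + integral {0..x} w"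
    using rep unfolding H2rep_def by blast+
  have wi: "set_integrable lborel {0..L} w" by (rule L2per_set_integrable[OF w])
  have Uc: "continuous_on {0..L} U" using U(1) by (rule continuous_on_vector_derivative)
  have U1c: "continuous_on {0..L} U1"
    using continuous_on_add[OF continuous_on_const integral_primitive_continuous[OF wi], of "U1 0"]
    by (rule continuous_on_eq) (rule U1[symmetric])
  have e0: "per_ext L U \<in> L2per L" and e1: "per_ext L U1 \<in> L2per L"
    by (intro per_ext_L2per L Uc U1c)+
  have int: "integral {0..x} (per_ext L U1) = U x - U 0" if x: "x \<in> {0..L}" for x
  proof -
    have "integral {0..x} (per_ext L U1) = integral {0..x} U1"
      by (rule integral_cong) (use x L U(3) in \<open>auto intro!: per_ext_eq\<close>)
    also have "\<dots> = U x - U 0"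
      by (intro integral_unique fundamental_theorem_of_calculus)
        (use x in \<open>auto intro: has_vector_derivative_within_subset[OF U(1)]\<close>)
    finally show ?thesis .
  qed
  have d0: "is_weak_deriv L (per_ext L U) (per_ext L U1)"
    by (rule primitive_imp_weak_deriv[OF L2per_set_integrable[OF e0] L2per_set_integrable[OF e1] L, of "U 0"])
      (use int L U(2) in \<open>auto simp: per_ext_eq\<close>)
  have d1: "is_weak_deriv L (per_ext L U1) w"
  proof (rule primitive_imp_weak_deriv[OF L2per_set_integrable[OF e1] wi L, of "U1 0"])
    show "AE x in lborel. x \<in> {0..L} \<longrightarrow> per_ext L U1 x = U1 0 + integral {0..x} w"
      by (rule AE_I2) (blast intro: trans per_ext_eq[OF L U(3)] U1)
    show "integral {0..L} w = 0" using U1[of L] U(3) L by auto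
  qed
  show "per_ext L U \<in> H2per L" using e0 e1 w d0 d1 by (auto simp: H2per_def)
  note W = wderiv_AE_unique[OF L e1 d0]
  have "is_weak_deriv L (wderiv L (per_ext L U)) w"
    by (rule is_weak_deriv_cong_AE[OF L2per_set_integrable[OF e1] L2per_set_integrable[OF W(1)] _ d1])
      (rule AE_mp[OF W(3)], auto)
  from wderiv_AE_unique(3)[OF L w this]
  show "AE x in lborel. wderiv L (wderiv L (per_ext L U)) x = w x" .
qed

section \<open>Periodic Schroedinger operators\<close>

lemma per_ext_self: "(\<And>x. f (x + L) = f x) \<Longrightarrow> per_ext L f = f"
  by (rule ext) (simp add: per_ext_def periodic_per_rem)

lemma set_integrable_cmod:
  fixes F :: "real \<Rightarrow> complex"
  assumes "set_integrable lborel {a..b} F"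
  shows "(\<lambda>x. cmod (F x)) integrable_on {a..b}"
  using set_borel_integral_eq_integral(1)[OF set_integrable_norm[OF assms]] .

lemma primitive_bound:
  fixes F :: "real \<Rightarrow> complex"
  assumes F: "set_integrable lborel {0..L} F" and x: "x \<in> {0..L}"
  shows "cmod (integral {0..x} F) \<le> integral {0..L} (\<lambda>x. cmod (F x))"
proof -
  have sub: "{0..x} \<subseteq> {0..L}" using x by auto
  have F': "set_integrable lborel {0..x} F" using set_integrable_subset[OF F _ sub] by simp
  have "cmod (integral {0..x} F) \<le> integral {0..x} (\<lambda>x. cmod (F x))"
    by (rule integral_norm_bound_integral[OF set_lebesgue_eq_integral(2)[OF F'] set_integrable_cmod[OF F']]) simp
  also have "\<dots> \<le> integral {0..L} (\<lambda>x. cmod (F x))"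
    by (rule integral_subset_le[OF sub set_integrable_cmod[OF F'] set_integrable_cmod[OF F]]) simp
  finally show ?thesis .
qed

text \<open>Z'' = -F in the integrated sense. If U'' = q U - F, then U - Z has the continuous source
  q Z, so the classical theory applies although F is merely integrable.\<close>

lemma double_primitive:
  fixes F :: "real \<Rightarrow> complex"
  assumes F: "set_integrable lborel {0..L} F" and L: "0 < L"
  defines "N \<equiv> integral {0..L} (\<lambda>x. cmod (F x))"
  obtains Z Z1 where "\<And>x. x \<in> {0..L} \<Longrightarrow> (Z has_vector_derivative Z1 x) (at x within {0..L})"
    "\<And>x. Z1 x = - integral {0..x} F" "Z 0 = 0" "continuous_on {0..L} Z"
    "\<And>x. x \<in> {0..L} \<Longrightarrow> cmod (Z x) \<le> L * N" "\<And>x. x \<in> {0..L} \<Longrightarrow> cmod (Z1 x) \<le> N"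
proof -
  define Z1 where "Z1 x = - integral {0..x} F" for x
  define Z where "Z x = integral {0..x} Z1" for x
  have Z1c: "continuous_on {0..L} Z1" unfolding Z1_def
    by (intro continuous_intros integral_primitive_continuous[OF F])
  have d: "(Z has_vector_derivative Z1 x) (at x within {0..L})" if "x \<in> {0..L}" for x
    unfolding Z_def by (rule integral_has_vector_derivative[OF Z1c that])
  have b1: "cmod (Z1 x) \<le> N" if "x \<in> {0..L}" for x
    using primitive_bound[OF F that] by (simp add: Z1_def N_def)
  have N: "0 \<le> N" by (rule order_trans[OF norm_ge_zero b1[of 0]]) (use L in simp)
  have b: "cmod (Z x) \<le> L * N" if x: "x \<in> {0..L}" for x
  proof -
    have "cmod (Z x) \<le> integral {0..x} (\<lambda>t. N)"
      unfolding Z_def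
      by (rule integral_norm_bound_integral) (use x b1 in \<open>auto intro!: integrable_continuous_real continuous_on_subset[OF Z1c]\<close>)
    also have "\<dots> = x * N" using x by simp
    also have "\<dots> \<le> L * N" using x N by (intro mult_right_mono) auto
    finally show ?thesis .
  qed
  show ?thesis
    by (rule that[of Z Z1, OF d _ _ continuous_on_vector_derivative[OF d] b b1]) (auto simp: Z1_def Z_def)
qed

text \<open>U - Z solves a classical problem whose jumps are those of -Z. The bounded solution of
  the same problem from \<open>per_solvable\<close> differs from it by a periodic homogeneous
  solution, which is zero since \<mu> is no eigenvalue. Taking F = 0 gives uniqueness.\<close>

lemma H2rep_estimate:
  assumes V: "continuous_on {0..L} V" and L: "0 < L" and ne: "\<not> per_eig V L \<mu>"
  obtains C where "0 \<le> C" "\<And>U U1 w F x. H2rep L U U1 w \<Longrightarrow> F \<in> L2per L \<Longrightarrow>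
    (AE x in lborel. x \<in> {0..L} \<longrightarrow> w x = (of_real (V x) - \<mu>) * U x - F x) \<Longrightarrow> x \<in> {0..L} \<Longrightarrow>
    cmod (U x) \<le> C * integral {0..L} (\<lambda>x. cmod (F x))"
proof -
  define q where "q x = complex_of_real (V x) - \<mu>" for x
  have qc: "continuous_on {0..L} q" unfolding q_def by (intro continuous_intros V)
  obtain Q where Q: "0 \<le> Q" "\<And>x. x \<in> {0..L} \<Longrightarrow> cmod (q x) \<le> Q"
    using continuous_on_Icc_bound[OF qc] by blast
  obtain C where C: "0 \<le> C" "\<And>r R d e. continuous_on {0..L} r \<Longrightarrow> (\<And>x. x \<in> {0..L} \<Longrightarrow> cmod (r x) \<le> R) \<Longrightarrow>
      \<exists>u v. hill_sol q r L u v \<and> u L - u 0 = d \<and> v L - v 0 = e \<and>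
        (\<forall>x\<in>{0..L}. cmod (u x) \<le> C * (R + cmod d + cmod e))"
    using per_solvable[OF V L ne] unfolding q_def by blast
  show ?thesis
  proof (rule that[of "L + C * (Q * L + L + 1)"])
    show "0 \<le> L + C * (Q * L + L + 1)" using C(1) Q(1) L by simp
    fix U U1 w F x
    assume rep: "H2rep L U U1 w" and F: "F \<in> L2per L"
      and ae: "AE x in lborel. x \<in> {0..L} \<longrightarrow> w x = (of_real (V x) - \<mu>) * U x - F x"
      and x: "x \<in> {0..L}"
    have Fi: "set_integrable lborel {0..L} F" by (rule L2per_set_integrable[OF F])
    define N where "N = integral {0..L} (\<lambda>x. cmod (F x))"
    obtain Z Z1 where Z: "\<And>x. x \<in> {0..L} \<Longrightarrow> (Z has_vector_derivative Z1 x) (at x within {0..L})"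
      "\<And>x. Z1 x = - integral {0..x} F" "Z 0 = 0" "continuous_on {0..L} Z"
      "\<And>x. x \<in> {0..L} \<Longrightarrow> cmod (Z x) \<le> L * N" "\<And>x. x \<in> {0..L} \<Longrightarrow> cmod (Z1 x) \<le> N"
      using double_primitive[OF Fi L] unfolding N_def by blast
    have R: "w \<in> L2per L" "U L = U 0" "U1 L = U1 0"
      "\<And>x. x \<in> {0..L} \<Longrightarrow> (U has_vector_derivative U1 x) (at x within {0..L})"
      "\<And>x. x \<in> {0..L} \<Longrightarrow> U1 x = U1 0 + integral {0..x} w"
      using rep unfolding H2rep_def by blast+
    have Uc: "continuous_on {0..L} U" using R(4) by (rule continuous_on_vector_derivative)
    have qUc: "continuous_on {0..L} (\<lambda>x. q x * U x)" by (intro continuous_intros qc Uc)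
    have U1: "U1 x = U1 0 + integral {0..x} (\<lambda>x. q x * U x) + Z1 x" if x: "x \<in> {0..L}" for x
    proof -
      have "integral {0..x} w = integral {0..x} (\<lambda>x. q x * U x - F x)"
        by (rule integral_cong_AE_Icc[OF L2per_set_integrable[OF R(1)] set_integral_diff(1)[OF set_integrable_continuous[OF qUc] Fi] _ x])
          (use ae in \<open>simp add: q_def\<close>)
      also have "\<dots> = integral {0..x} (\<lambda>x. q x * U x) - integral {0..x} F"
        by (intro integral_diff integrable_continuous_real continuous_on_subset[OF qUc]
            set_lebesgue_eq_integral(2)[OF set_integrable_subset[OF Fi]]) (use x in auto)
      finally show ?thesis using R(5)[OF x] Z(2)[of x] by simp
    qed
    define v where "v x = U x - Z x" for x
    define v1 where "v1 x = U1 x - Z1 x" for x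
    define r where "r x = q x * Z x" for x
    have rc: "continuous_on {0..L} r" unfolding r_def by (intro continuous_intros qc Z)
    have sol: "hill_sol q r L v v1"
      unfolding hill_sol_def
    proof (intro ballI conjI)
      fix x assume x: "x \<in> {0..L}"
      show "(v has_vector_derivative v1 x) (at x within {0..L})"
        unfolding v_def v1_def by (intro has_vector_derivative_diff R Z x)
      have "((\<lambda>x. U1 0 + integral {0..x} (\<lambda>x. q x * U x)) has_vector_derivative 0 + q x * U x) (at x within {0..L})"
        by (intro has_vector_derivative_add has_vector_derivative_const integral_has_vector_derivative[OF qUc] x)
      moreover have "v1 y = U1 0 + integral {0..y} (\<lambda>x. q x * U x)" if "y \<in> {0..L}" for y
        using U1[OF that] unfolding v1_def by simp
      ultimately have "(v1 has_vector_derivative 0 + q x * U x) (at x within {0..L})"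
        by (rule has_vector_derivative_transform[OF x, rotated])
      then show "(v1 has_vector_derivative q x * v x + r x) (at x within {0..L})"
        by (simp add: v_def r_def algebra_simps)
    qed
    have rb: "cmod (r x) \<le> Q * (L * N)" if "x \<in> {0..L}" for x
      unfolding r_def norm_mult using Q Z(5) that by (intro mult_mono) auto
    obtain u u1 where u: "hill_sol q r L u u1" "u L - u 0 = - Z L" "u1 L - u1 0 = - Z1 L"
       "\<And>x. x \<in> {0..L} \<Longrightarrow> cmod (u x) \<le> C * (Q * (L * N) + cmod (- Z L) + cmod (- Z1 L))"
      using C(2)[OF rc rb, of "- Z L" "- Z1 L"] by blast
    have d: "hill_sol q (\<lambda>x. 0) L (\<lambda>x. v x - u x) (\<lambda>x. v1 x - u1 x)"
      using hill_sol_lincomb[OF sol u(1), of 1 "-1"] by simp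
    have Z10: "Z1 0 = 0" using Z(2)[of 0] by simp
    have eq: "v L - u L = v 0 - u 0" "v1 L - u1 L = v1 0 - u1 0"
      using R(2,3) u(2,3) Z(3) Z10 by (auto simp: v_def v1_def algebra_simps)
    have z: "v 0 - u 0 = 0 \<and> v1 0 - u1 0 = 0"
    proof (rule ccontr)
      assume "\<not> ?thesis"
      then have "per_eig V L \<mu>" unfolding per_eig_def using d[unfolded q_def] eq by blast
      then show False using ne by simp
    qed
    have vu: "v x = u x" if "x \<in> {0..L}" for x
      using hill_sol_eq_0[OF d qc _ _ that] z by simp
    have Lin: "L \<in> {0..L}" using L by auto
    have "cmod (U x) \<le> cmod (v x) + cmod (Z x)" using norm_triangle_ineq[of "v x" "Z x"] by (simp add: v_def)
    also have "\<dots> \<le> C * (Q * (L * N) + cmod (- Z L) + cmod (- Z1 L)) + L * N"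
      using u(4)[OF x] vu[OF x] Z(5)[OF x] by (intro add_mono) simp_all
    also have "\<dots> \<le> C * (Q * (L * N) + L * N + N) + L * N"
      using C(1) Z(5,6)[OF Lin] by (intro add_mono mult_left_mono order_refl) simp_all
    also have "\<dots> = (L + C * (Q * L + L + 1)) * N" by (simp add: algebra_simps)
    finally show "cmod (U x) \<le> (L + C * (Q * L + L + 1)) * integral {0..L} (\<lambda>x. cmod (F x))" by (simp add: N_def)
  qed
qed

text \<open>The decomposition U = v + Z in reverse: v is found with the jumps that cancel those of
  Z.\<close>

lemma H2rep_exists:
  assumes V: "continuous_on UNIV V" "\<And>x. V (x + L) = V x" and L: "0 < L" and ne: "\<not> per_eig V L \<mu>"
    and F: "F \<in> L2per L"
  obtains U U1 where "H2rep L U U1 (\<lambda>x. (of_real (V x) - \<mu>) * per_ext L U x - F x)"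
proof -
  have Vc: "continuous_on {0..L} V" using V(1) continuous_on_subset by blast
  define q where "q x = complex_of_real (V x) - \<mu>" for x
  have qc: "continuous_on {0..L} q" unfolding q_def by (intro continuous_intros Vc)
  obtain Q where Q: "\<And>x. x \<in> {0..L} \<Longrightarrow> cmod (q x) \<le> Q"
    using continuous_on_Icc_bound[OF qc] by blast
  have Fi: "set_integrable lborel {0..L} F" by (rule L2per_set_integrable[OF F])
  obtain Z Z1 where Z: "\<And>x. x \<in> {0..L} \<Longrightarrow> (Z has_vector_derivative Z1 x) (at x within {0..L})"
    "\<And>x. Z1 x = - integral {0..x} F" "Z 0 = 0" "continuous_on {0..L} Z"
    by (rule double_primitive[OF Fi L]) blast
  define r where "r x = q x * Z x" for x
  have rc: "continuous_on {0..L} r" unfolding r_def by (intro continuous_intros qc Z)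
  obtain R where R: "\<And>x. x \<in> {0..L} \<Longrightarrow> cmod (r x) \<le> R" using continuous_on_Icc_bound[OF rc] by blast
  obtain v v1 where v: "hill_sol q r L v v1" "v L - v 0 = - Z L" "v1 L - v1 0 = - Z1 L"
  proof (rule per_solvable[OF Vc L ne])
    fix C
    assume "\<And>r R d e. continuous_on {0..L} r \<Longrightarrow> (\<And>x. x \<in> {0..L} \<Longrightarrow> cmod (r x) \<le> R) \<Longrightarrow>
      \<exists>u v. hill_sol (\<lambda>x. of_real (V x) - \<mu>) r L u v \<and> u L - u 0 = d \<and> v L - v 0 = e \<and>
        (\<forall>x\<in>{0..L}. cmod (u x) \<le> C * (R + cmod d + cmod e))"
    from this[OF rc R, of "- Z L" "- Z1 L"] show ?thesis using that unfolding q_def[abs_def] by blast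
  qed
  define U where "U x = v x + Z x" for x
  define U1 where "U1 x = v1 x + Z1 x" for x
  have Ud: "(U has_vector_derivative U1 x) (at x within {0..L})" if "x \<in> {0..L}" for x
    unfolding U_def U1_def by (intro has_vector_derivative_add hill_solD(1)[OF v(1)] Z that)
  have Uc: "continuous_on {0..L} U" using Ud by (rule continuous_on_vector_derivative)
  have Z10: "Z1 0 = 0" using Z(2)[of 0] by simp
  have UL: "U L = U 0" "U1 L = U1 0" using v(2,3) Z(3) Z10 by (auto simp: U_def U1_def algebra_simps)
  have qm: "q \<in> borel_measurable borel" unfolding q_def[abs_def]
    by (intro borel_measurable_continuous_onI continuous_intros V)
  have w: "(\<lambda>x. q x * per_ext L U x - F x) \<in> L2per L"
    by (intro L2per_diff F L2per_mult_bounded[where C = Q] per_ext_L2per L Uc qm) (use V(2) Q in \<open>auto simp: q_def\<close>)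
  have "U1 x = U1 0 + integral {0..x} (\<lambda>x. q x * per_ext L U x - F x)" if x: "x \<in> {0..L}" for x
  proof -
    have sub: "{0..x} \<subseteq> {0..L}" using x by auto
    have qUc: "continuous_on {0..L} (\<lambda>x. q x * U x)" by (intro continuous_intros qc Uc)
    have "((\<lambda>x. q x * U x) has_integral v1 x - v1 0) {0..x}"
    proof (rule fundamental_theorem_of_calculus)
      fix t assume "t \<in> {0..x}"
      then have t: "t \<in> {0..L}" using x by auto
      show "(v1 has_vector_derivative q t * U t) (at t within {0..x})"
        using has_vector_derivative_within_subset[OF hill_solD(2)[OF v(1) t] sub]
        by (simp add: r_def U_def algebra_simps)
    qed (use x in auto)
    then have i: "integral {0..x} (\<lambda>x. q x * U x) = v1 x - v1 0" by (rule integral_unique)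
    have "integral {0..x} (\<lambda>x. q x * per_ext L U x - F x) = integral {0..x} (\<lambda>x. q x * U x - F x)"
      by (rule integral_cong) (use x L UL in \<open>auto simp: per_ext_eq\<close>)
    also have "\<dots> = integral {0..x} (\<lambda>x. q x * U x) - integral {0..x} F"
      by (intro integral_diff integrable_continuous_real continuous_on_subset[OF qUc]
          set_lebesgue_eq_integral(2)[OF set_integrable_subset[OF Fi]]) (use x in auto)
    finally show ?thesis using i Z(2)[of x] Z10 by (simp add: U1_def)
  qed
  then have "H2rep L U U1 (\<lambda>x. q x * per_ext L U x - F x)"
    unfolding H2rep_def using w UL Ud by blast
  then show ?thesis using that unfolding q_def by blast
qed

section \<open>Kernels and resolvents of one scalar operator\<close>

lemma schroedinger_L2per:
  assumes V: "continuous_on UNIV V" "\<And>x. V (x + L) = V x" and L: "0 < L" and u: "u \<in> H2per L"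
  shows "(\<lambda>x. schroedinger L V u x - \<mu> * u x) \<in> L2per L"
proof -
  obtain U U1 where "H2rep L U U1 (wderiv L (wderiv L u))" using H2per_imp_H2rep[OF u L] by blast
  then have w: "wderiv L (wderiv L u) \<in> L2per L" unfolding H2rep_def by blast
  have uL: "u \<in> L2per L" using u by (simp add: H2per_def)
  define q where "q x = complex_of_real (V x) - \<mu>" for x
  have qc: "continuous_on {0..L} q" unfolding q_def by (intro continuous_intros continuous_on_subset[OF V(1)]) auto
  obtain Q where Q: "\<And>x. x \<in> {0..L} \<Longrightarrow> cmod (q x) \<le> Q" using continuous_on_Icc_bound[OF qc] by blast
  have qm: "q \<in> borel_measurable borel" unfolding q_def[abs_def]
    by (intro borel_measurable_continuous_onI continuous_intros V)
  have "(\<lambda>x. q x * u x - wderiv L (wderiv L u) x) \<in> L2per L"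
    by (intro L2per_diff w L2per_mult_bounded[where C = Q] uL qm) (use V(2) Q in \<open>auto simp: q_def\<close>)
  then show ?thesis by (simp add: schroedinger_def q_def algebra_simps)
qed

definition schr_ker :: "real \<Rightarrow> (real \<Rightarrow> real) \<Rightarrow> complex \<Rightarrow> (real \<Rightarrow> complex) set" where
  "schr_ker L V \<mu> = {u \<in> H2per L. AE x in lborel. schroedinger L V u x - \<mu> * u x = 0}"

text \<open>Regularity: the second weak derivative equals (V - \<mu>) U almost everywhere with U
  continuous, so U1 is a primitive of a continuous function.\<close>

lemma schr_ker_imp_hill_sol:
  assumes V: "continuous_on {0..L} V" and L: "0 < L" and u: "u \<in> schr_ker L V \<mu>"
  obtains U U1 where "hill_sol (\<lambda>x. of_real (V x) - \<mu>) (\<lambda>x. 0) L U U1" "U L = U 0" "U1 L = U1 0"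
    "AE x in lborel. u x = per_ext L U x"
proof -
  have uH: "u \<in> H2per L" and ae: "AE x in lborel. schroedinger L V u x - \<mu> * u x = 0"
    using u by (auto simp: schr_ker_def)
  define w where "w = wderiv L (wderiv L u)"
  obtain U U1 where rep: "H2rep L U U1 w" and uU: "AE x in lborel. x \<in> {0..L} \<longrightarrow> u x = U x"
    using H2per_imp_H2rep[OF uH L] unfolding w_def by blast
  have R: "w \<in> L2per L" "U L = U 0" "U1 L = U1 0"
      "\<And>x. x \<in> {0..L} \<Longrightarrow> (U has_vector_derivative U1 x) (at x within {0..L})"
      "\<And>x. x \<in> {0..L} \<Longrightarrow> U1 x = U1 0 + integral {0..x} w"
    using rep unfolding H2rep_def by blast+
  define q where "q x = complex_of_real (V x) - \<mu>" for x
  have Uc: "continuous_on {0..L} U" using R(4) by (rule continuous_on_vector_derivative)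
  have qUc: "continuous_on {0..L} (\<lambda>x. q x * U x)" unfolding q_def by (intro continuous_intros V Uc)
  have "AE x in lborel. x \<in> {0..L} \<longrightarrow> w x = q x * U x"
    using ae uU by eventually_elim (auto simp: schroedinger_def w_def q_def algebra_simps)
  from integral_cong_AE_Icc[OF L2per_set_integrable[OF R(1)] set_integrable_continuous[OF qUc] this]
  have U1: "U1 x = U1 0 + integral {0..x} (\<lambda>x. q x * U x)" if "x \<in> {0..L}" for x
    using R(5)[OF that] that by simp
  have "hill_sol q (\<lambda>x. 0) L U U1"
    unfolding hill_sol_def
  proof (intro ballI conjI R(4))
    fix x assume x: "x \<in> {0..L}"
    have "((\<lambda>x. U1 0 + integral {0..x} (\<lambda>x. q x * U x)) has_vector_derivative 0 + q x * U x) (at x within {0..L})"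
      by (intro has_vector_derivative_add has_vector_derivative_const integral_has_vector_derivative[OF qUc] x)
    then have "(U1 has_vector_derivative 0 + q x * U x) (at x within {0..L})"
      by (rule has_vector_derivative_transform[OF x, rotated]) (rule U1)
    then show "(U1 has_vector_derivative q x * U x + 0) (at x within {0..L})" by simp
  qed
  moreover have "AE x in lborel. u x = per_ext L U x"
  proof (rule AE_periodic[where L = L])
    show "u (x + L) = u x" for x using uH L2per_D(2) by (auto simp: H2per_def)
    show "AE x in lborel. x \<in> {0..L} \<longrightarrow> u x = per_ext L U x"
      using uU by eventually_elim (use per_ext_eq[OF L R(2)] in auto)
  qed (use L per_ext_periodic in auto)
  ultimately show ?thesis using that R(2,3) unfolding q_def[abs_def] by blast
qed

lemma hill_sol_imp_schr_ker:
  assumes V: "continuous_on {0..L} V" "\<And>x. V (x + L) = V x" and L: "0 < L"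
    and sol: "hill_sol (\<lambda>x. of_real (V x) - \<mu>) (\<lambda>x. 0) L U U1" and per: "U L = U 0" "U1 L = U1 0"
  shows "per_ext L U \<in> schr_ker L V \<mu>"
proof -
  define q where "q x = complex_of_real (V x) - \<mu>" for x
  have Uc: "continuous_on {0..L} U" by (rule hill_sol_continuous(1)[OF sol])
  have qUc: "continuous_on {0..L} (\<lambda>x. q x * U x)" unfolding q_def by (intro continuous_intros V(1) Uc)
  define w where "w = per_ext L (\<lambda>x. q x * U x)"
  have qL: "q L * U L = q 0 * U 0" using V(2)[of 0] per by (simp add: q_def)
  have "U1 x = U1 0 + integral {0..x} w" if x: "x \<in> {0..L}" for x
  proof -
    have "integral {0..x} w = integral {0..x} (\<lambda>x. q x * U x)"
      unfolding w_def by (rule integral_cong) (use x L qL in \<open>auto simp: per_ext_eq\<close>)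
    also have "\<dots> = U1 x - U1 0"
    proof (rule integral_unique, rule fundamental_theorem_of_calculus)
      fix t assume "t \<in> {0..x}"
      then have t: "t \<in> {0..L}" and sub: "{0..x} \<subseteq> {0..L}" using x by auto
      show "(U1 has_vector_derivative q t * U t) (at t within {0..x})"
        using has_vector_derivative_within_subset[OF hill_solD(2)[OF sol t] sub] by (simp add: q_def)
    qed (use x in auto)
    finally show ?thesis by simp
  qed
  then have rep: "H2rep L U U1 w"
    unfolding H2rep_def using per hill_solD(1)[OF sol] per_ext_L2per[OF L qUc, folded w_def] by blast
  have "AE x in lborel. schroedinger L V (per_ext L U) x - \<mu> * per_ext L U x = 0"
    using H2rep_imp_H2per(2)[OF rep L]
  proof eventually_elim
    case (elim x)
    have "w x = q x * per_ext L U x"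
      using periodic_per_rem[of V L x] V(2) by (simp add: w_def per_ext_def q_def)
    then show ?case using elim by (simp add: schroedinger_def q_def algebra_simps)
  qed
  then show ?thesis using H2rep_imp_H2per(1)[OF rep L] by (simp add: schr_ker_def)
qed

text \<open>Expand the integral of (f - m)^2 >= 0, with m the mean of f.\<close>

lemma integral_Cauchy_Schwarz_const:
  fixes f :: "real \<Rightarrow> real"
  assumes L: "0 < L" and f: "f integrable_on {0..L}" and f2: "(\<lambda>x. (f x)\<^sup>2) integrable_on {0..L}"
  shows "(integral {0..L} f)\<^sup>2 \<le> L * integral {0..L} (\<lambda>x. (f x)\<^sup>2)"
proof -
  define m where "m = integral {0..L} f / L"
  have h: "((\<lambda>x. (f x)\<^sup>2 - 2 * m * f x + m\<^sup>2) has_integral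
     integral {0..L} (\<lambda>x. (f x)\<^sup>2) - 2 * m * integral {0..L} f + L * m\<^sup>2) {0..L}"
    using has_integral_const_real[of "m\<^sup>2" 0 L] L
    by (intro has_integral_add has_integral_diff has_integral_mult_right integrable_integral f f2) simp
  have "0 \<le> integral {0..L} (\<lambda>x. (f x)\<^sup>2) - 2 * m * integral {0..L} f + L * m\<^sup>2"
  proof (rule has_integral_nonneg[OF h])
    fix x
    have "(f x)\<^sup>2 - 2 * m * f x + m\<^sup>2 = (f x - m)\<^sup>2" by (simp add: power2_diff algebra_simps)
    then show "0 \<le> (f x)\<^sup>2 - 2 * m * f x + m\<^sup>2" by simp
  qed
  then show ?thesis using L by (simp add: m_def field_simps power2_eq_square)
qed

lemma set_LINT_real_eq_integral:
  fixes f :: "real \<Rightarrow> real"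
  assumes "set_integrable lborel {a..b} f"
  shows "(LINT x:{a..b}|lborel. f x) = integral {a..b} f" "f integrable_on {a..b}"
  using set_borel_integral_eq_integral[OF assms] by auto

lemma schroedinger_resolvent:
  assumes V: "continuous_on UNIV V" "\<And>x. V (x + L) = V x" and L: "0 < L" and ne: "\<not> per_eig V L \<mu>"
  obtains C where "0 \<le> C"
    "\<And>F. F \<in> L2per L \<Longrightarrow> \<exists>u\<in>H2per L. AE x in lborel. schroedinger L V u x - \<mu> * u x = F x"
    "\<And>u u'. u \<in> H2per L \<Longrightarrow> u' \<in> H2per L \<Longrightarrow>
       AE x in lborel. schroedinger L V u x - \<mu> * u x = schroedinger L V u' x - \<mu> * u' x \<Longrightarrow> AE x in lborel. u x = u' x"
    "\<And>u. u \<in> H2per L \<Longrightarrow> (LINT x:{0..L}|lborel. (cmod (u x))\<^sup>2) \<le>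
       C * (LINT x:{0..L}|lborel. (cmod (schroedinger L V u x - \<mu> * u x))\<^sup>2)"
proof -
  have Vc: "continuous_on {0..L} V" using V(1) continuous_on_subset by blast
  define q where "q x = complex_of_real (V x) - \<mu>" for x
  obtain C where C: "0 \<le> C" "\<And>U U1 w F x. H2rep L U U1 w \<Longrightarrow> F \<in> L2per L \<Longrightarrow>
    (AE x in lborel. x \<in> {0..L} \<longrightarrow> w x = (of_real (V x) - \<mu>) * U x - F x) \<Longrightarrow> x \<in> {0..L} \<Longrightarrow>
    cmod (U x) \<le> C * integral {0..L} (\<lambda>x. cmod (F x))"
    using H2rep_estimate[OF Vc L ne] by blast
  show ?thesis
  \<comment> \<open>C bounds the sup norm of u by the integral of the modulus of the source.
    Squaring and integrating costs one factor L, and Cauchy-Schwarz for the source the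
    other.\<close>
  proof (rule that[of "L * C\<^sup>2 * L"])
    show "0 \<le> L * C\<^sup>2 * L" using L by simp
  next
    fix F assume F: "F \<in> L2per L"
    obtain U U1 where rep: "H2rep L U U1 (\<lambda>x. (of_real (V x) - \<mu>) * per_ext L U x - F x)"
      using H2rep_exists[OF V L ne F] by blast
    show "\<exists>u\<in>H2per L. AE x in lborel. schroedinger L V u x - \<mu> * u x = F x"
    proof
      show "per_ext L U \<in> H2per L" by (rule H2rep_imp_H2per(1)[OF rep L])
      show "AE x in lborel. schroedinger L V (per_ext L U) x - \<mu> * per_ext L U x = F x"
        using H2rep_imp_H2per(2)[OF rep L] by eventually_elim (simp add: schroedinger_def algebra_simps)
    qed
  next
    fix u u' assume u: "u \<in> H2per L" and u': "u' \<in> H2per L"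
      and ae: "AE x in lborel. schroedinger L V u x - \<mu> * u x = schroedinger L V u' x - \<mu> * u' x"
    obtain U U1 where rep: "H2rep L U U1 (wderiv L (wderiv L u))" "AE x in lborel. x \<in> {0..L} \<longrightarrow> u x = U x"
      using H2per_imp_H2rep[OF u L] by blast
    obtain U' U1' where rep': "H2rep L U' U1' (wderiv L (wderiv L u'))" "AE x in lborel. x \<in> {0..L} \<longrightarrow> u' x = U' x"
      using H2per_imp_H2rep[OF u' L] by blast
    define w where "w x = wderiv L (wderiv L u) x - wderiv L (wderiv L u') x" for x
    have wL: "wderiv L (wderiv L u) \<in> L2per L" "wderiv L (wderiv L u') \<in> L2per L"
      using rep(1) rep'(1) unfolding H2rep_def by blast+
    have int: "integral {0..x} w = integral {0..x} (wderiv L (wderiv L u)) - integral {0..x} (wderiv L (wderiv L u'))"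
      if "x \<in> {0..L}" for x
      unfolding w_def
      by (intro integral_diff set_lebesgue_eq_integral(2) set_integrable_subset[OF L2per_set_integrable]) (use that wL in auto)
    have "H2rep L (\<lambda>x. U x - U' x) (\<lambda>x. U1 x - U1' x) w"
      unfolding H2rep_def
    proof (intro conjI ballI)
      show "w \<in> L2per L" unfolding w_def[abs_def] by (intro L2per_diff wL)
      show "U L - U' L = U 0 - U' 0" "U1 L - U1' L = U1 0 - U1' 0" using rep(1) rep'(1) unfolding H2rep_def by metis+
      fix x assume x: "x \<in> {0..L}"
      show "((\<lambda>x. U x - U' x) has_vector_derivative U1 x - U1' x) (at x within {0..L})"
        using rep rep' x unfolding H2rep_def by (intro has_vector_derivative_diff) blast+
      have "U1 x = U1 0 + integral {0..x} (wderiv L (wderiv L u))" "U1' x = U1' 0 + integral {0..x} (wderiv L (wderiv L u'))"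
        using rep rep' x unfolding H2rep_def by blast+
      then show "U1 x - U1' x = U1 0 - U1' 0 + integral {0..x} w" using int[OF x] by simp
    qed
    moreover have "(\<lambda>x. 0) \<in> L2per L" by (rule L2per_bounded[of "\<lambda>x. 0" L 0]) auto
    moreover have "AE x in lborel. x \<in> {0..L} \<longrightarrow> w x = (of_real (V x) - \<mu>) * (U x - U' x) - 0"
      using ae rep(2) rep'(2)
      by eventually_elim (auto simp: w_def schroedinger_def algebra_simps)
    ultimately have UU: "U x - U' x = 0" if "x \<in> {0..L}" for x
      using C(2)[of "\<lambda>x. U x - U' x" "\<lambda>x. U1 x - U1' x" w "\<lambda>x. 0" x] that by simp
    show "AE x in lborel. u x = u' x"
    proof (rule AE_periodic[OF L])
      show "u (x + L) = u x" "u' (x + L) = u' x" for x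
        using u u' L2per_D(2)[of u L] L2per_D(2)[of u' L] by (auto simp: H2per_def)
      show "AE x in lborel. x \<in> {0..L} \<longrightarrow> u x = u' x"
        using rep(2) rep'(2) by eventually_elim (use UU in auto)
    qed
  next
    fix u assume u: "u \<in> H2per L"
    obtain U U1 where rep: "H2rep L U U1 (wderiv L (wderiv L u))" "AE x in lborel. x \<in> {0..L} \<longrightarrow> u x = U x"
      using H2per_imp_H2rep[OF u L] by blast
    define F where "F x = schroedinger L V u x - \<mu> * u x" for x
    have F: "F \<in> L2per L" unfolding F_def[abs_def] by (rule schroedinger_L2per[OF V L u])
    have uL: "u \<in> L2per L" using u by (simp add: H2per_def)
    define N where "N = integral {0..L} (\<lambda>x. cmod (F x))"
    have "AE x in lborel. x \<in> {0..L} \<longrightarrow> wderiv L (wderiv L u) x = (of_real (V x) - \<mu>) * U x - F x"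
      using rep(2) by eventually_elim (auto simp: F_def schroedinger_def algebra_simps)
    from C(2)[OF rep(1) F this] have b: "cmod (U x) \<le> C * N" if "x \<in> {0..L}" for x
      using that by (simp add: N_def)
    note Fs = set_LINT_real_eq_integral[OF L2per_D(3)[OF F]]
    have "(LINT x:{0..L}|lborel. (cmod (u x))\<^sup>2) \<le> (LINT x:{0..L}|lborel. (C * N)\<^sup>2)"
    proof (rule set_integral_mono_AE[OF L2per_D(3)[OF uL] set_integrable_const_Icc])
      show "AE x\<in>{0..L} in lborel. (cmod (u x))\<^sup>2 \<le> (C * N)\<^sup>2"
        using rep(2) by eventually_elim (use b in \<open>auto intro!: power_mono\<close>)
    qed
    also have "\<dots> = integral {0..L} (\<lambda>x. (C * N)\<^sup>2)" by (rule set_LINT_real_eq_integral[OF set_integrable_const_Icc])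
    also have "\<dots> = L * C\<^sup>2 * N\<^sup>2" using L by (simp add: power_mult_distrib)
    also have "N\<^sup>2 \<le> L * integral {0..L} (\<lambda>x. (cmod (F x))\<^sup>2)"
      unfolding N_def using Fs(2) set_integrable_cmod[OF L2per_set_integrable[OF F]] L
      by (intro integral_Cauchy_Schwarz_const) auto
    then have "L * C\<^sup>2 * N\<^sup>2 \<le> L * C\<^sup>2 * (L * integral {0..L} (\<lambda>x. (cmod (F x))\<^sup>2))"
      using L by (intro mult_left_mono) auto
    finally show "(LINT x:{0..L}|lborel. (cmod (u x))\<^sup>2) \<le>
       L * C\<^sup>2 * L * (LINT x:{0..L}|lborel. (cmod (schroedinger L V u x - \<mu> * u x))\<^sup>2)"
      using Fs(1) by (simp add: F_def mult.assoc)
  qed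
qed

section \<open>The dnoidal wave\<close>

definition ell_integrand :: "real \<Rightarrow> real \<Rightarrow> real" where
  "ell_integrand k t = 1 / sqrt (1 - k\<^sup>2 * (sin t)\<^sup>2)"

context
  fixes k :: real
  assumes k: "0 \<le> k" "k < 1"
begin

lemma ell_radicand_pos: "0 < 1 - k\<^sup>2 * (sin t)\<^sup>2"
proof -
  have "k\<^sup>2 * (sin t)\<^sup>2 \<le> k\<^sup>2 * 1"
    using abs_sin_le_one[of t] by (intro mult_left_mono) (auto simp: abs_square_le_1)
  moreover have "k\<^sup>2 < 1" using k by (simp add: power_less_one_iff)
  ultimately show ?thesis by linarith
qed

lemma ell_integrand_ge_1: "1 \<le> ell_integrand k t"
proof -
  have "1 - k\<^sup>2 * (sin t)\<^sup>2 \<le> 1" by simp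
  then have "sqrt (1 - k\<^sup>2 * (sin t)\<^sup>2) \<le> 1" by simp
  then show ?thesis using ell_radicand_pos[of t] by (simp add: ell_integrand_def)
qed

lemma ellF_deriv: "((\<lambda>p. ellF p k) has_real_derivative ell_integrand k p) (at p)"
proof -
  define R where "R = \<bar>p\<bar> + 1"
  have c: "continuous_on {-R..R} (ell_integrand k)"
    unfolding ell_integrand_def using ell_radicand_pos
    by (intro continuous_intros) (auto simp: less_imp_neq[symmetric] dest: less_imp_neq)
  have "((\<lambda>u. LBINT y=ereal 0..ereal u. ell_integrand k y) has_vector_derivative ell_integrand k p) (at p within {-R..R})"
    by (rule interval_integral_FTC2[OF _ _ c]) (auto simp: R_def)
  moreover have "at p within {-R..R} = at p" by (rule at_within_Icc_at) (auto simp: R_def)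
  ultimately show ?thesis
    by (simp add: ellF_def ell_integrand_def[abs_def] has_real_derivative_iff_has_vector_derivative zero_ereal_def)
qed

lemma ellF_0: "ellF 0 k = 0"
  by (simp add: ellF_def flip: zero_ereal_def)

text \<open>The integrand is at least 1, so \<open>ellF\<close> expands distances. This gives
  injectivity, enough growth for surjectivity, and the Lipschitz bound that makes the amplitude
  continuous.\<close>

lemma ellF_diff_ge:
  assumes "p \<le> q"
  shows "q - p \<le> ellF q k - ellF p k"
proof -
  have "ellF p k - p \<le> ellF q k - q"
  proof (rule DERIV_nonneg_imp_nondecreasing[OF assms])
    fix x
    have "((\<lambda>p. ellF p k - p) has_real_derivative ell_integrand k x - 1) (at x)"
      by (intro DERIV_diff ellF_deriv DERIV_ident)
    then show "\<exists>y. ((\<lambda>p. ellF p k - p) has_real_derivative y) (at x) \<and> 0 \<le> y"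
      using ell_integrand_ge_1[of x] by (intro exI[of _ "ell_integrand k x - 1"]) simp
  qed
  then show ?thesis by simp
qed

lemma ellF_inj:
  assumes "ellF p k = ellF q k"
  shows "p = q"
proof (cases "p \<le> q")
  case True
  then show ?thesis using ellF_diff_ge[OF True] assms by linarith
next
  case False
  then have "q \<le> p" by linarith
  from ellF_diff_ge[OF this] False assms show ?thesis by linarith
qed

lemma ellF_surj: "\<exists>p. ellF p k = u"
proof -
  have c: "continuous_on {-\<bar>u\<bar>..\<bar>u\<bar>} (\<lambda>p. ellF p k)"
    by (intro continuous_at_imp_continuous_on ballI DERIV_isCont[OF ellF_deriv])
  have "ellF (-\<bar>u\<bar>) k \<le> u" "u \<le> ellF \<bar>u\<bar> k"
    using ellF_diff_ge[of "-\<bar>u\<bar>" 0] ellF_diff_ge[of 0 "\<bar>u\<bar>"] by (auto simp: ellF_0)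
  then show ?thesis using IVT'[of "\<lambda>p. ellF p k" "-\<bar>u\<bar>" u "\<bar>u\<bar>"] c by force
qed

lemma ellF_am: "ellF (jacobi_am u k) k = u"
proof -
  obtain p where p: "ellF p k = u" using ellF_surj by blast
  have "jacobi_am u k = p" unfolding jacobi_am_def by (rule the_equality) (use p ellF_inj in auto)
  then show ?thesis using p by simp
qed

lemma am_ellF: "jacobi_am (ellF p k) k = p"
  by (rule ellF_inj[OF ellF_am])

lemma am_lipschitz: "\<bar>jacobi_am u k - jacobi_am v k\<bar> \<le> \<bar>u - v\<bar>"
proof (cases "jacobi_am u k \<le> jacobi_am v k")
  case True
  then show ?thesis using ellF_diff_ge[OF True, unfolded ellF_am] by linarith
next
  case False
  then have "jacobi_am v k \<le> jacobi_am u k" by simp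
  then show ?thesis using ellF_diff_ge[OF \<open>jacobi_am v k \<le> jacobi_am u k\<close>, unfolded ellF_am] by linarith
qed

lemma am_deriv: "((\<lambda>u. jacobi_am u k) has_real_derivative sqrt (1 - k\<^sup>2 * (sin (jacobi_am u k))\<^sup>2)) (at u)"
proof -
  have "isCont (\<lambda>u. jacobi_am u k) u"
    unfolding continuous_at_eps_delta
  proof (intro allI impI)
    fix e :: real assume e: "0 < e"
    have "dist (jacobi_am x' k) (jacobi_am u k) < e" if "dist x' u < e" for x'
      using am_lipschitz[of x' u] that unfolding dist_real_def by linarith
    then show "\<exists>d>0. \<forall>x'. dist x' u < d \<longrightarrow> dist (jacobi_am x' k) (jacobi_am u k) < e"
      using e by blast
  qed
  from DERIV_inverse_function[where f = "\<lambda>p. ellF p k" and a = "u - 1" and b = "u + 1", OF ellF_deriv _ _ _ _ this]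
  have "((\<lambda>u. jacobi_am u k) has_real_derivative inverse (ell_integrand k (jacobi_am u k))) (at u)"
    using ell_integrand_ge_1[of "jacobi_am u k"] by (simp add: ellF_am)
  then show ?thesis by (simp add: ell_integrand_def)
qed

lemma am_0: "jacobi_am 0 k = 0"
  using am_ellF[of 0] by (simp add: ellF_0)

lemma am_ellK: "jacobi_am (ellK k) k = pi / 2"
  using am_ellF[of "pi / 2"] by (simp add: ellK_def)

lemma ellF_minus: "ellF (- p) k = - ellF p k"
proof -
  have "((\<lambda>p. ellF p k + ellF (- p) k) has_real_derivative 0) (at p)" for p
  proof -
    have "((\<lambda>p. ellF (- p) k) has_real_derivative ell_integrand k (- p) * (- 1)) (at p)"
      by (rule DERIV_chain2[OF ellF_deriv]) (auto intro!: derivative_eq_intros)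
    from DERIV_add[OF ellF_deriv this] show ?thesis by (simp add: ell_integrand_def)
  qed
  then have "ellF p k + ellF (- p) k = ellF 0 k + ellF (- 0) k"
    using DERIV_isconst_all[of "\<lambda>p. ellF p k + ellF (- p) k" p 0] by blast
  then show ?thesis by (simp add: ellF_0)
qed

text \<open>The integrand is symmetric about pi/2, so the two halves of [0, pi] contribute
  equally.\<close>

lemma ellF_pi: "ellF pi k = 2 * ellK k"
proof -
  have "((\<lambda>t. ellF (pi / 2 + t) k + ellF (pi / 2 - t) k) has_real_derivative 0) (at t)" for t
  proof -
    have 1: "((\<lambda>t. ellF (pi / 2 + t) k) has_real_derivative ell_integrand k (pi / 2 + t) * 1) (at t)"
      by (rule DERIV_chain2[OF ellF_deriv]) (auto intro!: derivative_eq_intros)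
    have 2: "((\<lambda>t. ellF (pi / 2 - t) k) has_real_derivative ell_integrand k (pi / 2 - t) * (- 1)) (at t)"
      by (rule DERIV_chain2[OF ellF_deriv]) (auto intro!: derivative_eq_intros)
    from DERIV_add[OF 1 2] show ?thesis by (simp add: ell_integrand_def sin_add sin_diff)
  qed
  then have "ellF (pi / 2 + pi / 2) k + ellF (pi / 2 - pi / 2) k = ellF (pi / 2 + 0) k + ellF (pi / 2 - 0) k"
    using DERIV_isconst_all[of "\<lambda>t. ellF (pi / 2 + t) k + ellF (pi / 2 - t) k" "pi / 2" 0] by blast
  then show ?thesis by (simp add: ellF_0 ellK_def)
qed

lemma ellF_add_pi: "ellF (p + pi) k = ellF p k + 2 * ellK k"
proof -
  have "((\<lambda>p. ellF (p + pi) k - ellF p k) has_real_derivative 0) (at p)" for p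
  proof -
    have "((\<lambda>p. ellF (p + pi) k) has_real_derivative ell_integrand k (p + pi) * 1) (at p)"
      by (rule DERIV_chain2[OF ellF_deriv]) (auto intro!: derivative_eq_intros)
    from DERIV_diff[OF this ellF_deriv] show ?thesis by (simp add: ell_integrand_def)
  qed
  then have "ellF (p + pi) k - ellF p k = ellF (0 + pi) k - ellF 0 k"
    using DERIV_isconst_all[of "\<lambda>p. ellF (p + pi) k - ellF p k" p 0] by blast
  then show ?thesis by (simp add: ellF_0 ellF_pi)
qed

lemma am_minus: "jacobi_am (- u) k = - jacobi_am u k"
  by (rule ellF_inj) (simp only: ellF_am ellF_minus)

lemma am_add_period: "jacobi_am (u + 2 * ellK k) k = jacobi_am u k + pi"
  by (rule ellF_inj) (simp only: ellF_am ellF_add_pi)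

lemma am_mono:
  assumes "u < v"
  shows "jacobi_am u k < jacobi_am v k"
proof (rule ccontr)
  assume "\<not> ?thesis"
  then have "jacobi_am v k \<le> jacobi_am u k" by simp
  from ellF_diff_ge[OF this, unfolded ellF_am] \<open>\<not> ?thesis\<close> assms show False by linarith
qed

end

text \<open>A positive periodic orbit of \<open>\<phi>'' = \<phi> P'(\<phi>\<^sup>2)\<close> with energy relation \<open>\<phi>'\<^sup>2 = P(\<phi>\<^sup>2)\<close>,
  \<open>P(s) = (a - s)(s - b)(s + c) / 3\<close>, decreasing from \<open>\<surd>a\<close> to \<open>\<surd>b\<close> on a half period.\<close>

definition wave_P :: "real \<Rightarrow> real \<Rightarrow> real \<Rightarrow> real \<Rightarrow> real" where
  "wave_P a b c s = (a - s) * (s - b) * (s + c) / 3"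

text \<open>The derivative P' of \<open>wave_P\<close>, kept in factored terms for the polynomial
  identities below; \<open>wave_P2\<close> is P''.\<close>

definition wave_P1 :: "real \<Rightarrow> real \<Rightarrow> real \<Rightarrow> real \<Rightarrow> real" where
  "wave_P1 a b c s = ((a - s) * (s - b) + (a - s) * (s + c) - (s - b) * (s + c)) / 3"

definition wave_P2 :: "real \<Rightarrow> real \<Rightarrow> real \<Rightarrow> real \<Rightarrow> real" where
  "wave_P2 a b c s = 2 * (a + b - c - 3 * s) / 3"

text \<open>\<open>deriv2\<close> stands beside \<open>energy\<close> because differentiating the
  energy relation says nothing at the turning points, where \<phi>' = 0.\<close>

locale periodic_wave =
  fixes a b c L :: real and \<phi> \<phi>1 :: "real \<Rightarrow> real"
  assumes abc: "0 < b" "b < a" "0 < c" and L: "0 < L"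
    and pos: "\<And>x. 0 < \<phi> x"
    and periodic: "\<And>x. \<phi> (x + L) = \<phi> x"
    and even: "\<And>x. \<phi> (- x) = \<phi> x"
    and deriv: "\<And>x. (\<phi> has_real_derivative \<phi>1 x) (at x)"
    and deriv2: "\<And>x. (\<phi>1 has_real_derivative \<phi> x * wave_P1 a b c ((\<phi> x)\<^sup>2)) (at x)"
    and energy: "\<And>x. (\<phi>1 x)\<^sup>2 = wave_P a b c ((\<phi> x)\<^sup>2)"
    and range: "\<And>x. b \<le> (\<phi> x)\<^sup>2 \<and> (\<phi> x)\<^sup>2 \<le> a"
    and decreasing: "\<And>x. 0 < x \<Longrightarrow> x < L / 2 \<Longrightarrow> \<phi>1 x < 0"
    and top: "(\<phi> 0)\<^sup>2 = a" and bottom: "(\<phi> (L / 2))\<^sup>2 = b"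

text \<open>In terms of \<open>S = sin\<^sup>2 \<theta>\<close> the squared profile is the Moebius image
  \<open>-c + (a + c)(b + c) / (b + c + (a - b) S)\<close>.\<close>

lemma periodic_wave_of_phase:
  fixes \<theta> :: "real \<Rightarrow> real"
  assumes abc: "0 < b" "b < a" "0 < c" and L: "0 < L"
    and d\<theta>: "\<And>x. (\<theta> has_real_derivative sqrt ((a * (b + c) - c * (a - b) * (sin (\<theta> x))\<^sup>2) / 3)) (at x)"
    and \<theta>: "\<theta> 0 = 0" "\<theta> (L / 2) = pi / 2" "\<And>x. \<theta> (- x) = - \<theta> x" "\<And>x. \<theta> (x + L) = \<theta> x + pi"
    and mono: "\<And>x y. x < y \<Longrightarrow> \<theta> x < \<theta> y"
    and \<phi>: "\<And>x. \<phi> x = sqrt ((a * (b + c) - c * (a - b) * (sin (\<theta> x))\<^sup>2) / (b + c + (a - b) * (sin (\<theta> x))\<^sup>2))"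
  shows "\<exists>\<phi>1. periodic_wave a b c L \<phi> \<phi>1"
proof -
  define S where "S x = (sin (\<theta> x))\<^sup>2" for x
  have S: "0 \<le> S x" "S x \<le> 1" for x by (auto simp: S_def abs_square_le_1)
  \<comment> \<open>W is the square of \<theta>', positive because c (a - b) < a (b + c).\<close>
  define W where "W x = (a * (b + c) - c * (a - b) * S x) / 3" for x
  have Wpos: "0 < W x" for x
  proof -
    have "c * (a - b) * S x \<le> c * (a - b) * 1" using S[of x] abc by (intro mult_left_mono) auto
    moreover have "c * (a - b) < a * (b + c)" using abc by (simp add: algebra_simps add_pos_pos)
    ultimately show ?thesis by (simp add: W_def)
  qed
  define N where "N x = b + c + (a - b) * S x" for x
  have Npos: "0 < N x" for x using S[of x] abc by (simp add: N_def add_pos_nonneg)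
  define d where "d = (a + c) * (b + c)"
  have dpos: "0 < d" using abc by (simp add: d_def)
  define s where "s x = - c + d / N x" for x
  have sW: "s x = 3 * W x / N x" for x
    using Npos[of x] by (simp add: s_def W_def N_def d_def field_simps)
  have spos: "0 < s x" for x using Wpos[of x] Npos[of x] by (simp add: sW)
  have \<phi>s: "\<phi> x = sqrt (s x)" for x
  proof -
    have "3 * W x = a * (b + c) - c * (a - b) * S x" by (simp add: W_def)
    then show ?thesis by (simp only: \<phi> sW N_def S_def)
  qed
  have \<phi>2: "(\<phi> x)\<^sup>2 = s x" for x using spos[of x] by (simp add: \<phi>s)
  have \<phi>pos: "0 < \<phi> x" for x using spos[of x] by (simp add: \<phi>s)
  define T where "T x = 2 * sin (\<theta> x) * cos (\<theta> x) * sqrt (W x)" for x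
  have d\<theta>': "(\<theta> has_real_derivative sqrt (W x)) (at x)" for x using d\<theta>[of x] by (simp add: W_def S_def)
  have dS: "(S has_real_derivative T x) (at x)" for x
    unfolding S_def T_def by (rule derivative_eq_intros d\<theta>' refl | simp)+
  \<comment> \<open>T is S'. Differentiating its root brings a factor T / sqrt(W), in which the root
    cancels, so S'' is a polynomial in S and W.\<close>
  define T' where "T' x = 2 * W x * (1 - 2 * S x) - 2 * c * (a - b) / 3 * (S x * (1 - S x))" for x
  have dW: "(W has_real_derivative - c * (a - b) / 3 * T x) (at x)" for x
    unfolding W_def by (rule derivative_eq_intros dS refl | simp)+
  have dT: "(T has_real_derivative T' x) (at x)" for x
  proof -
    have q: "sqrt (W x) * sqrt (W x) = W x" using Wpos[of x] by simp
    have c2: "(cos (\<theta> x))\<^sup>2 = 1 - S x" by (simp add: S_def cos_squared_eq)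
    have dsq: "((\<lambda>x. sqrt (W x)) has_real_derivative (- c * (a - b) / 3 * T x) * (inverse (sqrt (W x)) / 2)) (at x)"
      using DERIV_chain2[OF DERIV_real_sqrt[OF Wpos] dW] by (simp add: mult.commute)
    have D: "(T has_real_derivative (2 * (cos (\<theta> x) * sqrt (W x)) * cos (\<theta> x) + 2 * sin (\<theta> x) * (- sin (\<theta> x) * sqrt (W x))) * sqrt (W x)
       + 2 * sin (\<theta> x) * cos (\<theta> x) * ((- c * (a - b) / 3 * T x) * (inverse (sqrt (W x)) / 2))) (at x)"
    proof -
      have "((\<lambda>x. 2 * sin (\<theta> x) * cos (\<theta> x)) has_real_derivative
          2 * (cos (\<theta> x) * sqrt (W x)) * cos (\<theta> x) + 2 * sin (\<theta> x) * (- sin (\<theta> x) * sqrt (W x))) (at x)"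
        by (rule derivative_eq_intros d\<theta>' refl | simp)+
      from DERIV_mult[OF this dsq] show ?thesis unfolding T_def by (simp only: mult.commute mult.left_commute add.commute)
    qed
    have e1: "(2 * (cos (\<theta> x) * sqrt (W x)) * cos (\<theta> x) + 2 * sin (\<theta> x) * (- sin (\<theta> x) * sqrt (W x))) * sqrt (W x)
       = 2 * (sqrt (W x) * sqrt (W x)) * ((cos (\<theta> x))\<^sup>2 - (sin (\<theta> x))\<^sup>2)"
      unfolding power2_eq_square by algebra
    have e2: "2 * sin (\<theta> x) * cos (\<theta> x) * ((- c * (a - b) / 3 * T x) * (inverse (sqrt (W x)) / 2))
       = - 2 * c * (a - b) / 3 * ((sin (\<theta> x))\<^sup>2 * (cos (\<theta> x))\<^sup>2)"
      using Wpos[of x] by (simp add: T_def power2_eq_square field_simps)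
    show ?thesis
      by (rule DERIV_cong[OF D], unfold e1 e2 q c2 S_def[symmetric]) (simp add: T'_def field_simps)
  qed
  have T2: "(T x)\<^sup>2 = 4 * S x * (1 - S x) * W x" for x
  proof -
    have "(T x)\<^sup>2 = 4 * (sin (\<theta> x))\<^sup>2 * (cos (\<theta> x))\<^sup>2 * (sqrt (W x))\<^sup>2" by (simp add: T_def power_mult_distrib)
    then show ?thesis using Wpos[of x] by (simp add: S_def cos_squared_eq)
  qed
  define s1 where "s1 x = - (d * (a - b)) * T x / (N x)\<^sup>2" for x
  have dN: "(N has_real_derivative (a - b) * T x) (at x)" for x
    unfolding N_def by (rule derivative_eq_intros dS refl | simp)+
  have ds: "(s has_real_derivative s1 x) (at x)" for x
    unfolding s_def s1_def using Npos[of x]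
    by (auto intro!: derivative_eq_intros dN simp: power2_eq_square field_simps)
  define s2 where "s2 x = - (d * (a - b)) * (T' x / (N x)\<^sup>2 - 2 * (a - b) * (T x)\<^sup>2 / (N x)^3)" for x
  have ds1: "(s1 has_real_derivative s2 x) (at x)" for x
    unfolding s1_def s2_def using Npos[of x]
    by (auto intro!: derivative_eq_intros dN dT simp: power2_eq_square power3_eq_cube divide_simps)
      (simp add: algebra_simps)
  have as: "a - s x = (a + c) * (a - b) * S x / N x" for x
    using Npos[of x] by (simp add: s_def N_def d_def field_simps)
  have sb: "s x - b = (b + c) * (a - b) * (1 - S x) / N x" for x
    using Npos[of x] by (simp add: s_def N_def d_def field_simps)
  have sc: "s x + c = d / N x" for x by (simp add: s_def)
  have s1sq: "(s1 x)\<^sup>2 = 4 * s x * wave_P a b c (s x)" for x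
  proof -
    have "4 * s x * wave_P a b c (s x) = 4 * (3 * W x / N x) * (((a + c) * (a - b) * S x / N x) * ((b + c) * (a - b) * (1 - S x) / N x) * (d / N x) / 3)"
      unfolding wave_P_def as sb sc sW[symmetric] ..
    also have "\<dots> = d\<^sup>2 * (a - b)\<^sup>2 * (4 * S x * (1 - S x) * W x) / (N x)^4"
      using Npos[of x] by (simp add: d_def power2_eq_square power4_eq_xxxx field_simps)
    also have "\<dots> = (s1 x)\<^sup>2" unfolding T2[symmetric] s1_def by (simp add: power_divide power_mult_distrib)
    finally show ?thesis by simp
  qed
  \<comment> \<open>For s = \<phi>^2 this is s'' = 2 (\<phi>'^2 + \<phi> \<phi>''). It is computed
    directly, since differentiating \<open>s1sq\<close> gives no information where s' = 0. In terms
    of n = N x all ingredients become polynomials, and the claim a rational identity in n.\<close>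
  have s2eq: "s2 x = 2 * (wave_P a b c (s x) + s x * wave_P1 a b c (s x))" for x
  proof -
    define n where "n = N x"
    have n: "n > 0" using Npos by (simp add: n_def)
    have Sn: "(a - b) * S x = n - b - c" by (simp add: n_def N_def)
    have ab: "a - b > 0" using abc by simp
    have Sx: "S x = (n - b - c) / (a - b)" using Sn ab by (simp add: field_simps)
    have S1: "(a - b) * (1 - S x) = a + c - n" using Sn by (simp add: algebra_simps)
    have "3 * W x = a * (b + c) - c * ((a - b) * S x)" by (simp add: W_def)
    then have Wn: "3 * W x = d - c * n" unfolding Sn by (simp add: d_def algebra_simps)
    have T2n: "(a - b)\<^sup>2 * (T x)\<^sup>2 = 4 * (n - b - c) * (a + c - n) * (d - c * n) / 3"
    proof -
      have "(a - b)\<^sup>2 * (T x)\<^sup>2 = 4 * ((a - b) * S x) * ((a - b) * (1 - S x)) * (3 * W x) / 3"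
        unfolding T2 by (simp add: power2_eq_square)
      then show ?thesis unfolding Sn S1 Wn .
    qed
    have T'n: "(a - b) * T' x = 2 / 3 * (d - c * n) * (a + b + 2 * c - 2 * n) - 2 * c / 3 * ((n - b - c) * (a + c - n))"
    proof -
      have "(a - b) * T' x = 2 / 3 * (3 * W x) * ((a - b) * (1 - S x) - (a - b) * S x) - 2 * c / 3 * (((a - b) * S x) * ((a - b) * (1 - S x)))"
        by (simp add: T'_def field_simps)
      then show ?thesis unfolding Sn S1 Wn by (simp add: algebra_simps)
    qed
    have "s2 x = - d * (((a - b) * T' x) / n\<^sup>2 - 2 * ((a - b)\<^sup>2 * (T x)\<^sup>2) / n^3)"
      by (simp add: s2_def n_def power2_eq_square algebra_simps)
    also have "\<dots> = - d * ((2 / 3 * (d - c * n) * (a + b + 2 * c - 2 * n) - 2 * c / 3 * ((n - b - c) * (a + c - n))) * n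
        - 8 / 3 * (n - b - c) * (a + c - n) * (d - c * n)) / n^3"
      unfolding T2n T'n using n by (simp add: field_simps power2_eq_square power3_eq_cube)
    also have "\<dots> = 2 * (wave_P a b c (- c + d / n) + (- c + d / n) * wave_P1 a b c (- c + d / n))"
      using n unfolding wave_P_def wave_P1_def d_def
      by (simp add: field_simps power2_eq_square power3_eq_cube)
    finally show ?thesis by (simp add: s_def n_def)
  qed
  define \<phi>1 where "\<phi>1 x = s1 x / (2 * \<phi> x)" for x
  have d\<phi>: "(\<phi> has_real_derivative \<phi>1 x) (at x)" for x
  proof -
    have "((\<lambda>x. sqrt (s x)) has_real_derivative s1 x * (inverse (sqrt (s x)) / 2)) (at x)"
      by (rule DERIV_chain2[OF DERIV_real_sqrt[OF spos] ds, THEN DERIV_cong]) simp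
    then show ?thesis unfolding \<phi>1_def \<phi>s[abs_def, symmetric] by (simp add: \<phi>s[abs_def] field_simps)
  qed
  have \<phi>1sq: "(\<phi>1 x)\<^sup>2 = wave_P a b c ((\<phi> x)\<^sup>2)" for x
  proof -
    have "(\<phi>1 x)\<^sup>2 = (s1 x)\<^sup>2 / (4 * s x)" by (simp add: \<phi>1_def power_divide power_mult_distrib \<phi>2)
    then show ?thesis unfolding s1sq \<phi>2 using spos[of x] by simp
  qed
  have d\<phi>1: "(\<phi>1 has_real_derivative \<phi> x * wave_P1 a b c ((\<phi> x)\<^sup>2)) (at x)" for x
  proof -
    have "(\<phi>1 has_real_derivative (s2 x * (2 * \<phi> x) - s1 x * (2 * \<phi>1 x)) / (2 * \<phi> x)\<^sup>2) (at x)"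
      using DERIV_divide[OF ds1 DERIV_cmult[OF d\<phi>, of 2], of x] \<phi>pos[of x]
      by (simp add: \<phi>1_def[abs_def] power2_eq_square)
    moreover have "s1 x = 2 * \<phi> x * \<phi>1 x" using \<phi>pos[of x] by (simp add: \<phi>1_def)
    then have "(s2 x * (2 * \<phi> x) - s1 x * (2 * \<phi>1 x)) / (2 * \<phi> x)\<^sup>2 = (s2 x / 2 - (\<phi>1 x)\<^sup>2) / \<phi> x"
      using \<phi>pos[of x] by (simp add: power2_eq_square field_simps)
    moreover have "\<dots> = s x * wave_P1 a b c (s x) / \<phi> x"
      unfolding \<phi>1sq \<phi>2 s2eq by (simp add: field_simps)
    moreover have "\<dots> = \<phi> x * wave_P1 a b c ((\<phi> x)\<^sup>2)"
      unfolding \<phi>2[symmetric] using \<phi>pos[of x] by (simp add: power2_eq_square)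
    ultimately show ?thesis by simp
  qed
  have "periodic_wave a b c L \<phi> \<phi>1"
  proof
    show "0 < b" "b < a" "0 < c" "0 < L" by fact+
    show "0 < \<phi> x" "(\<phi> has_real_derivative \<phi>1 x) (at x)"
      "(\<phi>1 has_real_derivative \<phi> x * wave_P1 a b c ((\<phi> x)\<^sup>2)) (at x)" "(\<phi>1 x)\<^sup>2 = wave_P a b c ((\<phi> x)\<^sup>2)" for x
      by (fact \<phi>pos d\<phi> d\<phi>1 \<phi>1sq)+
    show "\<phi> (x + L) = \<phi> x" "\<phi> (- x) = \<phi> x" for x by (simp_all add: \<phi> \<theta>)
    show "b \<le> (\<phi> x)\<^sup>2 \<and> (\<phi> x)\<^sup>2 \<le> a" for x
    proof -
      have "0 \<le> (a + c) * (a - b) * S x / N x" "0 \<le> (b + c) * (a - b) * (1 - S x) / N x"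
        using S[of x] Npos[of x] abc by simp_all
      then show ?thesis unfolding \<phi>2 as[symmetric] sb[symmetric] by simp
    qed
    show "\<phi>1 x < 0" if "0 < x" "x < L / 2" for x
    proof -
      have "0 < \<theta> x" "\<theta> x < pi / 2" using mono[OF that(1)] mono[OF that(2)] \<theta> by auto
      then have "0 < sin (\<theta> x)" "0 < cos (\<theta> x)" by (auto intro: sin_gt_zero cos_gt_zero)
      then have "0 < T x" using Wpos[of x] by (simp add: T_def)
      then have "s1 x < 0" using dpos abc Npos[of x] by (simp add: s1_def divide_neg_pos mult_neg_pos)
      then show ?thesis using \<phi>pos[of x] by (simp add: \<phi>1_def divide_neg_pos)
    qed
    show "(\<phi> 0)\<^sup>2 = a" "(\<phi> (L / 2))\<^sup>2 = b"
      using as[of 0] sb[of "L / 2"] by (auto simp: \<phi>2 S_def \<theta>)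
  qed
  then show ?thesis by blast
qed

section \<open>Sturm comparison\<close>

text \<open>The real, source-free case of \<open>hill_sol\<close> with the level \<nu> explicit,
  since comparison needs signs. As V is real, complex eigenfunctions are handled through their real
  and imaginary parts.\<close>

definition rsol :: "(real \<Rightarrow> real) \<Rightarrow> real \<Rightarrow> real \<Rightarrow> (real \<Rightarrow> real) \<Rightarrow> (real \<Rightarrow> real) \<Rightarrow> bool" where
  "rsol V \<nu> l f f1 \<longleftrightarrow> (\<forall>x\<in>{0..l}. (f has_real_derivative f1 x) (at x within {0..l}) \<and>
      (f1 has_real_derivative (V x - \<nu>) * f x) (at x within {0..l}))"

lemma rsolD:
  assumes "rsol V \<nu> l f f1" "x \<in> {0..l}"
  shows "(f has_real_derivative f1 x) (at x within {0..l})"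
    "(f1 has_real_derivative (V x - \<nu>) * f x) (at x within {0..l})"
  using assms by (auto simp: rsol_def)

lemma rsol_continuous:
  assumes "rsol V \<nu> l f f1"
  shows "continuous_on {0..l} f" "continuous_on {0..l} f1"
  using DERIV_continuous_on[OF rsolD(1)[OF assms]] DERIV_continuous_on[OF rsolD(2)[OF assms]] by auto

lemma hill_sol_of_rsol:
  assumes "rsol V \<nu> l f f1"
  shows "hill_sol (\<lambda>x. of_real (V x) - of_real \<nu>) (\<lambda>x. 0) l (\<lambda>x. of_real (f x)) (\<lambda>x. of_real (f1 x))"
  unfolding hill_sol_def
proof (intro ballI conjI)
  fix x assume x: "x \<in> {0..l}"
  show "((\<lambda>x. complex_of_real (f x)) has_vector_derivative of_real (f1 x)) (at x within {0..l})"
    by (rule has_vector_derivative_of_real[OF rsolD(1)[OF assms x]])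
  have "((\<lambda>x. complex_of_real (f1 x)) has_vector_derivative of_real ((V x - \<nu>) * f x)) (at x within {0..l})"
    by (rule has_vector_derivative_of_real[OF rsolD(2)[OF assms x]])
  then show "((\<lambda>x. complex_of_real (f1 x)) has_vector_derivative (of_real (V x) - of_real \<nu>) * of_real (f x) + 0) (at x within {0..l})"
    by simp
qed

lemma rsol_Re_Im:
  assumes "hill_sol (\<lambda>x. of_real (V x) - of_real \<nu>) (\<lambda>x. 0) l u v"
  shows "rsol V \<nu> l (\<lambda>x. Re (u x)) (\<lambda>x. Re (v x))" "rsol V \<nu> l (\<lambda>x. Im (u x)) (\<lambda>x. Im (v x))"
proof -
  have q: "(complex_of_real (V x) - complex_of_real \<nu>) * u x + 0 = (V x - \<nu>) *\<^sub>R u x" for x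
    by (simp add: scaleR_conv_of_real)
  have 1: "((\<lambda>x. Re (u x)) has_real_derivative Re (v x)) (at x within {0..l})"
    "((\<lambda>x. Im (u x)) has_real_derivative Im (v x)) (at x within {0..l})"
    "((\<lambda>x. Re (v x)) has_real_derivative (V x - \<nu>) * Re (u x)) (at x within {0..l})"
    "((\<lambda>x. Im (v x)) has_real_derivative (V x - \<nu>) * Im (u x)) (at x within {0..l})" if "x \<in> {0..l}" for x
    using hill_solD[OF assms that, unfolded q]
      bounded_linear.has_vector_derivative[OF bounded_linear_Re, of u "v x"]
      bounded_linear.has_vector_derivative[OF bounded_linear_Im, of u "v x"]
      bounded_linear.has_vector_derivative[OF bounded_linear_Re, of v "(V x - \<nu>) *\<^sub>R u x"]
      bounded_linear.has_vector_derivative[OF bounded_linear_Im, of v "(V x - \<nu>) *\<^sub>R u x"]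
    by (simp_all add: has_real_derivative_iff_has_vector_derivative)
  show "rsol V \<nu> l (\<lambda>x. Re (u x)) (\<lambda>x. Re (v x))" "rsol V \<nu> l (\<lambda>x. Im (u x)) (\<lambda>x. Im (v x))"
    unfolding rsol_def using 1 by blast+
qed

lemma rsol_lincomb:
  assumes "rsol V \<nu> l f f1" "rsol V \<nu> l g g1"
  shows "rsol V \<nu> l (\<lambda>x. p * f x + q * g x) (\<lambda>x. p * f1 x + q * g1 x)"
  unfolding rsol_def
proof (intro ballI conjI)
  fix x assume x: "x \<in> {0..l}"
  note D = rsolD[OF assms(1) x] rsolD[OF assms(2) x]
  show "((\<lambda>x. p * f x + q * g x) has_real_derivative p * f1 x + q * g1 x) (at x within {0..l})"
    by (intro DERIV_add DERIV_cmult D)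
  have "((\<lambda>x. p * f1 x + q * g1 x) has_real_derivative p * ((V x - \<nu>) * f x) + q * ((V x - \<nu>) * g x)) (at x within {0..l})"
    by (intro DERIV_add DERIV_cmult D)
  then show "((\<lambda>x. p * f1 x + q * g1 x) has_real_derivative (V x - \<nu>) * (p * f x + q * g x)) (at x within {0..l})"
    by (simp add: algebra_simps)
qed

lemma rsol_unique:
  assumes "rsol V \<nu> l f f1" "rsol V \<nu> l g g1" and V: "continuous_on {0..l} V"
    and "f 0 = g 0" "f1 0 = g1 0" "x \<in> {0..l}"
  shows "f x = g x \<and> f1 x = g1 x"
  using hill_sol_unique[OF hill_sol_of_rsol[OF assms(1)] hill_sol_of_rsol[OF assms(2)] _ _ _ assms(6)] assms(4,5) V
  by (simp add: continuous_intros)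

lemma rsol_zero: "rsol V \<nu> l (\<lambda>x. 0) (\<lambda>x. 0)"
  by (simp add: rsol_def)

lemma rsol_exists:
  assumes "0 \<le> l" "continuous_on {0..l} V"
  obtains f f1 where "rsol V \<nu> l f f1" "f 0 = p" "f1 0 = q"
proof -
  have "continuous_on {0..l} (\<lambda>x. complex_of_real (V x) - of_real \<nu>)" by (intro continuous_intros assms)
  then obtain u v where "hill_sol (\<lambda>x. of_real (V x) - of_real \<nu>) (\<lambda>x. 0) l u v" "u 0 = of_real p" "v 0 = of_real q"
    using hill_sol_exists[OF assms(1) _ continuous_on_const] by blast
  then show ?thesis using that[OF rsol_Re_Im(1)] by simp
qed

lemma rsol_restrict:
  assumes "rsol V \<nu> l f f1" "m \<le> l"
  shows "rsol V \<nu> m f f1"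
  unfolding rsol_def
proof (intro ballI conjI)
  fix x assume x: "x \<in> {0..m}"
  then have "x \<in> {0..l}" and sub: "{0..m} \<subseteq> {0..l}" using assms(2) by auto
  then show "(f has_real_derivative f1 x) (at x within {0..m})" "(f1 has_real_derivative (V x - \<nu>) * f x) (at x within {0..m})"
    using rsolD[OF assms(1)] DERIV_subset by blast+
qed

lemma rsol_shift:
  assumes "rsol V \<nu> l f f1" "0 \<le> m"
  shows "rsol (\<lambda>x. V (m + x)) \<nu> (l - m) (\<lambda>x. f (m + x)) (\<lambda>x. f1 (m + x))"
  unfolding rsol_def
proof (intro ballI conjI)
  fix x assume x: "x \<in> {0..l - m}"
  then have mx: "m + x \<in> {0..l}" using assms(2) by auto
  have im: "(\<lambda>x. m + x) ` {0..l - m} \<subseteq> {0..l}" using assms(2) by auto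
  have d: "((\<lambda>x. m + x) has_real_derivative 1) (at x within {0..l - m})" by (auto intro!: derivative_eq_intros)
  show "((\<lambda>x. f (m + x)) has_real_derivative f1 (m + x)) (at x within {0..l - m})"
    using DERIV_image_chain[OF DERIV_subset[OF rsolD(1)[OF assms(1) mx] im] d] by (simp add: o_def)
  show "((\<lambda>x. f1 (m + x)) has_real_derivative (V (m + x) - \<nu>) * f (m + x)) (at x within {0..l - m})"
    using DERIV_image_chain[OF DERIV_subset[OF rsolD(2)[OF assms(1) mx] im] d] by (simp add: o_def)
qed

lemma rsol_reflect:
  assumes "rsol V \<nu> l f f1"
  shows "rsol (\<lambda>x. V (l - x)) \<nu> l (\<lambda>x. f (l - x)) (\<lambda>x. - f1 (l - x))"
  unfolding rsol_def
proof (intro ballI conjI)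
  fix x assume x: "x \<in> {0..l}"
  then have mx: "l - x \<in> {0..l}" by auto
  have im: "(\<lambda>x. l - x) ` {0..l} \<subseteq> {0..l}" by auto
  have d: "((\<lambda>x. l - x) has_real_derivative - 1) (at x within {0..l})" by (auto intro!: derivative_eq_intros)
  show "((\<lambda>x. f (l - x)) has_real_derivative - f1 (l - x)) (at x within {0..l})"
    using DERIV_image_chain[OF DERIV_subset[OF rsolD(1)[OF assms mx] im] d] by (simp add: o_def)
  have "((\<lambda>x. f1 (l - x)) has_real_derivative - ((V (l - x) - \<nu>) * f (l - x))) (at x within {0..l})"
    using DERIV_image_chain[OF DERIV_subset[OF rsolD(2)[OF assms mx] im] d] by (simp add: o_def)
  from DERIV_minus[OF this]
  show "((\<lambda>x. - f1 (l - x)) has_real_derivative (V (l - x) - \<nu>) * f (l - x)) (at x within {0..l})" by simp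
qed

section \<open>Comparison of solutions at two levels\<close>

lemma rsol_wronskian:
  assumes f: "rsol V \<nu> l f f1" and g: "rsol V \<mu> l g g1" and x: "x \<in> {0..l}"
  shows "((\<lambda>x. f1 x * g x - f x * g1 x) has_real_derivative (\<mu> - \<nu>) * (f x * g x)) (at x within {0..l})"
proof -
  note D = rsolD[OF f x] rsolD[OF g x]
  have "((\<lambda>x. f1 x * g x - f x * g1 x) has_real_derivative
     ((V x - \<nu>) * f x * g x + g1 x * f1 x) - (f1 x * g1 x + (V x - \<mu>) * g x * f x)) (at x within {0..l})"
    by (intro DERIV_diff DERIV_mult D)
  then show ?thesis by (rule DERIV_cong) (simp add: algebra_simps)
qed

text \<open>While both solutions are positive, their Wronskian has derivative (\<mu> - \<nu>) f g >
  0. The comparisons below evaluate this inequality at points where boundary conditions fix the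
  signs.\<close>

lemma rsol_comparison:
  assumes f: "rsol V \<nu> l f f1" and g: "rsol V \<mu> l g g1" and less: "\<nu> < \<mu>"
    and e: "0 < e" "e \<le> l" and pos: "\<And>x. 0 < x \<Longrightarrow> x < e \<Longrightarrow> 0 < f x \<and> 0 < g x"
  shows "f1 0 * g 0 - f 0 * g1 0 < f1 e * g e - f e * g1 e"
proof (rule Icc_deriv_pos_strict_mono[OF rsol_wronskian[OF f g]])
  show "0 < (\<mu> - \<nu>) * (f x * g x)" if "0 < x" "x < e" for x
    using pos[OF that] less by simp
qed (use e in auto)

text \<open>Take the infimum of the closed zero set; a nonpositive value before it would produce an
  earlier zero.\<close>

lemma first_zero:
  fixes f :: "real \<Rightarrow> real"
  assumes c: "continuous_on {p..q} f" and p: "0 < f p" and d: "p \<le> d" "d \<le> q" "f d = 0"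
  obtains e where "p < e" "e \<le> d" "f e = 0" "\<And>x. p \<le> x \<Longrightarrow> x < e \<Longrightarrow> 0 < f x"
proof -
  define Z where "Z = {x \<in> {p..q}. f x = 0}"
  have Zc: "closed Z" unfolding Z_def by (rule continuous_closed_preimage_constant[OF c closed_atLeastAtMost])
  have Zb: "bdd_below Z" unfolding Z_def by (rule bdd_belowI[of _ p]) auto
  have dZ: "d \<in> Z" using d by (simp add: Z_def)
  define e where "e = Inf Z"
  have eZ: "e \<in> Z" unfolding e_def using closed_contains_Inf[OF _ Zb Zc] dZ by blast
  have ele: "e \<le> x" if "x \<in> Z" for x unfolding e_def using cInf_lower[OF that Zb] .
  have pe: "p < e" using eZ p by (cases "p = e") (auto simp: Z_def)
  have pos: "0 < f x" if "p \<le> x" "x < e" for x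
  proof (rule ccontr)
    assume "\<not> 0 < f x"
    then have "f x \<le> 0" by simp
    moreover have "continuous_on {p..x} f" using continuous_on_subset[OF c] that eZ by (auto simp: Z_def)
    ultimately have "\<exists>t. p \<le> t \<and> t \<le> x \<and> f t = 0"
      using IVT2'[of f x 0 p] p \<open>p \<le> x\<close> by auto
    then obtain t where "p \<le> t" "t \<le> x" "f t = 0" by blast
    then have "t \<in> Z" using that eZ by (auto simp: Z_def)
    from ele[OF this] \<open>t \<le> x\<close> that show False by simp
  qed
  show ?thesis by (rule that[OF pe ele[OF dZ] _ pos]) (use eZ in \<open>auto simp: Z_def\<close>)
qed

lemma deriv_nonpos_at_zero:
  fixes f :: "real \<Rightarrow> real"
  assumes d: "(f has_real_derivative D) (at e within {0..l})" and e: "p < e" "0 \<le> p" "e \<le> l"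
    and f: "f e = 0" "\<And>x. p < x \<Longrightarrow> x < e \<Longrightarrow> 0 < f x"
  shows "D \<le> 0"
proof (rule ccontr)
  assume "\<not> D \<le> 0"
  then obtain h0 where h0: "0 < h0" "\<And>h. 0 < h \<Longrightarrow> e - h \<in> {0..l} \<Longrightarrow> h < h0 \<Longrightarrow> f (e - h) < f e"
    using has_real_derivative_pos_inc_left[OF d] by auto
  define h where "h = min (h0 / 2) ((e - p) / 2)"
  have h: "0 < h" "h < h0" "h < e - p" using h0 e by (auto simp: h_def min_def)
  have "f (e - h) < 0" using h0(2)[of h] h e f by auto
  moreover have "0 < f (e - h)" using h f(2)[of "e - h"] by auto
  ultimately show False by simp
qed

text \<open>A solution g leaving 0 with positive slope has a first zero e. There g' <= 0 and z >= 0,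
  whereas the Wronskian, which vanishes at 0, has become positive. Applied to f and to -f, this
  leaves only slope 0.\<close>

lemma rsol_dirichlet:
  assumes f: "rsol V \<nu> h f f1" "f 0 = 0" "f h = 0" and z: "rsol V \<mu> h z z1" "z 0 = 0" "z h = 0"
    and zpos: "\<And>x. 0 < x \<Longrightarrow> x < h \<Longrightarrow> 0 < z x" and less: "\<nu> < \<mu>" and h: "0 < h"
  shows "f1 0 = 0"
proof -
  have key: "\<not> 0 < g1 0" if g: "rsol V \<nu> h g g1" "g 0 = 0" "g h = 0" for g g1
  proof
    assume g10: "0 < g1 0"
    have "(g has_real_derivative g1 0) (at 0 within {0..h})" using rsolD(1)[OF g(1)] h by auto
    then obtain d where d: "0 < d" "\<And>x. 0 < x \<Longrightarrow> 0 + x \<in> {0..h} \<Longrightarrow> x < d \<Longrightarrow> g 0 < g (0 + x)"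
      using has_real_derivative_pos_inc_right[OF _ g10] by metis
    define p where "p = min (d / 2) (h / 2)"
    have p: "0 < p" "p < d" "p < h" using d h by (auto simp: p_def min_def)
    have gp: "0 < g x" if "0 < x" "x \<le> p" for x using d(2)[of x] that p g by auto
    obtain e where e: "p < e" "e \<le> h" "g e = 0" "\<And>x. p \<le> x \<Longrightarrow> x < e \<Longrightarrow> 0 < g x"
      using first_zero[of p h g h] gp[of p] p g(3) continuous_on_subset[OF rsol_continuous(1)[OF g(1)], of "{p..h}"] by auto
    have pos: "0 < g x" if "0 < x" "x < e" for x using gp[of x] e(4)[of x] that by fastforce
    have "g1 0 * z 0 - g 0 * z1 0 < g1 e * z e - g e * z1 e"
      by (rule rsol_comparison[OF g(1) z(1) less]) (use e p pos zpos in auto)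
    then have "0 < g1 e * z e" using g z e by simp
    moreover have "g1 e \<le> 0"
      using deriv_nonpos_at_zero[of g "g1 e" e h 0] rsolD(1)[OF g(1), of e] e p pos by auto
    moreover have "0 \<le> z e" using zpos[of e] e p z(3) by (cases "e = h") auto
    ultimately show False by (simp add: zero_less_mult_iff)
  qed
  have "rsol V \<nu> h (\<lambda>x. - 1 * f x + 0 * f x) (\<lambda>x. - 1 * f1 x + 0 * f1 x)"
    by (rule rsol_lincomb[OF f(1) f(1)])
  from key[OF f] key[OF this] show ?thesis using f by simp
qed

text \<open>Suppose the solution \<open>y\<close> at the level \<open>\<mu>\<close> has Neumann data at \<open>0\<close>, changes sign exactly
  once, at \<open>c\<close>, and is negative and decreasing at \<open>h\<close>.  Then a Neumann eigenfunction below \<open>\<mu>\<close>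
  has no zero up to \<open>c\<close> (compare from the left) and none after \<open>c\<close> (compare from the right).\<close>

lemma rsol_neumann_pos:
  assumes Y: "rsol V \<nu> h Y Y1" "Y 0 = 1" "Y1 0 = 0" "Y1 h = 0" and V: "continuous_on {0..h} V"
    and y: "rsol V \<mu> h y y1" "y1 0 = 0" "y1 h < 0" "y h < 0" and c: "0 < c" "c < h" "y c = 0"
    and yl: "\<And>x. 0 < x \<Longrightarrow> x < c \<Longrightarrow> 0 < y x" and yr: "\<And>x. c < x \<Longrightarrow> x < h \<Longrightarrow> y x < 0"
    and less: "\<nu> < \<mu>" and x: "x \<in> {0..h}"
  shows "0 < Y x"
proof (rule ccontr)
  assume nx: "\<not> 0 < Y x"
  have h: "0 < h" using c by simp
  note Yc = rsol_continuous(1)[OF Y(1)]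
  obtain d where d: "0 \<le> d" "d \<le> h" "Y d = 0"
  proof -
    have "\<exists>t. 0 \<le> t \<and> t \<le> x \<and> Y t = 0"
      using nx x Y(2) by (intro IVT2') (auto intro: continuous_on_subset[OF Yc])
    then show ?thesis using that x by auto
  qed
  have zc: "c < t" if t: "0 \<le> t" "t \<le> h" "Y t = 0" for t
  proof (rule ccontr)
    assume "\<not> c < t"
    obtain e where e: "0 < e" "e \<le> t" "Y e = 0" "\<And>x. 0 \<le> x \<Longrightarrow> x < e \<Longrightarrow> 0 < Y x"
      using first_zero[OF Yc, of t] Y(2) t by auto
    have ec: "e \<le> c" using e \<open>\<not> c < t\<close> by simp
    have "Y1 0 * y 0 - Y 0 * y1 0 < Y1 e * y e - Y e * y1 e"
      by (rule rsol_comparison[OF Y(1) y(1) less]) (use e t ec yl in auto)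
    then have "0 < Y1 e * y e" using Y y e by simp
    moreover have "Y1 e \<le> 0"
      using deriv_nonpos_at_zero[of Y "Y1 e" e h 0] rsolD(1)[OF Y(1), of e] e t by auto
    moreover have "0 \<le> y e" using yl[of e] ec e c(3) by (cases "e = c") auto
    ultimately show False by (simp add: zero_less_mult_iff)
  qed
  define V' where "V' x = V (h - x)" for x
  have V'c: "continuous_on {0..h} V'" unfolding V'_def
    by (rule continuous_on_compose2[OF V]) (auto intro!: continuous_intros)
  have R: "rsol V' \<nu> h (\<lambda>x. Y (h - x)) (\<lambda>x. - Y1 (h - x))"
    unfolding V'_def by (rule rsol_reflect[OF Y(1)])
  \<comment> \<open>A zero at h together with Y1 h = 0 would make Y vanish identically.\<close>
  have Yh: "Y h \<noteq> 0"
  proof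
    assume "Y h = 0"
    then have "Y (h - h) = 0" using rsol_unique[OF R rsol_zero V'c, of h] Y(4) h by auto
    then show False using Y(2) by simp
  qed
  \<comment> \<open>Y may be negative past its zero. \<sigma> normalises its sign at h, so that in
    reflected coordinates both \<sigma> Y and -y start out positive.\<close>
  define \<sigma> where "\<sigma> = sgn (Y h)"
  have s0: "\<sigma> * Y h > 0" using Yh by (simp add: \<sigma>_def sgn_if)
  have R': "rsol V' \<nu> h (\<lambda>x. \<sigma> * Y (h - x)) (\<lambda>x. \<sigma> * - Y1 (h - x))"
    using rsol_lincomb[OF R R, of \<sigma> 0] by simp
  have ry: "rsol V' \<mu> h (\<lambda>x. - y (h - x)) (\<lambda>x. y1 (h - x))"
    using rsol_lincomb[OF rsol_reflect[OF y(1)] rsol_reflect[OF y(1)], of "-1" 0] unfolding V'_def by simp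
  obtain e where e: "0 < e" "e \<le> h - d" "\<sigma> * Y (h - e) = 0" "\<And>x. 0 \<le> x \<Longrightarrow> x < e \<Longrightarrow> 0 < \<sigma> * Y (h - x)"
    using first_zero[OF rsol_continuous(1)[OF R'], of "h - d"] s0 d by auto
  have ehc: "e < h - c" using e zc[OF d] by simp
  have "\<sigma> * - Y1 (h - 0) * - y (h - 0) - \<sigma> * Y (h - 0) * y1 (h - 0)
     < \<sigma> * - Y1 (h - e) * - y (h - e) - \<sigma> * Y (h - e) * y1 (h - e)"
    by (rule rsol_comparison[OF R' ry less]) (use e ehc c yr in auto)
  then have "- (\<sigma> * Y h) * y1 h < (\<sigma> * - Y1 (h - e)) * - y (h - e)" using Y(4) e(3) by simp
  moreover have "0 < - (\<sigma> * Y h) * y1 h" using s0 y(3) by (simp add: mult_pos_neg)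
  moreover have "\<sigma> * - Y1 (h - e) \<le> 0"
    using deriv_nonpos_at_zero[of "\<lambda>x. \<sigma> * Y (h - x)" "\<sigma> * - Y1 (h - e)" e h 0] rsolD(1)[OF R', of e] e d by auto
  moreover have "0 < - y (h - e)" using yr[of "h - e"] ehc e c by auto
  ultimately show False by (smt (verit) mult_nonpos_nonneg)
qed

text \<open>The Neumann conditions make the Wronskian vanish at both ends, so it cannot increase
  strictly.\<close>

lemma rsol_two_positive_neumann:
  assumes f: "rsol V \<nu> h f f1" "f1 0 = 0" "f1 h = 0" "\<And>x. x \<in> {0..h} \<Longrightarrow> 0 < f x"
    and g: "rsol V \<mu> h g g1" "g1 0 = 0" "g1 h = 0" "\<And>x. x \<in> {0..h} \<Longrightarrow> 0 < g x" and h: "0 < h"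
  shows "\<nu> = \<mu>"
proof (rule ccontr)
  assume "\<nu> \<noteq> \<mu>"
  then consider "\<nu> < \<mu>" | "\<mu> < \<nu>" by linarith
  then show False
  proof cases
    case 1
    from rsol_comparison[OF f(1) g(1) 1 h order_refl] f g h show False by simp
  next
    case 2
    from rsol_comparison[OF g(1) f(1) 2 h order_refl] f g h show False by simp
  qed
qed

text \<open>While Y > 0 it is convex, hence increasing from slope 0, so it cannot reach a first
  zero.\<close>

lemma rsol_neumann_large_potential:
  assumes Y: "rsol V \<nu> h Y Y1" "Y 0 = 1" "Y1 0 = 0" and h: "0 < h"
    and V: "\<And>x. x \<in> {0..h} \<Longrightarrow> 0 < V x - \<nu>"
  shows "0 < Y1 h"
proof -
  have inc: "0 < Y1 x" if "0 < x" "x \<le> e" "e \<le> h" "\<And>t. 0 \<le> t \<Longrightarrow> t < e \<Longrightarrow> 0 < Y t" for x e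
  proof -
    have "Y1 0 < Y1 x"
      by (rule Icc_deriv_pos_strict_mono[OF rsolD(2)[OF Y(1)]]) (use that V in auto)
    then show ?thesis using Y by simp
  qed
  have pos: "0 < Y x" if xh: "x \<in> {0..h}" for x
  proof (rule ccontr)
    assume nx: "\<not> 0 < Y x"
    note Yc = rsol_continuous(1)[OF Y(1)]
    have "\<exists>t. 0 \<le> t \<and> t \<le> x \<and> Y t = 0"
      using nx xh Y(2) by (intro IVT2') (auto intro: continuous_on_subset[OF Yc])
    then obtain t where t: "0 \<le> t" "t \<le> h" "Y t = 0" using xh by force
    obtain e where e: "0 < e" "e \<le> t" "Y e = 0" "\<And>x. 0 \<le> x \<Longrightarrow> x < e \<Longrightarrow> 0 < Y x"
      using first_zero[OF Yc, of t] Y(2) t by auto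
    have "Y 0 < Y e"
      by (rule Icc_deriv_pos_strict_mono[OF rsolD(1)[OF Y(1)]]) (use e t inc[of _ e] in auto)
    then show False using e Y by simp
  qed
  show ?thesis by (rule inc[of h h]) (use h pos in auto)
qed

text \<open>The Neumann shooting function changes sign between a very negative level and \<open>\<mu>\<close>.\<close>

lemma neumann_eigenvalue_exists:
  assumes V: "continuous_on {0..h} V" and h: "0 < h"
    and y: "rsol V \<mu> h y y1" "0 < y 0" "y1 0 = 0" "y1 h < 0"
  obtains \<nu> Y Y1 where "\<nu> < \<mu>" "rsol V \<nu> h Y Y1" "Y 0 = 1" "Y1 0 = 0" "Y1 h = 0"
proof -
  have "\<forall>\<nu>. \<exists>f f1. rsol V \<nu> h f f1 \<and> f 0 = 1 \<and> f1 0 = 0"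
    using rsol_exists[OF less_imp_le[OF h] V] by metis
  then obtain Y Y1 where Y: "\<And>\<nu>. rsol V \<nu> h (Y \<nu>) (Y1 \<nu>)" "\<And>\<nu>. Y \<nu> 0 = 1" "\<And>\<nu>. Y1 \<nu> 0 = 0" by metis
  obtain K where K: "0 \<le> K" "\<And>x. x \<in> {0..h} \<Longrightarrow> norm (V x) \<le> K"
    using continuous_on_Icc_bound[OF V] by blast
  \<comment> \<open>Below \<mu>, and low enough that V - \<Lambda> > 0 on the whole
    interval.\<close>
  define \<Lambda> where "\<Lambda> = - (K + \<bar>\<mu>\<bar> + 1)"
  have hin: "h \<in> {0..h}" using h by auto
  have low: "0 < Y1 \<Lambda> h"
    by (rule rsol_neumann_large_potential[OF Y h]) (use K(2) in \<open>fastforce simp: \<Lambda>_def abs_le_iff\<close>)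
  have high: "Y1 \<mu> h < 0"
  proof -
    have "rsol V \<mu> h (\<lambda>x. (1 / y 0) * y x + 0 * y x) (\<lambda>x. (1 / y 0) * y1 x + 0 * y1 x)"
      by (rule rsol_lincomb[OF y(1) y(1)])
    from rsol_unique[OF Y(1) this V _ _ hin] Y y have "Y1 \<mu> h = y1 h / y 0" by simp
    then show ?thesis using y by (simp add: divide_neg_pos)
  qed
  \<comment> \<open>One bound for all levels between \<Lambda> and \<mu>, so that the shooting
    function is Lipschitz there.\<close>
  define Q where "Q = K + \<bar>\<Lambda>\<bar> + \<bar>\<mu>\<bar>"
  have Q: "cmod (complex_of_real (V x) - complex_of_real \<nu>) \<le> Q" if "x \<in> {0..h}" "\<nu> \<in> {\<Lambda>..\<mu>}" for x \<nu>
  proof -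
    have "\<bar>V x - \<nu>\<bar> \<le> Q" using K(2)[OF that(1)] that(2) unfolding Q_def real_norm_def by (auto simp: abs_le_iff)
    then show ?thesis by (metis norm_of_real of_real_diff real_norm_def)
  qed
  define E where "E = hill_const Q h"
  have E0: "0 \<le> E" unfolding E_def by (rule hill_const_nonneg) (use h in simp)
  have lip: "\<bar>Y1 \<nu> h - Y1 \<nu>' h\<bar> \<le> (E * E) * \<bar>\<nu> - \<nu>'\<bar>" if "\<nu> \<in> {\<Lambda>..\<mu>}" "\<nu>' \<in> {\<Lambda>..\<mu>}" for \<nu> \<nu>'
  proof -
    have "cmod (complex_of_real (Y1 \<nu> h) - complex_of_real (Y1 \<nu>' h)) \<le>
       E * (cmod (complex_of_real (Y \<nu> 0) - complex_of_real (Y \<nu>' 0)) + cmod (complex_of_real (Y1 \<nu> 0) - complex_of_real (Y1 \<nu>' 0)) +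
        cmod (complex_of_real \<nu> - complex_of_real \<nu>') * (E * (cmod (complex_of_real (Y \<nu> 0)) + cmod (complex_of_real (Y1 \<nu> 0)))))"
      unfolding E_def
      by (rule hill_sol_dependence(2)[OF hill_sol_of_rsol[OF Y(1)] hill_sol_of_rsol[OF Y(1)] Q[OF _ that(1)] Q[OF _ that(2)] hin])
    then show ?thesis by (simp add: Y(2,3) flip: of_real_diff) (simp add: mult_ac)
  qed
  have cont: "continuous_on {\<Lambda>..\<mu>} (\<lambda>\<nu>. Y1 \<nu> h)"
  proof (rule continuous_on_iff[THEN iffD2], intro ballI allI impI)
    fix \<nu> e :: real assume \<nu>: "\<nu> \<in> {\<Lambda>..\<mu>}" and e: "0 < e"
    define d where "d = e / (E * E + 1)"
    have EE: "0 < E * E + 1" using E0 by (simp add: add_nonneg_pos)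
    have d: "0 < d" using e EE by (simp add: d_def)
    have "dist (Y1 \<nu>' h) (Y1 \<nu> h) < e" if "\<nu>' \<in> {\<Lambda>..\<mu>}" "dist \<nu>' \<nu> < d" for \<nu>'
    proof -
      have "\<bar>Y1 \<nu>' h - Y1 \<nu> h\<bar> \<le> (E * E) * \<bar>\<nu>' - \<nu>\<bar>" by (rule lip[OF that(1) \<nu>])
      also have "\<dots> \<le> (E * E + 1) * \<bar>\<nu>' - \<nu>\<bar>" by (simp add: algebra_simps)
      also have "\<dots> < (E * E + 1) * d" using that(2) EE by (intro mult_strict_left_mono) (auto simp: dist_real_def)
      also have "\<dots> = e" using EE by (simp add: d_def)
      finally show ?thesis by (simp add: dist_real_def)
    qed
    then show "\<exists>d>0. \<forall>x'\<in>{\<Lambda>..\<mu>}. dist x' \<nu> < d \<longrightarrow> dist (Y1 x' h) (Y1 \<nu> h) < e" using d by blast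
  qed
  have "\<Lambda> \<le> \<mu>" using K(1) by (auto simp: \<Lambda>_def)
  then obtain \<nu> where \<nu>: "\<Lambda> \<le> \<nu>" "\<nu> \<le> \<mu>" "Y1 \<nu> h = 0"
    using IVT2'[of "\<lambda>\<nu>. Y1 \<nu> h" \<mu> 0 \<Lambda>] low high cont by auto
  then have "\<nu> < \<mu>" using high by (cases "\<nu> = \<mu>") auto
  then show ?thesis using that Y \<nu>(3) by blast
qed

section \<open>Spectrum of the linearization\<close>

text \<open>Reduction of order for \<open>-y'' + (P1 + 2 s P2)(\<phi>\<^sup>2) y = 0\<close>: besides \<open>\<phi>'\<close> there is a solution
  \<open>y = A(\<phi>\<^sup>2) / \<phi> + \<phi>' \<integral> B(\<phi>\<^sup>2)\<close>.  Regularity at the turning points forces \<open>A\<close> to interpolate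
  a multiple of \<open>-1/P'\<close> at \<open>a\<close> and \<open>b\<close>; the remaining freedom in \<open>A\<close> is fixed so that \<open>B < 0\<close> on the
  whole orbit.  This choice is what one gets by differentiating the period in the form
  \<open>\<integral> (X cos\<^sup>2 + Y sin\<^sup>2)\<^sup>-\<^sup>1\<^sup>/\<^sup>2\<close>, \<open>X = a(b + c)\<close>, \<open>Y = b(a + c)\<close>, along the orbits: both \<open>X + Y\<close> and
  \<open>X Y\<close> are monotone, hence so is the period.\<close>

definition red_G :: "real \<Rightarrow> real \<Rightarrow> real \<Rightarrow> real" where
  "red_G a b c = 3 * (a * b) * (a + b)^2 - 8 * (a * b)^2 + a * b * (a + b) * c + (a + b)^3 * c
     + 2 * (a + b)^2 * c^2 + (a + b) * c^3"

definition red_A :: "real \<Rightarrow> real \<Rightarrow> real \<Rightarrow> real \<Rightarrow> real" where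
  "red_A a b c s = 2 * a * b * (a + c) * (b + c) * ((b + c) * (s - b) - (a + c) * (a - s))
     + red_G a b c * (s - a) * (s - b)"

text \<open>The derivative of \<open>red_A\<close> in s.\<close>

definition red_A1 :: "real \<Rightarrow> real \<Rightarrow> real \<Rightarrow> real \<Rightarrow> real" where
  "red_A1 a b c s = 2 * a * b * (a + c) * (b + c) * (a + b + 2 * c) + red_G a b c * (2 * s - a - b)"

text \<open>The numerator of -B, arranged so that its sign can be read off for b <= s <= a: squares
  that do not vanish together, plus a nonnegative product.\<close>

definition red_N :: "real \<Rightarrow> real \<Rightarrow> real \<Rightarrow> real \<Rightarrow> real" where
  "red_N a b c s = ((a + b + c) * (a + c) * (b + c) + 2 * a * b * (a + b + 2 * c)) *
       (a * (a + c) * (s - b)^2 + b * (b + c) * (a - s)^2)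
     + 6 * a * b * (a + c) * (b + c) * (a + b + c) * (s - b) * (a - s)"

definition red_B :: "real \<Rightarrow> real \<Rightarrow> real \<Rightarrow> real \<Rightarrow> real" where
  "red_B a b c s = - red_N a b c s / (s * (s + c))"

text \<open>The coefficient of \<phi>' in y': with I the integral of B along the orbit, y' = \<phi>'
  C(\<phi>^2) + \<phi>'' I.\<close>

definition red_C :: "real \<Rightarrow> real \<Rightarrow> real \<Rightarrow> real \<Rightarrow> real" where
  "red_C a b c s = 2 * red_A1 a b c s - red_A a b c s / s + red_B a b c s"

text \<open>\<open>red_C_P\<close> with denominators cleared: G and E stand for the two long
  coefficients and all powers are multiplied out, the form handed to \<open>algebra\<close>.\<close>

lemma red_polynomial_identity_aux:
  fixes a b c s G E :: real
  assumes "G = 3 * (a * b) * ((a + b) * (a + b)) - 8 * (a * b) * (a * b) + a * b * (a + b) * c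
      + (a + b) * (a + b) * (a + b) * c + 2 * (a + b) * (a + b) * (c * c) + (a + b) * (c * c * c)"
    and "E = (a + b + c) * (a + c) * (b + c) + 2 * a * b * (a + b + 2 * c)"
  shows "((2 * (2 * a * b * (a + c) * (b + c) * (a + b + 2 * c) + G * (2 * s - a - b)) * s
       - (2 * a * b * (a + c) * (b + c) * ((b + c) * (s - b) - (a + c) * (a - s)) + G * (s - a) * (s - b))) * (s + c)
     - (E * (a * (a + c) * ((s - b) * (s - b)) + b * (b + c) * ((a - s) * (a - s)))
       + 6 * a * b * (a + c) * (b + c) * (a + b + c) * (s - b) * (a - s))) * (a - s) * (s - b) =
   ((2 * a * b * (a + c) * (b + c) * ((b + c) * (s - b) - (a + c) * (a - s)) + G * (s - a) * (s - b))
       * ((a - s) * (s - b) + (a - s) * (s + c) - (s - b) * (s + c))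
     + 2 * a * b * ((a - b) * (a - b)) * ((a + c) * (a + c)) * ((b + c) * (b + c))) * s"
  using assms by algebra

lemma red_polynomial_identity:
  "((2 * red_A1 a b c s * s - red_A a b c s) * (s + c) - red_N a b c s) * (a - s) * (s - b) =
   (3 * (red_A a b c s * wave_P1 a b c s) + 2 * a * b * (a - b)^2 * (a + c)^2 * (b + c)^2) * s"
proof -
  have P1: "3 * (red_A a b c s * wave_P1 a b c s) =
      red_A a b c s * ((a - s) * (s - b) + (a - s) * (s + c) - (s - b) * (s + c))"
    by (simp add: wave_P1_def)
  have G: "red_G a b c = 3 * (a * b) * ((a + b) * (a + b)) - 8 * (a * b) * (a * b) + a * b * (a + b) * c
      + (a + b) * (a + b) * (a + b) * c + 2 * (a + b) * (a + b) * (c * c) + (a + b) * (c * c * c)"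
    by (simp only: red_G_def power2_eq_square power3_eq_cube mult.assoc)
  show ?thesis
    unfolding P1 unfolding red_A1_def red_A_def red_N_def power2_eq_square
    by (rule red_polynomial_identity_aux[OF G refl])
qed

text \<open>Constancy of a Wronskian: along the orbit \<phi>' y' - \<phi>'' y equals C P - A P',
  because \<phi>'^2 = P and \<phi>'' = \<phi> P'. The constant is the common value of -A P' at s = a
  and s = b, where P vanishes.\<close>

lemma red_C_P:
  assumes "0 < s" "0 < c"
  shows "red_C a b c s * wave_P a b c s =
    red_A a b c s * wave_P1 a b c s + 2 / 3 * a * b * (a - b)^2 * (a + c)^2 * (b + c)^2"
proof -
  define A A1 N P1 K where "A = red_A a b c s" and "A1 = red_A1 a b c s" and "N = red_N a b c s"
    and "P1 = wave_P1 a b c s" and "K = 2 * a * b * (a - b)^2 * (a + c)^2 * (b + c)^2"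
  have id: "((2 * A1 * s - A) * (s + c) - N) * (a - s) * (s - b) = (3 * (A * P1) + K) * s"
    using red_polynomial_identity[of a b c s] by (simp add: A_def A1_def N_def P1_def K_def)
  have sc: "s + c \<noteq> 0" "s \<noteq> 0" using assms by auto
  have "red_C a b c s = (2 * A1 * (s * (s + c)) - A * (s + c) - N) / (s * (s + c))"
    unfolding red_C_def red_B_def A_def[symmetric] A1_def[symmetric] N_def[symmetric]
    using sc by (simp add: add_divide_distrib diff_divide_distrib)
  also have "2 * A1 * (s * (s + c)) - A * (s + c) - N = (2 * A1 * s - A) * (s + c) - N"
    by (simp add: algebra_simps)
  finally have "red_C a b c s = ((2 * A1 * s - A) * (s + c) - N) / (s * (s + c))" .
  then have "red_C a b c s * wave_P a b c s = ((2 * A1 * s - A) * (s + c) - N) * (a - s) * (s - b) / (3 * s)"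
    using sc by (simp add: wave_P_def)
  also have "\<dots> = A * P1 + K / 3" unfolding id using sc by (simp add: field_simps)
  finally show ?thesis by (simp add: A_def P1_def K_def)
qed

lemma red_B_neg:
  assumes "0 < b" "b < a" "0 < c" "b \<le> s" "s \<le> a"
  shows "red_B a b c s < 0"
proof -
  have E: "0 < (a + b + c) * (a + c) * (b + c) + 2 * a * b * (a + b + 2 * c)"
    using assms by (intro add_pos_pos mult_pos_pos) auto
  have "0 < a * (a + c) * (s - b)^2 + b * (b + c) * (a - s)^2"
  proof (cases "s = b")
    case True
    then show ?thesis using assms by simp
  next
    case False
    then have "0 < a * (a + c) * (s - b)^2" using assms by simp
    moreover have "0 \<le> b * (b + c) * (a - s)^2" using assms by simp
    ultimately show ?thesis by linarith
  qed
  moreover have "0 \<le> 6 * a * b * (a + c) * (b + c) * (a + b + c) * (s - b) * (a - s)"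
    using assms by (intro mult_nonneg_nonneg) auto
  ultimately have "0 < red_N a b c s" unfolding red_N_def using mult_pos_pos[OF E] by (simp add: add_pos_nonneg)
  moreover have "0 < s * (s + c)" using assms by simp
  ultimately show ?thesis by (simp add: red_B_def)
qed

section \<open>The two scalar operators at a periodic wave\<close>

context periodic_wave
begin

text \<open>The derivative of \<phi> P'(\<phi>^2) with respect to \<phi>, so that the differentiated
  wave equation reads \<phi>''' = V1 \<phi>'. In the same way \<open>V2\<close> is
  \<phi>''/\<phi>.\<close>

definition V1 :: "real \<Rightarrow> real" where
  "V1 x = wave_P1 a b c ((\<phi> x)\<^sup>2) + 2 * (\<phi> x)\<^sup>2 * wave_P2 a b c ((\<phi> x)\<^sup>2)"

definition V2 :: "real \<Rightarrow> real" where
  "V2 x = wave_P1 a b c ((\<phi> x)\<^sup>2)"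

definition \<phi>2 :: "real \<Rightarrow> real" where
  "\<phi>2 x = \<phi> x * wave_P1 a b c ((\<phi> x)\<^sup>2)"

lemma wave_P_DERIV:
  "(wave_P a b c has_real_derivative wave_P1 a b c s) (at s)"
  "(wave_P1 a b c has_real_derivative wave_P2 a b c s) (at s)"
  unfolding wave_P_def[abs_def] wave_P1_def[abs_def] wave_P2_def
  by (auto intro!: derivative_eq_intros simp: field_simps)

lemma \<phi>_continuous: "continuous_on S \<phi>"
  by (rule continuous_at_imp_continuous_on) (use DERIV_isCont[OF deriv] in blast)

lemma V_continuous: "continuous_on S V1" "continuous_on S V2"
  unfolding V1_def[abs_def] V2_def[abs_def] wave_P1_def wave_P2_def
  by (intro continuous_intros \<phi>_continuous; simp)+

lemma V_periodic: "V1 (x + L) = V1 x" "V2 (x + L) = V2 x"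
  by (simp_all add: V1_def V2_def periodic)

lemma V1_reflect: "V1 (L - x) = V1 x"
proof -
  have "\<phi> (L - x) = \<phi> x" using periodic[of "- x"] even[of x] by simp
  then show ?thesis by (simp add: V1_def)
qed

lemma \<phi>1_periodic: "\<phi>1 (x + L) = \<phi>1 x"
proof -
  have "((\<lambda>x. \<phi> (x + L)) has_real_derivative \<phi>1 (x + L)) (at x)"
    using deriv[of "x + L"] by (simp add: DERIV_shift)
  then show ?thesis using DERIV_unique[OF _ deriv[of x]] by (simp add: periodic)
qed

lemma \<phi>2_periodic: "\<phi>2 (x + L) = \<phi>2 x"
  by (simp add: \<phi>2_def periodic)

lemma deriv_\<phi>: "deriv \<phi> = \<phi>1"
  by (intro ext DERIV_imp_deriv deriv)

lemma \<phi>1_zeros: "\<phi>1 0 = 0" "\<phi>1 (L / 2) = 0"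
  using energy[of 0] energy[of "L / 2"] by (simp_all add: top bottom wave_P_def)

lemma \<phi>2_ends: "\<phi>2 0 < 0" "0 < \<phi>2 (L / 2)"
proof -
  have "wave_P1 a b c a < 0" "0 < wave_P1 a b c b" using abc by (simp_all add: wave_P1_def)
  then show "\<phi>2 0 < 0" "0 < \<phi>2 (L / 2)" using pos by (simp_all add: \<phi>2_def top bottom mult_pos_neg)
qed

lemma DERIV_\<phi>2: "(\<phi>2 has_real_derivative V1 x * \<phi>1 x) (at x)"
proof -
  have "((\<lambda>x. wave_P1 a b c ((\<phi> x)\<^sup>2)) has_real_derivative wave_P2 a b c ((\<phi> x)\<^sup>2) * (2 * \<phi> x * \<phi>1 x)) (at x)"
    by (rule DERIV_chain2[OF wave_P_DERIV(2)]) (auto intro!: derivative_eq_intros deriv)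
  from DERIV_mult[OF deriv this] show ?thesis unfolding \<phi>2_def[abs_def]
    by (rule DERIV_cong) (simp add: V1_def power2_eq_square algebra_simps)
qed

lemma rsol_\<phi>1: "rsol V1 0 l \<phi>1 \<phi>2"
  unfolding rsol_def
proof (intro ballI conjI)
  fix x
  show "(\<phi>1 has_real_derivative \<phi>2 x) (at x within {0..l})"
    unfolding \<phi>2_def by (rule has_field_derivative_at_within[OF deriv2])
  show "(\<phi>2 has_real_derivative (V1 x - 0) * \<phi>1 x) (at x within {0..l})"
    using has_field_derivative_at_within[OF DERIV_\<phi>2] by simp
qed

lemma rsol_\<phi>: "rsol V2 0 l \<phi> \<phi>1"
  unfolding rsol_def
proof (intro ballI conjI)
  fix x
  show "(\<phi> has_real_derivative \<phi>1 x) (at x within {0..l})"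
    by (rule has_field_derivative_at_within[OF deriv])
  show "(\<phi>1 has_real_derivative (V2 x - 0) * \<phi> x) (at x within {0..l})"
    using has_field_derivative_at_within[OF deriv2] by (simp add: V2_def mult.commute)
qed

text \<open>At the turning points \<phi>' = 0, so y = A/\<phi> and y' = \<phi>'' I there, with I
  negative beyond 0. The signs follow: A is positive at a and negative at b, while \<phi>'' is
  negative at the top and positive at the bottom. That y1 differs at 0 and L is the failure of
  periodicity.\<close>

lemma second_solution:
  obtains y y1 where "rsol V1 0 L y y1" "0 < y 0" "y1 0 = 0" "y (L / 2) < 0" "y1 (L / 2) < 0" "y1 L \<noteq> 0"
proof -
  define s where "s x = (\<phi> x)\<^sup>2" for x
  have s: "b \<le> s x" "s x \<le> a" "0 < s x" for x using range[of x] abc pos[of x] by (auto simp: s_def)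
  have ds: "(s has_real_derivative 2 * \<phi> x * \<phi>1 x) (at x)" for x
    unfolding s_def[abs_def] by (auto intro!: derivative_eq_intros deriv)
  have sc: "continuous_on S s" for S unfolding s_def[abs_def] by (intro continuous_intros \<phi>_continuous)
  define I where "I x = integral {0..x} (\<lambda>t. red_B a b c (s t))" for x
  have nz: "s t * (s t + c) \<noteq> 0" for t using s(3)[of t] abc by auto
  have Bc: "continuous_on S (\<lambda>t. red_B a b c (s t))" for S
    unfolding red_B_def red_N_def using nz by (intro continuous_intros sc) auto
  have dI: "(I has_real_derivative red_B a b c (s x)) (at x within {0..L})" if "x \<in> {0..L}" for x
    unfolding I_def by (rule integral_has_real_derivative[OF Bc that])
  have Ineg: "I x < 0" if "0 < x" for x
  proof -
    have "I x < integral {0..x} (\<lambda>t. 0)"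
      unfolding I_def
    proof (rule integral_less_real[OF Bc continuous_on_const])
      show "{0<..<x} \<noteq> {}" using that by simp
      show "red_B a b c (s t) < 0" for t by (rule red_B_neg) (use abc s in auto)
    qed
    then show ?thesis by simp
  qed
  define A where "A x = red_A a b c (s x)" for x
  define y where "y x = A x / \<phi> x + \<phi>1 x * I x" for x
  define y1 where "y1 x = \<phi>1 x * red_C a b c (s x) + \<phi>2 x * I x" for x
  have dA: "(red_A a b c has_real_derivative red_A1 a b c t) (at t)" for t
    unfolding red_A_def[abs_def] red_A1_def by (auto intro!: derivative_eq_intros simp: algebra_simps)
  have dAs: "(A has_real_derivative red_A1 a b c (s x) * (2 * \<phi> x * \<phi>1 x)) (at x)" for x
    unfolding A_def by (rule DERIV_chain2[OF dA ds])
  have dC: "\<exists>D. (red_C a b c has_real_derivative D) (at t)" if "0 < t" for t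
  proof -
    have "t * (t + c) \<noteq> 0" "t \<noteq> 0" using that abc by auto
    then have "(red_C a b c) differentiable (at t)"
      unfolding red_C_def[abs_def] red_B_def red_N_def red_A_def red_A1_def
      by (intro derivative_intros) auto
    then show ?thesis by (simp add: real_differentiable_def)
  qed
  have rs: "rsol V1 0 L y y1"
    unfolding rsol_def
  proof (intro ballI conjI)
    fix x assume x: "x \<in> {0..L}"
    note w = has_field_derivative_at_within
    define t where "t = s x"
    have t: "0 < t" using s by (simp add: t_def)
    have tphi: "t = \<phi> x * \<phi> x" by (simp add: t_def s_def power2_eq_square)
    have p: "0 < \<phi> x" by (rule pos)
    have y_quot: "((\<lambda>x. A x / \<phi> x) has_real_derivative
       ((red_A1 a b c (s x) * (2 * \<phi> x * \<phi>1 x)) * \<phi> x - A x * \<phi>1 x) / (\<phi> x * \<phi> x)) (at x within {0..L})"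
      by (rule w[OF DERIV_divide[OF dAs deriv]]) (use p in simp)
    have d\<phi>1: "(\<phi>1 has_real_derivative \<phi>2 x) (at x within {0..L})"
      unfolding \<phi>2_def by (rule w[OF deriv2])
    have "(y has_real_derivative ((red_A1 a b c (s x) * (2 * \<phi> x * \<phi>1 x)) * \<phi> x - A x * \<phi>1 x) / (\<phi> x * \<phi> x)
       + (\<phi>2 x * I x + red_B a b c (s x) * \<phi>1 x)) (at x within {0..L})"
      unfolding y_def[abs_def] by (rule DERIV_add[OF y_quot DERIV_mult[OF d\<phi>1 dI[OF x]]])
    moreover have "((red_A1 a b c (s x) * (2 * \<phi> x * \<phi>1 x)) * \<phi> x - A x * \<phi>1 x) / (\<phi> x * \<phi> x) + (\<phi>2 x * I x + red_B a b c (s x) * \<phi>1 x) = y1 x"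
      using p by (simp add: y1_def red_C_def A_def t_def[symmetric] tphi field_simps)
    ultimately show "(y has_real_derivative y1 x) (at x within {0..L})" by simp
    obtain D where D: "(red_C a b c has_real_derivative D) (at t)" using dC[OF t] by blast
    \<comment> \<open>The derivative of the Wronskian identity, obtained by comparing its two sides;
      C' is used only through this relation.\<close>
    have dCP: "D * wave_P a b c t + wave_P1 a b c t * red_C a b c t = red_A1 a b c t * wave_P1 a b c t + wave_P2 a b c t * red_A a b c t"
    proof (rule DERIV_unique)
      show "((\<lambda>t. red_C a b c t * wave_P a b c t) has_real_derivative D * wave_P a b c t + wave_P1 a b c t * red_C a b c t) (at t)"
        by (rule DERIV_mult[OF D wave_P_DERIV(1)])
      have "((\<lambda>t. red_A a b c t * wave_P1 a b c t + 2 / 3 * a * b * (a - b)^2 * (a + c)^2 * (b + c)^2) has_real_derivative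
          (red_A1 a b c t * wave_P1 a b c t + wave_P2 a b c t * red_A a b c t) + 0) (at t)"
        by (intro DERIV_add DERIV_mult dA wave_P_DERIV DERIV_const)
      then have "((\<lambda>t. red_A a b c t * wave_P1 a b c t + 2 / 3 * a * b * (a - b)^2 * (a + c)^2 * (b + c)^2) has_real_derivative
          red_A1 a b c t * wave_P1 a b c t + wave_P2 a b c t * red_A a b c t) (at t)" by simp
      then show "((\<lambda>t. red_C a b c t * wave_P a b c t) has_real_derivative red_A1 a b c t * wave_P1 a b c t + wave_P2 a b c t * red_A a b c t) (at t)"
        by (rule has_field_derivative_transform_within_open[of _ _ _ "{0<..}"]) (use t abc red_C_P in auto)
    qed
    have dCs: "((\<lambda>x. red_C a b c (s x)) has_real_derivative D * (2 * \<phi> x * \<phi>1 x)) (at x)"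
      by (rule DERIV_chain2[OF D[unfolded t_def] ds])
    have "(y1 has_real_derivative (\<phi>2 x * red_C a b c (s x) + (D * (2 * \<phi> x * \<phi>1 x)) * \<phi>1 x)
        + ((V1 x * \<phi>1 x) * I x + red_B a b c (s x) * \<phi>2 x)) (at x within {0..L})"
      unfolding y1_def[abs_def]
      by (rule DERIV_cong[OF DERIV_add[OF DERIV_mult[OF d\<phi>1 w[OF dCs]] DERIV_mult[OF w[OF DERIV_\<phi>2] dI[OF x]]]]) simp
    moreover have "(\<phi>2 x * red_C a b c (s x) + (D * (2 * \<phi> x * \<phi>1 x)) * \<phi>1 x)
        + ((V1 x * \<phi>1 x) * I x + red_B a b c (s x) * \<phi>2 x) = (V1 x - 0) * y x"
    proof -
      define P P1 P2 Cv Bv Av A1v where "P = wave_P a b c t" and "P1 = wave_P1 a b c t" and "P2 = wave_P2 a b c t"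
        and "Cv = red_C a b c t" and "Bv = red_B a b c t" and "Av = red_A a b c t" and "A1v = red_A1 a b c t"
      have e1: "D * P + P1 * Cv = A1v * P1 + P2 * Av"
        using dCP by (simp add: P_def P1_def P2_def Cv_def Av_def A1v_def)
      have e2: "t * Cv = 2 * A1v * t - Av + t * Bv"
        using t by (simp add: Cv_def red_C_def Bv_def Av_def A1v_def field_simps)
      have e3: "\<phi>1 x * \<phi>1 x = P" using energy[of x] by (simp add: P_def t_def s_def power2_eq_square)
      have V: "V1 x = P1 + 2 * t * P2" by (simp add: V1_def P1_def P2_def t_def s_def)
      have f2: "\<phi>2 x = \<phi> x * P1" by (simp add: \<phi>2_def P1_def t_def s_def)
      \<comment> \<open>No division by \<phi>' occurs: \<phi>'^2 is replaced by P, so the equation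
        is obtained at the turning points as well.\<close>
      have "t * P1 * (Cv + Bv) + 2 * t * (D * P) = (P1 + 2 * t * P2) * Av"
        using e1 e2 by algebra
      then have "\<phi> x * (\<phi> x * P1 * Cv + 2 * \<phi> x * D * P + Bv * (\<phi> x * P1)) = (P1 + 2 * t * P2) * Av"
        unfolding tphi by (simp add: algebra_simps)
      then have k: "\<phi> x * P1 * Cv + 2 * \<phi> x * D * P + Bv * (\<phi> x * P1) = (P1 + 2 * t * P2) * Av / \<phi> x"
        using p by (simp add: field_simps)
      have "(\<phi>2 x * red_C a b c (s x) + (D * (2 * \<phi> x * \<phi>1 x)) * \<phi>1 x)
        + ((V1 x * \<phi>1 x) * I x + red_B a b c (s x) * \<phi>2 x)
        = (\<phi> x * P1 * Cv + 2 * \<phi> x * D * (\<phi>1 x * \<phi>1 x) + Bv * (\<phi> x * P1)) + V1 x * (\<phi>1 x * I x)"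
        by (simp add: f2 Cv_def Bv_def t_def algebra_simps)
      also have "\<dots> = V1 x * (A x / \<phi> x) + V1 x * (\<phi>1 x * I x)"
        unfolding e3 k V by (simp add: A_def Av_def t_def)
      finally show ?thesis by (simp add: y_def algebra_simps)
    qed
    ultimately show "(y1 has_real_derivative (V1 x - 0) * y x) (at x within {0..L})" by simp
  qed
  have s0: "s 0 = a" "s (L / 2) = b" by (simp_all add: s_def top bottom)
  have I0: "I 0 = 0" by (simp add: I_def)
  have Aa: "0 < red_A a b c a" using abc by (simp add: red_A_def)
  have Ab: "red_A a b c b < 0" using abc by (simp add: red_A_def mult_pos_neg)
  show ?thesis
  proof (rule that[OF rs])
    show "0 < y 0" using Aa pos[of 0] by (simp add: y_def A_def s0 I0)
    show "y1 0 = 0" by (simp add: y1_def \<phi>1_zeros I0)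
    show "y (L / 2) < 0" using Ab pos[of "L / 2"] by (simp add: y_def A_def s0 \<phi>1_zeros divide_neg_pos)
    show "y1 (L / 2) < 0" using \<phi>2_ends(2) Ineg[of "L / 2"] L by (simp add: y1_def \<phi>1_zeros mult_pos_neg)
    have "\<phi>1 L = 0" "\<phi>2 L = \<phi>2 0" using \<phi>1_periodic[of 0] \<phi>2_periodic[of 0] \<phi>1_zeros by simp_all
    then have "y1 L = \<phi>2 0 * I L" by (simp add: y1_def)
    then show "y1 L \<noteq> 0" using \<phi>2_ends(1) Ineg[OF L] by simp
  qed
qed

lemma kernel_V1:
  assumes sol: "hill_sol (\<lambda>x. of_real (V1 x) - of_real 0) (\<lambda>x. 0) L u v" and per: "u L = u 0" "v L = v 0"
  shows "\<exists>k. \<forall>x\<in>{0..L}. u x = k * of_real (\<phi>1 x)"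
proof -
  obtain y y1 where y: "rsol V1 0 L y y1" "0 < y 0" "y1 0 = 0" "y1 L \<noteq> 0"
    using second_solution by metis
  \<comment> \<open>\<phi>' and y have complementary data at 0, where \<phi>' and y' vanish, so each
    coefficient is read off from one initial value.\<close>
  define \<alpha> \<beta> where "\<alpha> = v 0 / of_real (\<phi>2 0)" and "\<beta> = u 0 / of_real (y 0)"
  have q: "continuous_on {0..L} (\<lambda>x. complex_of_real (V1 x) - of_real 0)" by (intro continuous_intros V_continuous)
  have c: "hill_sol (\<lambda>x. of_real (V1 x) - of_real 0) (\<lambda>x. 0) L
      (\<lambda>x. \<alpha> * of_real (\<phi>1 x) + \<beta> * of_real (y x)) (\<lambda>x. \<alpha> * of_real (\<phi>2 x) + \<beta> * of_real (y1 x))"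
    using hill_sol_lincomb[OF hill_sol_of_rsol[OF rsol_\<phi>1] hill_sol_of_rsol[OF y(1)], of \<alpha> \<beta>] by simp
  have eq: "u x = \<alpha> * of_real (\<phi>1 x) + \<beta> * of_real (y x) \<and> v x = \<alpha> * of_real (\<phi>2 x) + \<beta> * of_real (y1 x)"
    if "x \<in> {0..L}" for x
    by (rule hill_sol_unique[OF sol c q _ _ that])
      (use y \<phi>1_zeros \<phi>2_ends in \<open>auto simp: \<alpha>_def \<beta>_def\<close>)
  have "v L = \<alpha> * of_real (\<phi>2 0) + \<beta> * of_real (y1 L)" using eq[of L] L \<phi>2_periodic[of 0] by simp
  moreover have "v 0 = \<alpha> * of_real (\<phi>2 0)" using \<phi>2_ends by (simp add: \<alpha>_def)
  ultimately have "\<beta> = 0" using per y(4) by simp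
  then show ?thesis using eq by auto
qed

text \<open>Picone's identity: f f' - f^2 \<phi>'/\<phi> takes equal values at 0 and L and has
  derivative (f' - f \<phi>'/\<phi>)^2 - \<nu> f^2, a sum of nonnegative terms for \<nu> <= 0. Both
  vanish; for \<nu> < 0 this means f = 0, and for \<nu> = 0 it fixes the initial slope and hence
  f.\<close>

lemma kernel_V2_real:
  assumes f: "rsol V2 \<nu> L f f1" and per: "f L = f 0" "f1 L = f1 0" and \<nu>: "\<nu> \<le> 0" and x: "x \<in> {0..L}"
  shows "f x = (if \<nu> = 0 then f 0 / \<phi> 0 else 0) * \<phi> x"
proof -
  define g where "g x = f x * f1 x - (f x)\<^sup>2 * \<phi>1 x / \<phi> x" for x
  define g' where "g' x = (f1 x - f x * \<phi>1 x / \<phi> x)\<^sup>2 + (- \<nu>) * (f x)\<^sup>2" for x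
  have dg: "(g has_real_derivative g' x) (at x within {0..L})" if x: "x \<in> {0..L}" for x
  proof -
    note D = rsolD[OF f x] has_field_derivative_at_within[OF deriv, of x "{0..L}"]
      has_field_derivative_at_within[OF deriv2[of x], of "{0..L}"]
    have p: "\<phi> x \<noteq> 0" using pos[of x] by simp
    have "(g has_real_derivative (f1 x * f1 x + ((V2 x - \<nu>) * f x) * f x) -
       (((2 * f x * f1 x) * \<phi>1 x + (\<phi> x * V2 x) * (f x)\<^sup>2) * \<phi> x - (f x)\<^sup>2 * \<phi>1 x * \<phi>1 x) / (\<phi> x * \<phi> x)) (at x within {0..L})"
      unfolding g_def[abs_def]
    proof (intro DERIV_diff DERIV_divide DERIV_mult)
      show "((\<lambda>x. (f x)\<^sup>2) has_real_derivative 2 * f x * f1 x) (at x within {0..L})"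
        using DERIV_power[OF D(1), of 2] by (simp add: mult_ac)
      show "(\<phi>1 has_real_derivative \<phi> x * V2 x) (at x within {0..L})" using D(4) by (simp add: V2_def)
    qed (use D p in auto)
    then show ?thesis
      by (rule DERIV_cong) (use p in \<open>simp add: g'_def power2_eq_square field_simps\<close>)
  qed
  have gL: "g L = g 0" using per periodic[of 0] \<phi>1_periodic[of 0] by (simp add: g_def)
  note fc = rsol_continuous[OF f]
  have \<phi>1c: "continuous_on S \<phi>1" for S
    by (rule continuous_at_imp_continuous_on) (use DERIV_isCont[OF deriv2] in blast)
  have g'c: "continuous_on {0..L} g'"
    unfolding g'_def[abs_def] using pos
    by (intro continuous_intros fc \<phi>1c \<phi>_continuous) (auto simp: less_imp_neq[symmetric])
  have "(g' has_integral g L - g 0) {0..L}"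
    using L dg by (intro fundamental_theorem_of_calculus) (auto simp: has_real_derivative_iff_has_vector_derivative)
  then have "integral {0..L} g' = 0" using gL by (simp add: integral_unique)
  moreover have f2: "0 \<le> (- \<nu>) * (f x)\<^sup>2" for x using \<nu> by (intro mult_nonneg_nonneg) auto
  then have "0 \<le> g' x" for x unfolding g'_def by (intro add_nonneg_nonneg zero_le_power2)
  ultimately have z: "g' t = 0" if "t \<in> {0..L}" for t
    using Equivalence_Lebesgue_Henstock_Integration.integral_eq_0_iff[OF g'c L] that by blast
  show ?thesis
  proof (cases "\<nu> = 0")
    case True
    have "(f1 0 - f 0 * \<phi>1 0 / \<phi> 0)\<^sup>2 = 0" using z[of 0] L True by (simp add: g'_def)
    then have f10: "f1 0 = 0" by (simp add: \<phi>1_zeros)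
    have "rsol V2 \<nu> L (\<lambda>x. (f 0 / \<phi> 0) * \<phi> x + 0 * \<phi> x) (\<lambda>x. (f 0 / \<phi> 0) * \<phi>1 x + 0 * \<phi>1 x)"
      unfolding True by (rule rsol_lincomb[OF rsol_\<phi> rsol_\<phi>])
    from rsol_unique[OF f this V_continuous(2) _ _ x] f10 \<phi>1_zeros pos[of 0] True show ?thesis by simp
  next
    case False
    have "0 \<le> (f1 x - f x * \<phi>1 x / \<phi> x)\<^sup>2" by simp
    with z[OF x] f2[of x] have "(- \<nu>) * (f x)\<^sup>2 = 0" unfolding g'_def by linarith
    then show ?thesis using False by simp
  qed
qed

lemma kernel_V2:
  assumes sol: "hill_sol (\<lambda>x. of_real (V2 x) - of_real \<nu>) (\<lambda>x. 0) L u v" and per: "u L = u 0" "v L = v 0"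
    and \<nu>: "\<nu> \<le> 0"
  shows "\<nu> = 0 \<Longrightarrow> \<exists>k. \<forall>x\<in>{0..L}. u x = k * of_real (\<phi> x)"
    and "\<nu> < 0 \<Longrightarrow> x \<in> {0..L} \<Longrightarrow> u x = 0"
proof -
  note R = rsol_Re_Im[OF sol]
  have re: "Re (u x) = (if \<nu> = 0 then Re (u 0) / \<phi> 0 else 0) * \<phi> x" if "x \<in> {0..L}" for x
    using kernel_V2_real[OF R(1) _ _ \<nu> that] per by simp
  have im: "Im (u x) = (if \<nu> = 0 then Im (u 0) / \<phi> 0 else 0) * \<phi> x" if "x \<in> {0..L}" for x
    using kernel_V2_real[OF R(2) _ _ \<nu> that] per by simp
  show "\<exists>k. \<forall>x\<in>{0..L}. u x = k * of_real (\<phi> x)" if "\<nu> = 0"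
  proof (intro exI ballI)
    show "u x = (u 0 / of_real (\<phi> 0)) * of_real (\<phi> x)" if "x \<in> {0..L}" for x
      using re[OF that] im[OF that] \<open>\<nu> = 0\<close> by (intro complex_eqI) simp_all
  qed
  show "u x = 0" if "\<nu> < 0" "x \<in> {0..L}"
    using re[OF that(2)] im[OF that(2)] that(1) by (intro complex_eqI) simp_all
qed

text \<open>The reflection of x to L - x preserves the equation. The odd part f(x) - f(L - x)
  vanishes at 0 by periodicity and at L/2; comparison with -\<phi>', positive in between, makes its
  slope at 0 vanish. So f is symmetric, with slope zero at both symmetry points.\<close>

lemma negative_V1_neumann:
  assumes f: "rsol V1 \<nu> L f f1" and per: "f L = f 0" "f1 L = f1 0" and \<nu>: "\<nu> < 0"
  shows "f1 0 = 0" "f1 (L / 2) = 0"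
proof -
  have "rsol V1 \<nu> L (\<lambda>x. f (L - x)) (\<lambda>x. - f1 (L - x))"
    using rsol_reflect[OF f] by (simp add: V1_reflect)
  from rsol_lincomb[OF f this, of 1 "-1"]
  have o: "rsol V1 \<nu> L (\<lambda>x. f x - f (L - x)) (\<lambda>x. f1 x + f1 (L - x))" by simp
  have z: "rsol V1 0 (L / 2) (\<lambda>x. - \<phi>1 x) (\<lambda>x. - \<phi>2 x)"
    using rsol_lincomb[OF rsol_\<phi>1 rsol_\<phi>1, of "L / 2" "-1" 0] by simp
  have "rsol V1 \<nu> (L / 2) (\<lambda>x. f x - f (L - x)) (\<lambda>x. f1 x + f1 (L - x))"
    by (rule rsol_restrict[OF o]) (use L in simp)
  from rsol_dirichlet[OF this _ _ z _ _ _ \<nu>] per decreasing \<phi>1_zeros L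
  have o0: "f1 0 + f1 (L - 0) = 0" by simp
  then show "f1 0 = 0" using per by simp
  have "(f (L/2) - f (L - L/2)) = 0 \<and> f1 (L/2) + f1 (L - L/2) = 0"
    by (rule rsol_unique[OF o rsol_zero V_continuous(1)]) (use per o0 L in auto)
  then show "f1 (L / 2) = 0" by simp
qed

text \<open>The Wronskian of y and \<phi>' is constant, so y/\<phi>' has positive derivative on the
  open half period and y has exactly one zero c there. This supplies the comparison function for
  \<open>rsol_neumann_pos\<close>.\<close>

lemma neumann_V1_pos:
  assumes Y: "rsol V1 \<nu> (L / 2) Y Y1" "Y 0 = 1" "Y1 0 = 0" "Y1 (L / 2) = 0" and \<nu>: "\<nu> < 0"
    and x: "x \<in> {0..L / 2}"
  shows "0 < Y x"
proof -
  obtain y y1 where y: "rsol V1 0 L y y1" "0 < y 0" "y1 0 = 0" "y (L / 2) < 0" "y1 (L / 2) < 0"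
    using second_solution by metis
  have yh: "rsol V1 0 (L / 2) y y1" by (rule rsol_restrict[OF y(1)]) (use L in simp)
  define K where "K = y 0 * \<phi>2 0"
  have K: "K < 0" using y \<phi>2_ends by (simp add: K_def mult_pos_neg)
  have wr: "y1 x * \<phi>1 x - y x * \<phi>2 x = - K" if x: "x \<in> {0..L / 2}" for x
  proof -
    have d: "((\<lambda>x. y1 x * \<phi>1 x - y x * \<phi>2 x) has_real_derivative 0) (at x within {0..L/2})" if "x \<in> {0..L/2}" for x
      using rsol_wronskian[OF yh rsol_\<phi>1 that] by simp
    have "y1 0 * \<phi>1 0 - y 0 * \<phi>2 0 \<le> y1 x * \<phi>1 x - y x * \<phi>2 x"
      by (rule Icc_deriv_nonneg_mono[OF d]) (use x in auto)
    moreover have "- (y1 0 * \<phi>1 0 - y 0 * \<phi>2 0) \<le> - (y1 x * \<phi>1 x - y x * \<phi>2 x)"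
      by (rule Icc_deriv_nonneg_mono[OF DERIV_minus[OF d]]) (use x in auto)
    ultimately show ?thesis using y by (simp add: K_def)
  qed
  have dec: "y t / \<phi>1 t > y r / \<phi>1 r" if rt: "0 < r" "r < t" "t < L / 2" for r t
  proof (rule DERIV_pos_imp_increasing[OF rt(2)])
    fix x assume x: "r \<le> x" "x \<le> t"
    then have xin: "x \<in> {0..L/2}" "x \<in> {0<..<L/2}" using rt by auto
    have at: "at x within {0..L/2} = at x" by (rule at_within_Icc_at) (use xin in auto)
    have p1: "\<phi>1 x < 0" using decreasing xin by auto
    have "((\<lambda>x. y x / \<phi>1 x) has_real_derivative (y1 x * \<phi>1 x - y x * \<phi>2 x) / (\<phi>1 x * \<phi>1 x)) (at x)"
      using rsolD[OF yh xin(1)] rsolD[OF rsol_\<phi>1 xin(1)] p1 unfolding at by (intro DERIV_divide) auto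
    moreover have "0 < (y1 x * \<phi>1 x - y x * \<phi>2 x) / (\<phi>1 x * \<phi>1 x)"
      unfolding wr[OF xin(1)] using K p1 by (intro divide_pos_pos mult_neg_neg) auto
    ultimately show "\<exists>D. ((\<lambda>x. y x / \<phi>1 x) has_real_derivative D) (at x) \<and> 0 < D" by blast
  qed
  have "\<exists>c. 0 \<le> c \<and> c \<le> L / 2 \<and> y c = 0"
    by (rule IVT2') (use y rsol_continuous(1)[OF yh] L in auto)
  then obtain c where c: "0 \<le> c" "c \<le> L / 2" "y c = 0" by blast
  have c': "0 < c" "c < L / 2" using c y by (cases "c = 0"; cases "c = L / 2"; force)+
  show ?thesis
  proof (rule rsol_neumann_pos[OF Y V_continuous(1) yh y(3,5,4) c' c(3) _ _ \<nu> x])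
    show "0 < y x" if "0 < x" "x < c" for x
    proof -
      have "y x / \<phi>1 x < 0" using dec[OF that(1,2) c'(2)] c(3) by simp
      moreover have "\<phi>1 x < 0" using decreasing that c' by auto
      ultimately show ?thesis by (simp add: divide_less_0_iff)
    qed
    show "y x < 0" if "c < x" "x < L / 2" for x
    proof -
      have "0 < y x / \<phi>1 x" using dec[OF c'(1) that] c(3) by simp
      moreover have "\<phi>1 x < 0" using decreasing that c' by auto
      ultimately show ?thesis by (simp add: zero_less_divide_iff)
    qed
  qed
qed

text \<open>Shooting on the half period gives a Neumann solution, and symmetry makes it periodic.
  Conversely, a nonzero periodic solution below 0 is Neumann on the half period, hence of one sign
  there, and two solutions of one sign share their level. At equal level the initial value
  determines the solution.\<close>

lemma negative_V1:
  obtains \<nu>0 Y Y1 where "\<nu>0 < 0" "rsol V1 \<nu>0 L Y Y1" "Y L = Y 0" "Y1 L = Y1 0" "Y 0 = 1"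
    "\<And>\<nu> u v. \<nu> < 0 \<Longrightarrow> hill_sol (\<lambda>x. of_real (V1 x) - of_real \<nu>) (\<lambda>x. 0) L u v \<Longrightarrow> u L = u 0 \<Longrightarrow> v L = v 0 \<Longrightarrow>
       (\<forall>x\<in>{0..L}. u x = 0) \<or> \<nu> = \<nu>0 \<and> (\<exists>k. \<forall>x\<in>{0..L}. u x = k * of_real (Y x))"
proof -
  have h: "0 < L / 2" using L by simp
  obtain y y1 where y: "rsol V1 0 L y y1" "0 < y 0" "y1 0 = 0" "y1 (L / 2) < 0"
    using second_solution by metis
  have yh: "rsol V1 0 (L / 2) y y1" by (rule rsol_restrict[OF y(1)]) (use L in simp)
  obtain \<nu>0 Z Z1 where Z: "\<nu>0 < 0" "rsol V1 \<nu>0 (L / 2) Z Z1" "Z 0 = 1" "Z1 0 = 0" "Z1 (L / 2) = 0"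
    using neumann_eigenvalue_exists[OF V_continuous(1) h yh y(2,3,4)] by blast
  obtain Y Y1 where Y: "rsol V1 \<nu>0 L Y Y1" "Y 0 = 1" "Y1 0 = 0"
    using rsol_exists[OF less_imp_le[OF L] V_continuous(1)] by blast
  have Yh: "rsol V1 \<nu>0 (L / 2) Y Y1" by (rule rsol_restrict[OF Y(1)]) (use L in simp)
  have Y1h: "Y1 (L / 2) = 0"
    using rsol_unique[OF Yh Z(2) V_continuous(1), of "L / 2"] Y Z L by simp
  \<comment> \<open>Y(x) - Y(L - x) has zero data at L/2 because Y1 (L/2) = 0, so it vanishes on the
    second half; at x = L this is the periodicity of Y.\<close>
  have "rsol V1 \<nu>0 L (\<lambda>x. Y (L - x)) (\<lambda>x. - Y1 (L - x))"
    using rsol_reflect[OF Y(1)] by (simp add: V1_reflect)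
  from rsol_lincomb[OF Y(1) this, of 1 "-1"]
  have o: "rsol V1 \<nu>0 L (\<lambda>x. Y x - Y (L - x)) (\<lambda>x. Y1 x + Y1 (L - x))" by simp
  from rsol_shift[OF o, of "L / 2"] L
  have o2: "rsol (\<lambda>x. V1 (L / 2 + x)) \<nu>0 (L / 2) (\<lambda>x. Y (L / 2 + x) - Y (L - (L / 2 + x))) (\<lambda>x. Y1 (L / 2 + x) + Y1 (L - (L / 2 + x)))"
    by simp
  have V1s: "continuous_on {0..L / 2} (\<lambda>x. V1 (L / 2 + x))"
    by (rule continuous_on_compose2[OF V_continuous(1)[of UNIV]]) (auto intro!: continuous_intros)
  have "Y (L / 2 + L / 2) - Y (L - (L / 2 + L / 2)) = 0 \<and> Y1 (L / 2 + L / 2) + Y1 (L - (L / 2 + L / 2)) = 0"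
    by (rule rsol_unique[OF o2 rsol_zero V1s]) (use Y1h L in auto)
  then have YL: "Y L = Y 0" "Y1 L = Y1 0" using Y by auto
  have real: "(\<forall>x\<in>{0..L}. f x = 0) \<or> \<nu> = \<nu>0 \<and> (\<forall>x\<in>{0..L}. f x = f 0 * Y x)"
    if \<nu>: "\<nu> < 0" and f: "rsol V1 \<nu> L f f1" and per: "f L = f 0" "f1 L = f1 0" for \<nu> f f1
  proof (cases "f 0 = 0")
    case True
    have "f x = 0" if "x \<in> {0..L}" for x
      using rsol_unique[OF f rsol_zero V_continuous(1) _ _ that] True negative_V1_neumann(1)[OF f per \<nu>] by simp
    then show ?thesis by blast
  next
    case False
    note n = negative_V1_neumann[OF f per \<nu>]
    have g: "rsol V1 \<nu> L (\<lambda>x. (1 / f 0) * f x) (\<lambda>x. (1 / f 0) * f1 x)"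
      using rsol_lincomb[OF f f, of "1 / f 0" 0] by simp
    have gh: "rsol V1 \<nu> (L / 2) (\<lambda>x. (1 / f 0) * f x) (\<lambda>x. (1 / f 0) * f1 x)"
      by (rule rsol_restrict[OF g]) (use L in simp)
    have gpos: "0 < (1 / f 0) * f x" if "x \<in> {0..L / 2}" for x
      by (rule neumann_V1_pos[OF gh _ _ _ \<nu> that]) (use False n in auto)
    have Ypos: "0 < Y x" if "x \<in> {0..L / 2}" for x
      by (rule neumann_V1_pos[OF Yh Y(2,3) Y1h Z(1) that])
    have "\<nu> = \<nu>0"
      by (rule rsol_two_positive_neumann[OF gh _ _ gpos Yh Y(3) Y1h Ypos h]) (use n in auto)
    moreover have "f x = f 0 * Y x" if "x \<in> {0..L}" for x
      using rsol_unique[OF g Y(1)[folded \<open>\<nu> = \<nu>0\<close>] V_continuous(1) _ _ that] False n Y by (simp add: field_simps)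
    ultimately show ?thesis by blast
  qed
  show ?thesis
  proof (rule that[OF Z(1) Y(1) YL Y(2)])
    fix \<nu> u v
    assume \<nu>: "\<nu> < 0" and sol: "hill_sol (\<lambda>x. of_real (V1 x) - of_real \<nu>) (\<lambda>x. 0) L u v"
      and per: "u L = u 0" "v L = v 0"
    note R = rsol_Re_Im[OF sol]
    have re: "(\<forall>x\<in>{0..L}. Re (u x) = 0) \<or> \<nu> = \<nu>0 \<and> (\<forall>x\<in>{0..L}. Re (u x) = Re (u 0) * Y x)"
      using real[OF \<nu> R(1)] per by simp
    have im: "(\<forall>x\<in>{0..L}. Im (u x) = 0) \<or> \<nu> = \<nu>0 \<and> (\<forall>x\<in>{0..L}. Im (u x) = Im (u 0) * Y x)"
      using real[OF \<nu> R(2)] per by simp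
    show "(\<forall>x\<in>{0..L}. u x = 0) \<or> \<nu> = \<nu>0 \<and> (\<exists>k. \<forall>x\<in>{0..L}. u x = k * of_real (Y x))"
    proof (cases "\<nu> = \<nu>0")
      case True
      \<comment> \<open>At the level \<nu>0 the two alternatives merge: the zero function is also g
        0 times Y.\<close>
      have aux: "g x = g 0 * Y x"
        if g: "(\<forall>x\<in>{0..L}. g x = 0) \<or> \<nu> = \<nu>0 \<and> (\<forall>x\<in>{0..L}. g x = g 0 * Y x)" and x: "x \<in> {0..L}"
        for g :: "real \<Rightarrow> real" and x
        using g
      proof
        assume z: "\<forall>x\<in>{0..L}. g x = 0"
        have "g x = 0" "g 0 = 0" using z x L by auto
        then show ?thesis by simp
      next
        assume "\<nu> = \<nu>0 \<and> (\<forall>x\<in>{0..L}. g x = g 0 * Y x)"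
        then show ?thesis using x by blast
      qed
      have "u x = u 0 * of_real (Y x)" if "x \<in> {0..L}" for x
        using aux[OF re that] aux[OF im that] by (intro complex_eqI) simp_all
      then show ?thesis using True by blast
    next
      case False
      then have "\<forall>x\<in>{0..L}. Re (u x) = 0" "\<forall>x\<in>{0..L}. Im (u x) = 0" using re im by blast+
      then have "u x = 0" if "x \<in> {0..L}" for x using that by (intro complex_eqI) simp_all
      then show ?thesis by blast
    qed
  qed
qed

end

text \<open>a, b and -c are the roots of the energy polynomial, and the two equations are Vieta's
  relations encoding P'(s) = \<omega> - s - s^2. The lower end of \<open>alpha3_range\<close> yields
  b < a, the upper end b > 0.\<close>

lemma dnoidal_parameters:
  assumes \<omega>: "0 < \<omega>" and r: "a \<in> alpha3_range \<omega>"
  defines "b \<equiv> alpha2 \<omega> a" and "c \<equiv> - alpha1 \<omega> a"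
  shows "0 < b" "b < a" "0 < c" "a + b - c = - 3 / 2" "a * b - a * c - b * c = - 3 * \<omega>"
proof -
  have r1: "sqrt (1 + 4 * \<omega>) < 2 * a + 1" and r2: "4 * a + 3 < sqrt (48 * \<omega> + 9)"
    using r by (auto simp: alpha3_range_def field_simps)
  have "1 < sqrt (1 + 4 * \<omega>)" using \<omega> by simp
  then have a: "0 < a" using r1 by linarith
  have "(sqrt (1 + 4 * \<omega>))\<^sup>2 < (2 * a + 1)\<^sup>2" using r1 \<omega> by (intro power_strict_mono) auto
  then have i1: "\<omega> < a\<^sup>2 + a" using \<omega> by (simp add: power2_eq_square algebra_simps)
  have "(4 * a + 3)\<^sup>2 < (sqrt (48 * \<omega> + 9))\<^sup>2" using r2 a by (intro power_strict_mono) auto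
  then have i2: "16 * a\<^sup>2 + 24 * a < 48 * \<omega>" using \<omega> by (simp add: power2_eq_square algebra_simps)
  have a2: "0 < a\<^sup>2" using a by simp
  have q: "0 < dn_q \<omega> a" unfolding dn_q_def using i2 a a2 by linarith
  define R where "R = sqrt 3 * sqrt (dn_q \<omega> a)"
  have R0: "0 \<le> R" using q by (simp add: R_def)
  have R2: "R\<^sup>2 = 48 * \<omega> - 12 * a\<^sup>2 - 12 * a + 9"
    using q by (simp add: R_def power_mult_distrib) (simp add: dn_q_def)
  have bR: "b = (R - 2 * a - 3) / 4" by (simp add: b_def alpha2_def R_def)
  have cR: "c = (R + 2 * a + 3) / 4" by (simp add: c_def alpha1_def R_def field_simps)
  have "(2 * a + 3)\<^sup>2 < R\<^sup>2" unfolding R2 using i2 by (simp add: power2_eq_square algebra_simps)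
  then have "2 * a + 3 < R" using R0 by (rule power_less_imp_less_base)
  then show "0 < b" by (simp add: bR)
  have "R\<^sup>2 < (6 * a + 3)\<^sup>2" unfolding R2 using i1 by (simp add: power2_eq_square algebra_simps)
  then have "R < 6 * a + 3" by (rule power_less_imp_less_base) (use a in simp)
  then show "b < a" by (simp add: bR)
  show "0 < c" using R0 a by (simp add: cR)
  show "a + b - c = - 3 / 2" by (simp add: bR cR field_simps)
  have "a * b - a * c - b * c = - (16 * a\<^sup>2 + 24 * a + (R\<^sup>2 - (2 * a + 3)\<^sup>2)) / 16"
    by (simp add: bR cR power2_eq_square field_simps)
  then show "a * b - a * c - b * c = - 3 * \<omega>"
    unfolding R2 by (simp add: power2_eq_square field_simps)
qed

text \<open>The phase is \<theta>(x) = am(\<kappa> x) with \<kappa>^2 = a (b + c)/3. As k^2 a (b +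
  c) = c (a - b), its equation \<theta>' = \<kappa> sqrt(1 - k^2 sin^2 \<theta>) is the required
  one. One period of the wave is half a turn of the phase: \<kappa> L = 2 K(k).\<close>

lemma dnoidal_periodic_wave:
  assumes L: "0 < L" and \<omega>: "0 < \<omega>" and r: "a \<in> alpha3_range \<omega>" and per: "dnoidal_period \<omega> a = L"
  obtains \<phi>1 where "periodic_wave a (alpha2 \<omega> a) (- alpha1 \<omega> a) L (dnoidal \<omega> a) \<phi>1"
proof -
  define b c where "b = alpha2 \<omega> a" and "c = - alpha1 \<omega> a"
  note P = dnoidal_parameters[OF \<omega> r, folded b_def c_def]
  define X where "X = a * (b + c)"
  have X: "0 < X" using P by (simp add: X_def)
  have al: "alpha2 \<omega> a - alpha1 \<omega> a = b + c" by (simp add: b_def c_def)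
  define k where "k = dn_k \<omega> a"
  have ksq: "k = sqrt (c * (a - b) / X)"
    unfolding k_def dn_k_def al X_def[symmetric] by (simp add: b_def c_def)
  have knn: "0 \<le> c * (a - b) / X" using P X by simp
  then have k2: "k\<^sup>2 = c * (a - b) / X" by (simp add: ksq)
  have cX: "c * (a - b) < X" using P by (simp add: X_def algebra_simps add_pos_pos)
  have k: "0 \<le> k" "k < 1"
  proof -
    show "0 \<le> k" using knn by (simp add: ksq)
    have "k\<^sup>2 < 1\<^sup>2" using cX X by (simp add: k2)
    then show "k < 1" by (rule power_less_imp_less_base) simp
  qed
  define \<kappa> where "\<kappa> = sqrt (X / 3)"
  have g: "2 / (sqrt 3 * dn_g \<omega> a) = \<kappa>"
    unfolding dn_g_def al X_def[symmetric] \<kappa>_def using X by (simp add: real_sqrt_divide)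
  have \<kappa>: "0 < \<kappa>" using X by (simp add: \<kappa>_def)
  have L\<kappa>: "\<kappa> * L = 2 * ellK k"
    unfolding per[symmetric] dnoidal_period_def al X_def[symmetric] k_def[symmetric] \<kappa>_def
    using X by (simp add: real_sqrt_divide)
  define \<theta> where "\<theta> x = jacobi_am (\<kappa> * x) k" for x
  have "\<exists>\<phi>1. periodic_wave a b c L (dnoidal \<omega> a) \<phi>1"
  proof (rule periodic_wave_of_phase[of b a c L \<theta>])
    fix x
    have "(\<theta> has_real_derivative sqrt (1 - k\<^sup>2 * (sin (\<theta> x))\<^sup>2) * \<kappa>) (at x)"
      unfolding \<theta>_def by (rule DERIV_chain2[OF am_deriv[OF k]]) (auto intro!: derivative_eq_intros)
    moreover have "sqrt (1 - k\<^sup>2 * (sin (\<theta> x))\<^sup>2) * \<kappa> = sqrt ((a * (b + c) - c * (a - b) * (sin (\<theta> x))\<^sup>2) / 3)"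
      unfolding \<kappa>_def real_sqrt_mult[symmetric] k2 X_def[symmetric] using X by (simp add: field_simps)
    ultimately show "(\<theta> has_real_derivative sqrt ((a * (b + c) - c * (a - b) * (sin (\<theta> x))\<^sup>2) / 3)) (at x)" by simp
    show "\<theta> (- x) = - \<theta> x" using am_minus[OF k, of "\<kappa> * x"] by (simp add: \<theta>_def)
    show "\<theta> (x + L) = \<theta> x + pi"
      using am_add_period[OF k, of "\<kappa> * x"] L\<kappa> by (simp add: \<theta>_def distrib_left)
    define S where "S = (sin (\<theta> x))\<^sup>2"
    have beta: "dn_beta2 \<omega> a = (a - b) / (b + c)"
    proof -
      have "alpha1 \<omega> a = - c" by (simp add: c_def)
      then show ?thesis
        unfolding dn_beta2_def k_def[symmetric] k2 X_def using P by simp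
    qed
    have "dnoidal \<omega> a x = sqrt a * sqrt (1 - k\<^sup>2 * S) / sqrt (1 + (a - b) / (b + c) * S)"
      unfolding dnoidal_def Let_def g beta jacobi_dn_def jacobi_sn_def k_def[symmetric] by (simp add: S_def \<theta>_def)
    also have "\<dots> = sqrt (a * (1 - k\<^sup>2 * S) / (1 + (a - b) / (b + c) * S))"
      by (simp add: real_sqrt_mult real_sqrt_divide)
    also have "a * (1 - k\<^sup>2 * S) = (X - c * (a - b) * S) / (b + c)"
      using P X unfolding k2 by (simp add: X_def field_simps)
    also have "1 + (a - b) / (b + c) * S = (b + c + (a - b) * S) / (b + c)"
      using P by (simp add: field_simps)
    also have "(X - c * (a - b) * S) / (b + c) / ((b + c + (a - b) * S) / (b + c)) = (X - c * (a - b) * S) / (b + c + (a - b) * S)"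
      using P by simp
    finally show "dnoidal \<omega> a x = sqrt ((a * (b + c) - c * (a - b) * (sin (\<theta> x))\<^sup>2) / (b + c + (a - b) * (sin (\<theta> x))\<^sup>2))"
      by (simp add: S_def X_def)
  next
    show "\<theta> 0 = 0" using am_0[OF k] by (simp add: \<theta>_def)
    have "\<kappa> * (L / 2) = ellK k" using L\<kappa> by simp
    then show "\<theta> (L / 2) = pi / 2" using am_ellK[OF k] by (simp add: \<theta>_def)
    show "\<theta> x < \<theta> y" if "x < y" for x y
      unfolding \<theta>_def by (rule am_mono[OF k]) (use that \<kappa> in simp)
  qed (use P L in auto)
  then show ?thesis using that unfolding b_def c_def by blast
qed

lemma omegaL_pos: "0 < L \<Longrightarrow> 0 < omegaL L"
proof -
  assume L: "0 < L"
  have "L \<le> sqrt (L\<^sup>2 + 16 * pi\<^sup>2)" by (rule real_le_rsqrt) simp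
  then have "1 \<le> sqrt (L\<^sup>2 + 16 * pi\<^sup>2) / L" using L by simp
  moreover have "0 < 8 * pi\<^sup>2 / L\<^sup>2" using L by simp
  ultimately show ?thesis by (simp add: omegaL_def)
qed

text \<open>At s = \<phi>^2 this identifies \<open>V2\<close> and \<open>V1\<close> with the
  potentials of the linearized operator.\<close>

lemma wave_P_cubic_quintic:
  assumes "a + b - c = - 3 / 2" "a * b - a * c - b * c = - 3 * \<omega>"
  shows "wave_P1 a b c s = \<omega> - s - s\<^sup>2" "wave_P1 a b c s + 2 * s * wave_P2 a b c s = \<omega> - 3 * s - 5 * s\<^sup>2"
proof -
  have "3 * wave_P1 a b c s = - 3 * s\<^sup>2 + 2 * (a + b - c) * s - (a * b - a * c - b * c)"
    by (simp add: wave_P1_def power2_eq_square field_simps)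
  then show 1: "wave_P1 a b c s = \<omega> - s - s\<^sup>2" unfolding assms by (simp add: field_simps)
  have 2: "wave_P2 a b c s = - 1 - 2 * s" unfolding wave_P2_def assms(1) by (simp add: field_simps)
  then show "wave_P1 a b c s + 2 * s * wave_P2 a b c s = \<omega> - 3 * s - 5 * s\<^sup>2"
    unfolding 1 2 by (simp add: power2_eq_square algebra_simps)
qed

section \<open>From scalar equations to the diagonal operator\<close>

lemma continuous_AE_zero:
  fixes f :: "real \<Rightarrow> complex"
  assumes f: "continuous_on {0..L} f" and L: "0 < L" and ae: "AE x in lborel. x \<in> {0..L} \<longrightarrow> f x = 0"
    and x: "x \<in> {0..L}"
  shows "f x = 0"
proof (rule has_integral_cmod_sq_eq_0[OF _ f L x])
  have c: "continuous_on {0..L} (\<lambda>x. f x * cnj (f x))" by (intro continuous_intros f)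
  have "integral {0..L} (\<lambda>x. f x * cnj (f x)) = integral {0..L} (\<lambda>x. 0)"
  proof (rule integral_cong_AE_Icc[of L])
    show "AE x in lborel. x \<in> {0..L} \<longrightarrow> f x * cnj (f x) = 0" using ae by eventually_elim simp
  qed (use L in \<open>auto intro: set_integrable_continuous c\<close>)
  then have "integral {0..L} (\<lambda>x. f x * cnj (f x)) = 0" by simp
  then show "((\<lambda>x. f x * cnj (f x)) has_integral 0) {0..L}"
    using integrable_integral[OF integrable_continuous_real[OF c]] by simp
qed

lemma AE_zero_coefficient:
  fixes f :: "real \<Rightarrow> complex"
  assumes f: "continuous_on {0..L} f" and L: "0 < L" and ae: "AE x in lborel. k * f x = 0"
    and x: "x \<in> {0..L}" "f x \<noteq> 0"
  shows "k = 0"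
proof -
  have "k * f x = 0"
    by (rule continuous_AE_zero[OF _ L _ x(1)]) (use ae in \<open>auto intro!: continuous_intros f elim: eventually_mono\<close>)
  then show ?thesis using x(2) by simp
qed

lemma schr_ker_zero:
  assumes "continuous_on {0..L} V" "\<And>x. V (x + L) = V x" "0 < L"
  shows "(\<lambda>x. 0) \<in> schr_ker L V \<mu>"
proof -
  have "hill_sol (\<lambda>x. of_real (V x) - \<mu>) (\<lambda>x. 0) L (\<lambda>x. 0) (\<lambda>x. 0)" by (simp add: hill_sol_def)
  from hill_sol_imp_schr_ker[OF assms this] show ?thesis by (simp add: per_ext_def[abs_def])
qed

text \<open>Transfers a spanning statement for classical periodic solutions to almost-everywhere
  classes; Y = 0 is allowed and covers a trivial kernel.\<close>

lemma schr_ker_span: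
  assumes V: "continuous_on {0..L} V" and L: "0 < L"
    and span: "\<forall>U U1. hill_sol (\<lambda>x. of_real (V x) - \<mu>) (\<lambda>x. 0) L U U1 \<and> U L = U 0 \<and> U1 L = U1 0 \<longrightarrow>
      (\<exists>k. \<forall>x\<in>{0..L}. U x = k * Y x)"
    and u: "u \<in> schr_ker L V \<mu>"
  obtains k where "AE x in lborel. u x = k * per_ext L Y x"
proof -
  obtain U U1 where U: "hill_sol (\<lambda>x. of_real (V x) - \<mu>) (\<lambda>x. 0) L U U1" "U L = U 0" "U1 L = U1 0"
    and ae: "AE x in lborel. u x = per_ext L U x"
    using schr_ker_imp_hill_sol[OF V L u] by blast
  obtain k where k: "\<And>x. x \<in> {0..L} \<Longrightarrow> U x = k * Y x" using span U by blast
  have "per_ext L U x = k * per_ext L Y x" for x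
    unfolding per_ext_def by (rule k) (use per_rem_bounds[OF L, of x] in auto)
  with ae that show ?thesis by simp
qed

lemma per_eig_schr_ker:
  assumes V: "continuous_on {0..L} V" "\<And>x. V (x + L) = V x" and L: "0 < L" and e: "per_eig V L \<mu>"
  obtains u where "u \<in> schr_ker L V \<mu>" "\<not> (AE x in lborel. u x = 0)"
proof -
  obtain U U1 where U: "hill_sol (\<lambda>x. of_real (V x) - \<mu>) (\<lambda>x. 0) L U U1" "U L = U 0" "U1 L = U1 0"
    "(U 0, U1 0) \<noteq> (0, 0)"
    using e unfolding per_eig_def by blast
  have "\<not> (AE x in lborel. per_ext L U x = 0)"
  proof
    assume ae: "AE x in lborel. per_ext L U x = 0"
    have "AE x in lborel. x \<in> {0..L} \<longrightarrow> U x = 0"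
      using ae by eventually_elim (use per_ext_eq[OF L U(2)] in auto)
    then have z: "U x = 0" if "x \<in> {0..L}" for x
      using continuous_AE_zero[OF hill_sol_continuous(1)[OF U(1)] L _ that] by blast
    have "U1 0 = 0" using hill_sol_zero_deriv[OF U(1) L z, of 0] L by simp
    with z[of 0] L U(4) show False by simp
  qed
  then show ?thesis using that hill_sol_imp_schr_ker[OF V L U(1-3)] by blast
qed

definition pair_op :: "real \<Rightarrow> (real \<Rightarrow> real) \<Rightarrow> (real \<Rightarrow> real) \<Rightarrow> cpair \<Rightarrow> cpair" where
  "pair_op L V W U = (schroedinger L V (fst U), schroedinger L W (snd U))"

lemma pair_aeq_iff: "U =\<^sub>a\<^sub>e V \<longleftrightarrow> (AE x in lborel. fst U x = fst V x) \<and> (AE x in lborel. snd U x = snd V x)"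
  by (simp add: pair_aeq_def AE_conj_iff)

lemma eigenspace_pair_op:
  "U \<in> eigenspace L (pair_op L V W) \<mu> \<longleftrightarrow> fst U \<in> schr_ker L V \<mu> \<and> snd U \<in> schr_ker L W \<mu>"
  by (auto simp: eigenspace_def schr_ker_def pair_aeq_iff op_minus_def pair_op_def pair_zero_def HH2per_def mem_Times_iff)

lemma is_eigenvalue_pair_op:
  assumes V: "continuous_on {0..L} V" "\<And>x. V (x + L) = V x"
    and W: "continuous_on {0..L} W" "\<And>x. W (x + L) = W x" and L: "0 < L"
    and e: "per_eig V L \<mu> \<or> per_eig W L \<mu>"
  shows "is_eigenvalue L (pair_op L V W) \<mu>"
  using e
proof
  assume "per_eig V L \<mu>"
  then obtain u where u: "u \<in> schr_ker L V \<mu>" "\<not> (AE x in lborel. u x = 0)"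
    using per_eig_schr_ker[OF V L] by blast
  show ?thesis unfolding is_eigenvalue_def
    by (rule bexI[of _ "(u, \<lambda>x. 0)"])
      (use u schr_ker_zero[OF W L] in \<open>auto simp: eigenspace_pair_op pair_aeq_iff pair_zero_def\<close>)
next
  assume "per_eig W L \<mu>"
  then obtain u where u: "u \<in> schr_ker L W \<mu>" "\<not> (AE x in lborel. u x = 0)"
    using per_eig_schr_ker[OF W L] by blast
  show ?thesis unfolding is_eigenvalue_def
    by (rule bexI[of _ "(\<lambda>x. 0, u)"])
      (use u schr_ker_zero[OF V L] in \<open>auto simp: eigenspace_pair_op pair_aeq_iff pair_zero_def\<close>)
qed

lemma resolvent_pair_op:
  assumes V: "continuous_on UNIV V" "\<And>x. V (x + L) = V x"
    and W: "continuous_on UNIV W" "\<And>x. W (x + L) = W x" and L: "0 < L"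
    and ne: "\<not> per_eig V L \<mu>" "\<not> per_eig W L \<mu>"
  shows "\<mu> \<in> resolvent_set L (pair_op L V W)"
proof -
  let ?T = "pair_op L V W"
  have op: "fst (op_minus ?T \<mu> U) = (\<lambda>x. schroedinger L V (fst U) x - \<mu> * fst U x)"
    "snd (op_minus ?T \<mu> U) = (\<lambda>x. schroedinger L W (snd U) x - \<mu> * snd U x)" for U
    by (simp_all add: op_minus_def pair_op_def)
  obtain C where C: "0 \<le> C"
    "\<And>F. F \<in> L2per L \<Longrightarrow> \<exists>u\<in>H2per L. AE x in lborel. schroedinger L V u x - \<mu> * u x = F x"
    "\<And>u u'. u \<in> H2per L \<Longrightarrow> u' \<in> H2per L \<Longrightarrow>
       AE x in lborel. schroedinger L V u x - \<mu> * u x = schroedinger L V u' x - \<mu> * u' x \<Longrightarrow> AE x in lborel. u x = u' x"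
    "\<And>u. u \<in> H2per L \<Longrightarrow> (LINT x:{0..L}|lborel. (cmod (u x))\<^sup>2) \<le>
       C * (LINT x:{0..L}|lborel. (cmod (schroedinger L V u x - \<mu> * u x))\<^sup>2)"
    using schroedinger_resolvent[OF V L ne(1)] by blast
  obtain D where D: "0 \<le> D"
    "\<And>F. F \<in> L2per L \<Longrightarrow> \<exists>u\<in>H2per L. AE x in lborel. schroedinger L W u x - \<mu> * u x = F x"
    "\<And>u u'. u \<in> H2per L \<Longrightarrow> u' \<in> H2per L \<Longrightarrow>
       AE x in lborel. schroedinger L W u x - \<mu> * u x = schroedinger L W u' x - \<mu> * u' x \<Longrightarrow> AE x in lborel. u x = u' x"
    "\<And>u. u \<in> H2per L \<Longrightarrow> (LINT x:{0..L}|lborel. (cmod (u x))\<^sup>2) \<le>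
       D * (LINT x:{0..L}|lborel. (cmod (schroedinger L W u x - \<mu> * u x))\<^sup>2)"
    using schroedinger_resolvent[OF W L ne(2)] by blast
  have "op_minus ?T \<mu> U \<in> LL2per L" if "U \<in> HH2per L" for U
    using schroedinger_L2per[OF V L, of "fst U" \<mu>] schroedinger_L2per[OF W L, of "snd U" \<mu>] that
    by (simp add: LL2per_def HH2per_def mem_Times_iff op)
  moreover have "\<exists>U\<in>HH2per L. op_minus ?T \<mu> U =\<^sub>a\<^sub>e F \<and>
        (\<forall>U'\<in>HH2per L. op_minus ?T \<mu> U' =\<^sub>a\<^sub>e F \<longrightarrow> U' =\<^sub>a\<^sub>e U)" if F: "F \<in> LL2per L" for F
  proof -
    have F': "fst F \<in> L2per L" "snd F \<in> L2per L" using F by (auto simp: LL2per_def mem_Times_iff)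
    obtain u where u: "u \<in> H2per L" "AE x in lborel. schroedinger L V u x - \<mu> * u x = fst F x" using C(2)[OF F'(1)] by blast
    obtain w where w: "w \<in> H2per L" "AE x in lborel. schroedinger L W w x - \<mu> * w x = snd F x" using D(2)[OF F'(2)] by blast
    show ?thesis
    proof (rule bexI[of _ "(u, w)"], intro conjI ballI impI)
      show "(u, w) \<in> HH2per L" using u w by (simp add: HH2per_def)
      show "op_minus ?T \<mu> (u, w) =\<^sub>a\<^sub>e F" using u w by (simp add: pair_aeq_iff op)
      fix U' assume U': "U' \<in> HH2per L" "op_minus ?T \<mu> U' =\<^sub>a\<^sub>e F"
      have "AE x in lborel. schroedinger L V (fst U') x - \<mu> * fst U' x = schroedinger L V u x - \<mu> * u x"
        "AE x in lborel. schroedinger L W (snd U') x - \<mu> * snd U' x = schroedinger L W w x - \<mu> * w x"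
        using U'(2) u(2) w(2) unfolding pair_aeq_iff op by (auto elim: eventually_elim2)
      then show "U' =\<^sub>a\<^sub>e (u, w)"
        using C(3)[of "fst U'" u] D(3)[of "snd U'" w] U'(1) u(1) w(1)
        by (simp add: pair_aeq_iff HH2per_def mem_Times_iff)
    qed
  qed
  moreover have "\<exists>K. \<forall>U\<in>HH2per L. LL2norm L U \<le> K * LL2norm L (op_minus ?T \<mu> U)"
  proof (rule exI[of _ "sqrt (C + D)"], rule ballI)
    fix U assume U: "U \<in> HH2per L"
    define n1 n2 m1 m2 where "n1 = (LINT x:{0..L}|lborel. (cmod (fst U x))\<^sup>2)"
      and "n2 = (LINT x:{0..L}|lborel. (cmod (snd U x))\<^sup>2)"
      and "m1 = (LINT x:{0..L}|lborel. (cmod (schroedinger L V (fst U) x - \<mu> * fst U x))\<^sup>2)"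
      and "m2 = (LINT x:{0..L}|lborel. (cmod (schroedinger L W (snd U) x - \<mu> * snd U x))\<^sup>2)"
    have m: "0 \<le> m1" "0 \<le> m2" unfolding m1_def m2_def set_lebesgue_integral_def by (auto intro!: integral_nonneg_AE)
    have "n1 \<le> C * m1" "n2 \<le> D * m2"
      using C(4)[of "fst U"] D(4)[of "snd U"] U by (auto simp: n1_def n2_def m1_def m2_def HH2per_def mem_Times_iff)
    then have "n1 + n2 \<le> C * m1 + D * m2" by simp
    also have "\<dots> \<le> (C + D) * (m1 + m2)" using C(1) D(1) m by (simp add: algebra_simps)
    finally have "sqrt (n1 + n2) \<le> sqrt ((C + D) * (m1 + m2))" by simp
    then show "LL2norm L U \<le> sqrt (C + D) * LL2norm L (op_minus ?T \<mu> U)"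
      by (simp add: LL2norm_def op n1_def n2_def m1_def m2_def real_sqrt_mult)
  qed
  ultimately show ?thesis unfolding resolvent_set_def by blast
qed

lemma pair_lincomb_1: "pair_lincomb c [p] = (\<lambda>x. c 0 * fst p x, \<lambda>x. c 0 * snd p x)"
  by (simp add: pair_lincomb_def)

lemma pair_lincomb_2: "pair_lincomb c [p, q] =
    (\<lambda>x. c 0 * fst p x + c 1 * fst q x, \<lambda>x. c 0 * snd p x + c 1 * snd q x)"
  by (simp add: pair_lincomb_def)

theorem theorem4p1:
  fixes L \<omega> \<alpha>3 :: real and \<phi> :: "real \<Rightarrow> real"
  assumes "L > 0"
    and "\<omega> > omegaL L"
    and "\<alpha>3 \<in> alpha3_range \<omega>"
    and "dnoidal_period \<omega> \<alpha>3 = L"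
    and "\<phi> = dnoidal \<omega> \<alpha>3"
  shows "\<exists>\<nu>0 :: real.
      \<nu>0 < 0 \<and>
      (\<forall>\<nu> :: real. \<nu> < 0 \<and> is_eigenvalue L (lin_op L \<omega> \<phi>) (complex_of_real \<nu>) \<longleftrightarrow> \<nu> = \<nu>0) \<and>
      has_multiplicity L (lin_op L \<omega> \<phi>) (complex_of_real \<nu>0) 1 \<and>
      has_multiplicity L (lin_op L \<omega> \<phi>) 0 2 \<and>
      is_basis_ae [(\<lambda>x. complex_of_real (deriv \<phi> x), \<lambda>x. 0), (\<lambda>x. 0, \<lambda>x. complex_of_real (\<phi> x))]
        (eigenspace L (lin_op L \<omega> \<phi>) 0) \<and>
      (let R = op_spectrum L (lin_op L \<omega> \<phi>) - {complex_of_real \<nu>0, 0} in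
        (\<forall>\<mu>\<in>R. is_eigenvalue L (lin_op L \<omega> \<phi>) \<mu>) \<and>
        R sparse_in UNIV \<and>
        (\<exists>\<delta>>0. \<forall>\<mu>\<in>R. \<delta> \<le> cmod \<mu>))"
proof -
  have \<omega>: "0 < \<omega>" using omegaL_pos[OF assms(1)] assms(2) by linarith
  define b c where "b = alpha2 \<omega> \<alpha>3" and "c = - alpha1 \<omega> \<alpha>3"
  obtain \<phi>1 where "periodic_wave \<alpha>3 b c L \<phi> \<phi>1"
    using dnoidal_periodic_wave[OF assms(1) \<omega> assms(3,4)] unfolding assms(5) b_def c_def by blast
  then interpret periodic_wave \<alpha>3 b c L \<phi> \<phi>1 .
  note rel = dnoidal_parameters(4,5)[OF \<omega> assms(3), folded b_def c_def]
  have V1: "V1 = (\<lambda>x. \<omega> - 3 * \<phi> x ^ 2 - 5 * \<phi> x ^ 4)"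
    using wave_P_cubic_quintic(2)[OF rel] by (auto simp: V1_def)
  have V2: "V2 = (\<lambda>x. \<omega> - \<phi> x ^ 2 - \<phi> x ^ 4)"
    using wave_P_cubic_quintic(1)[OF rel] by (auto simp: V2_def)
  define T where "T = pair_op L V1 V2"
  have T: "lin_op L \<omega> \<phi> = T"
    unfolding T_def V1 V2 by (rule ext) (simp add: lin_op_def pair_op_def)
  note Vc = V_continuous(1)[of "{0..L}"] V_continuous(2)[of "{0..L}"]
  have \<phi>1c: "continuous_on {0..L} \<phi>1"
    by (rule continuous_at_imp_continuous_on) (use DERIV_isCont[OF deriv2] in blast)
  obtain \<nu>0 Y Y1 where neg: "\<nu>0 < 0" and Y: "rsol V1 \<nu>0 L Y Y1" "Y L = Y 0" "Y1 L = Y1 0" "Y 0 = 1"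
    and uniq: "\<And>\<nu> u v. \<nu> < 0 \<Longrightarrow> hill_sol (\<lambda>x. of_real (V1 x) - of_real \<nu>) (\<lambda>x. 0) L u v \<Longrightarrow> u L = u 0 \<Longrightarrow> v L = v 0 \<Longrightarrow>
       (\<forall>x\<in>{0..L}. u x = 0) \<or> \<nu> = \<nu>0 \<and> (\<exists>k. \<forall>x\<in>{0..L}. u x = k * of_real (Y x))"
    using negative_V1 by blast
  define u0 where "u0 = per_ext L (\<lambda>x. complex_of_real (Y x))"
  have u0: "u0 \<in> schr_ker L V1 (of_real \<nu>0)"
    unfolding u0_def by (rule hill_sol_imp_schr_ker[OF Vc(1) V_periodic(1) L hill_sol_of_rsol[OF Y(1)]]) (use Y in auto)
  have z2: "(\<lambda>x. 0) \<in> schr_ker L V2 \<mu>" and z1: "(\<lambda>x. 0) \<in> schr_ker L V1 \<mu>" for \<mu>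
    using schr_ker_zero[OF Vc(2) V_periodic(2) L] schr_ker_zero[OF Vc(1) V_periodic(1) L] by blast+
  have ker2neg: "AE x in lborel. u x = 0" if \<nu>: "\<nu> < 0" and u: "u \<in> schr_ker L V2 (of_real \<nu>)" for \<nu> u
  proof -
    have "\<forall>U U1. hill_sol (\<lambda>x. of_real (V2 x) - of_real \<nu>) (\<lambda>x. 0) L U U1 \<and> U L = U 0 \<and> U1 L = U1 0 \<longrightarrow>
        (\<exists>k. \<forall>x\<in>{0..L}. U x = k * (\<lambda>x. 0) x)"
    proof (intro allI impI, elim conjE)
      fix U U1 assume "hill_sol (\<lambda>x. of_real (V2 x) - of_real \<nu>) (\<lambda>x. 0) L U U1" "U L = U 0" "U1 L = U1 0"
      from kernel_V2(2)[OF this less_imp_le[OF \<nu>] \<nu>] show "\<exists>k. \<forall>x\<in>{0..L}. U x = k * (\<lambda>x. 0) x" by simp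
    qed
    from schr_ker_span[OF Vc(2) L this u]
    obtain k where "AE x in lborel. u x = k * per_ext L (\<lambda>x. 0) x" by blast
    then show ?thesis by (simp add: per_ext_def)
  qed
  have ker1neg: "(AE x in lborel. u x = 0) \<or> \<nu> = \<nu>0 \<and> (\<exists>k. AE x in lborel. u x = k * u0 x)"
    if \<nu>: "\<nu> < 0" and u: "u \<in> schr_ker L V1 (of_real \<nu>)" for \<nu> u
  proof -
    \<comment> \<open>The value 0 at levels other than \<nu>0 lets one spanning function express
      both the simplicity of \<nu>0 and the absence of further negative eigenvalues.\<close>
    define Z where "Z x = (if \<nu> = \<nu>0 then complex_of_real (Y x) else 0)" for x
    have "\<forall>U U1. hill_sol (\<lambda>x. of_real (V1 x) - of_real \<nu>) (\<lambda>x. 0) L U U1 \<and> U L = U 0 \<and> U1 L = U1 0 \<longrightarrow>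
        (\<exists>k. \<forall>x\<in>{0..L}. U x = k * Z x)"
    proof (intro allI impI, elim conjE)
      fix U U1 assume U: "hill_sol (\<lambda>x. of_real (V1 x) - of_real \<nu>) (\<lambda>x. 0) L U U1" "U L = U 0" "U1 L = U1 0"
      from uniq[OF \<nu> U] show "\<exists>k. \<forall>x\<in>{0..L}. U x = k * Z x"
      proof
        assume "\<forall>x\<in>{0..L}. U x = 0"
        then show ?thesis by (intro exI[of _ 0]) simp
      next
        assume "\<nu> = \<nu>0 \<and> (\<exists>k. \<forall>x\<in>{0..L}. U x = k * of_real (Y x))"
        then show ?thesis by (simp add: Z_def)
      qed
    qed
    from schr_ker_span[OF Vc(1) L this u]
    obtain k where k: "AE x in lborel. u x = k * per_ext L Z x" by blast
    show ?thesis
    proof (cases "\<nu> = \<nu>0")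
      case True
      then have "per_ext L Z = u0" by (auto simp: u0_def per_ext_def Z_def)
      with k have "AE x in lborel. u x = k * u0 x" by simp
      then show ?thesis using True by blast
    next
      case False
      then have "per_ext L Z = (\<lambda>x. 0)" by (auto simp: per_ext_def Z_def)
      then show ?thesis using k by simp
    qed
  qed
  have Yc: "continuous_on {0..L} (\<lambda>x. complex_of_real (Y x))"
    by (intro continuous_intros rsol_continuous(1)[OF Y(1)])
  have u0_coeff: "k = 0" if "AE x in lborel. k * u0 x = 0" for k
  proof -
    have "continuous_on {0..L} u0"
      by (rule continuous_on_eq[OF Yc]) (use Y(2) L in \<open>auto simp: u0_def per_ext_eq\<close>)
    moreover have "u0 0 \<noteq> 0" using Y(2,4) L by (simp add: u0_def per_ext_eq)
    ultimately show ?thesis using AE_zero_coefficient[OF _ L that, of 0] L by simp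
  qed
  have eigneg: "\<nu> < 0 \<and> is_eigenvalue L T (of_real \<nu>) \<longleftrightarrow> \<nu> = \<nu>0" for \<nu>
  proof
    assume \<nu>: "\<nu> < 0 \<and> is_eigenvalue L T (of_real \<nu>)"
    then obtain U where UE: "U \<in> eigenspace L T (of_real \<nu>)" and nz: "\<not> U =\<^sub>a\<^sub>e pair_zero"
      unfolding is_eigenvalue_def by blast
    have U: "fst U \<in> schr_ker L V1 (of_real \<nu>)" "snd U \<in> schr_ker L V2 (of_real \<nu>)"
      using UE by (simp_all add: T_def eigenspace_pair_op)
    have "AE x in lborel. snd U x = 0" using ker2neg U(2) \<nu> by blast
    with nz have "\<not> (AE x in lborel. fst U x = 0)" unfolding pair_aeq_iff pair_zero_def fst_conv snd_conv by blast
    with ker1neg[of \<nu> "fst U"] U(1) \<nu> show "\<nu> = \<nu>0" by blast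
  next
    assume "\<nu> = \<nu>0"
    moreover have "\<not> (u0, \<lambda>x. 0) =\<^sub>a\<^sub>e pair_zero"
      using u0_coeff[of 1] by (auto simp: pair_aeq_iff pair_zero_def)
    then have "is_eigenvalue L T (of_real \<nu>0)"
      unfolding is_eigenvalue_def T_def using u0 z2 by (intro bexI[of _ "(u0, \<lambda>x. 0)"]) (auto simp: eigenspace_pair_op)
    ultimately show "\<nu> < 0 \<and> is_eigenvalue L T (of_real \<nu>)" using neg by simp
  qed
  have "is_basis_ae [(u0, \<lambda>x. 0)] (eigenspace L T (of_real \<nu>0))"
    unfolding is_basis_ae_def
  proof (intro conjI allI impI ballI)
    show "set [(u0, \<lambda>x. 0)] \<subseteq> eigenspace L T (of_real \<nu>0)"
      using u0 z2 by (simp add: T_def eigenspace_pair_op)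
    show "k i = 0" if "pair_lincomb k [(u0, \<lambda>x. 0)] =\<^sub>a\<^sub>e pair_zero" "i < length [(u0, \<lambda>x::real. 0::complex)]" for k i
    proof -
      have "AE x in lborel. k 0 * u0 x = 0"
        using that(1) unfolding pair_lincomb_1 pair_aeq_iff pair_zero_def fst_conv snd_conv by blast
      then have "k 0 = 0" by (rule u0_coeff)
      then show ?thesis using that(2) by simp
    qed
    fix U assume "U \<in> eigenspace L T (of_real \<nu>0)"
    then have U: "fst U \<in> schr_ker L V1 (of_real \<nu>0)" "snd U \<in> schr_ker L V2 (of_real \<nu>0)"
      by (simp_all add: T_def eigenspace_pair_op)
    have "\<exists>k. AE x in lborel. fst U x = k * u0 x"
      using ker1neg[OF neg U(1)]
    proof (elim disjE conjE)
      assume "AE x in lborel. fst U x = 0"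
      then show ?thesis by (intro exI[of _ 0]) simp
    qed
    then obtain k where "AE x in lborel. fst U x = k * u0 x" by blast
    then show "\<exists>k. U =\<^sub>a\<^sub>e pair_lincomb k [(u0, \<lambda>x. 0)]"
      using ker2neg[OF neg U(2)] by (intro exI[of _ "\<lambda>i. k"]) (simp add: pair_lincomb_1 pair_aeq_iff)
  qed
  then have mult1: "has_multiplicity L T (of_real \<nu>0) 1"
    unfolding has_multiplicity_def by (intro exI[of _ "[(u0, \<lambda>x. 0)]"]) simp
  define f where "f x = complex_of_real (\<phi>1 x)" for x
  define g where "g x = complex_of_real (\<phi> x)" for x
  have fp: "per_ext L f = f" and gp: "per_ext L g = g"
    by (rule per_ext_self, simp add: f_def \<phi>1_periodic, rule per_ext_self, simp add: g_def periodic)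
  have fL: "f L = f 0" "g L = g 0" "\<phi>2 L = \<phi>2 0" "\<phi>1 L = \<phi>1 0"
    using \<phi>1_periodic[of 0] periodic[of 0] \<phi>2_periodic[of 0] by (simp_all add: f_def g_def)
  have fker: "f \<in> schr_ker L V1 (of_real 0)"
    using hill_sol_imp_schr_ker[OF Vc(1) V_periodic(1) L hill_sol_of_rsol[OF rsol_\<phi>1]] fL
    unfolding f_def[symmetric] fp by simp
  have gker: "g \<in> schr_ker L V2 (of_real 0)"
    using hill_sol_imp_schr_ker[OF Vc(2) V_periodic(2) L hill_sol_of_rsol[OF rsol_\<phi>]] fL
    unfolding g_def[symmetric] gp by simp
  \<comment> \<open>L/4 lies inside the half period, where \<phi>' < 0.\<close>
  have f_coeff: "k = 0" if "AE x in lborel. k * f x = 0" for k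
    by (rule AE_zero_coefficient[OF _ L that, of "L / 4"])
      (use L decreasing[of "L / 4"] in \<open>auto simp: f_def intro!: continuous_intros \<phi>1c\<close>)
  have g_coeff: "k = 0" if "AE x in lborel. k * g x = 0" for k
    by (rule AE_zero_coefficient[OF _ L that, of 0])
      (use L pos[of 0] in \<open>auto simp: g_def intro!: continuous_intros \<phi>_continuous\<close>)
  have basis0: "is_basis_ae [(f, \<lambda>x. 0), (\<lambda>x. 0, g)] (eigenspace L T 0)"
    unfolding is_basis_ae_def
  proof (intro conjI allI impI ballI)
    show "set [(f, \<lambda>x. 0), (\<lambda>x. 0, g)] \<subseteq> eigenspace L T 0"
      using fker gker z1 z2 by (simp add: T_def eigenspace_pair_op)
    show "k i = 0" if "pair_lincomb k [(f, \<lambda>x. 0), (\<lambda>x. 0, g)] =\<^sub>a\<^sub>e pair_zero"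
      "i < length [(f, \<lambda>x::real. 0::complex), (\<lambda>x. 0, g)]" for k i
    proof -
      have "AE x in lborel. k 0 * f x + k 1 * 0 = 0" "AE x in lborel. k 0 * 0 + k 1 * g x = 0"
        using that(1) unfolding pair_lincomb_2 pair_aeq_iff pair_zero_def fst_conv snd_conv by blast+
      then have "AE x in lborel. k 0 * f x = 0" "AE x in lborel. k 1 * g x = 0"
        by (simp_all only: mult_zero_right add_0_right add_0_left)
      then have "k 0 = 0" "k 1 = 0" using f_coeff g_coeff by blast+
      moreover have "i = 0 \<or> i = 1" using that(2) by auto
      ultimately show ?thesis by auto
    qed
    fix U assume "U \<in> eigenspace L T 0"
    then have U: "fst U \<in> schr_ker L V1 (of_real 0)" "snd U \<in> schr_ker L V2 (of_real 0)"
      by (simp_all add: T_def eigenspace_pair_op)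
    have "\<forall>W W1. hill_sol (\<lambda>x. of_real (V1 x) - of_real 0) (\<lambda>x. 0) L W W1 \<and> W L = W 0 \<and> W1 L = W1 0 \<longrightarrow>
        (\<exists>k. \<forall>x\<in>{0..L}. W x = k * f x)"
      unfolding f_def using kernel_V1 by blast
    from schr_ker_span[OF Vc(1) L this U(1)]
    obtain p where p: "AE x in lborel. fst U x = p * per_ext L f x" by blast
    have "\<forall>W W1. hill_sol (\<lambda>x. of_real (V2 x) - of_real 0) (\<lambda>x. 0) L W W1 \<and> W L = W 0 \<and> W1 L = W1 0 \<longrightarrow>
        (\<exists>k. \<forall>x\<in>{0..L}. W x = k * g x)"
      unfolding g_def using kernel_V2(1)[OF _ _ _ order_refl refl] by blast
    from schr_ker_span[OF Vc(2) L this U(2)]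
    obtain q where q: "AE x in lborel. snd U x = q * per_ext L g x" by blast
    show "\<exists>k. U =\<^sub>a\<^sub>e pair_lincomb k [(f, \<lambda>x. 0), (\<lambda>x. 0, g)]"
      using p q unfolding fp gp
      by (intro exI[of _ "\<lambda>i. if i = 0 then p else q"]) (simp add: pair_lincomb_2 pair_aeq_iff)
  qed
  then have mult2: "has_multiplicity L T 0 2"
    unfolding has_multiplicity_def by (intro exI[of _ "[(f, \<lambda>x. 0), (\<lambda>x. 0, g)]"]) simp
  define R where "R = op_spectrum L T - {complex_of_real \<nu>0, 0}"
  \<comment> \<open>The resolvent exists off the periodic eigenvalues of the two components, so the
    spectrum consists of eigenvalues and inherits their discreteness.\<close>
  have sub: "op_spectrum L T \<subseteq> {\<mu>. per_eig V1 L \<mu>} \<union> {\<mu>. per_eig V2 L \<mu>}"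
    using resolvent_pair_op[OF V_continuous(1) V_periodic(1) V_continuous(2) V_periodic(2) L]
    by (auto simp: op_spectrum_def T_def)
  have R1: "\<forall>\<mu>\<in>R. is_eigenvalue L T \<mu>"
    using is_eigenvalue_pair_op[OF Vc(1) V_periodic(1) Vc(2) V_periodic(2) L] sub by (auto simp: R_def T_def)
  have "({\<mu>. per_eig V1 L \<mu>} \<union> {\<mu>. per_eig V2 L \<mu>}) sparse_in UNIV"
    by (intro sparse_in_union' per_eig_sparse Vc L)
  then have R2: "R sparse_in UNIV" by (rule sparse_in_subset2) (use sub in \<open>auto simp: R_def\<close>)
  \<comment> \<open>Discreteness at the point 0 itself provides the gap around 0.\<close>
  then have "\<not> 0 islimpt R" by (simp add: sparse_in_open)
  then obtain \<delta> where "0 < \<delta>" "\<And>\<mu>. \<mu> \<in> R \<Longrightarrow> \<mu> \<noteq> 0 \<Longrightarrow> \<not> dist \<mu> 0 < \<delta>"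
    unfolding islimpt_approachable by blast
  then have R3: "\<exists>\<delta>>0. \<forall>\<mu>\<in>R. \<delta> \<le> cmod \<mu>" by (intro exI[of _ \<delta>]) (auto simp: R_def not_less)
  show ?thesis
    unfolding T Let_def deriv_\<phi> f_def[symmetric] g_def[symmetric]
    using neg eigneg mult1 mult2 basis0 R1 R2 R3 unfolding R_def by - (rule exI[of _ \<nu>0], intro conjI allI)
qed


end
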